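(* Let $G=\langle X\rangle$ and $H=\langle Y\rangle$ be finitely generated groups with logspace normal forms. Suppose furthermore that the free product $G\ast H$ has logspace decidable word problem. Then $G\ast H$ has a logspace normal form.
   Context: A deterministic logspace transducer is a deterministic machine with a finite state control and three tapes: a read-only input tape storing the input word; a read-write work tape restricted to at most $c\log n$ squares, where $n$ is the length of the input word and $c$ is a fixed constant; and a write-only output tape written from left to right. In each transition it may modify the work tape, change state, move the input read-head, and write at most a fixed constant number of letters to the output tape. For finite alphabets $X,Y$, a function $f:X^*\to Y^*$ is logspace computable if some deterministic logspace transducer outputs $f(w)$ on every input $w\in X^*$ ($X^*$ is the set of finite words over $X$, including the empty word $\lambda$). Let $G$ be a group with finite symmetric (closed under inverses) generating set $X$; for $w\in X^*$ let $\overline{w}\in G$ denote the element it represents. A normal form for $(G,X)$ is a subset $L\subseteq X^*$ such that $w\mapsto\overline{w}$ restricts to a bijection $L\to G$. A logspace normal form function for $(G,X)$ is a logspace computable $f:X^*\to X^*$ such that, for some normal form $L$, $f(w)$ is the unique element of $L$ with $\overline{f(w)}=\overline{w}$, for all $w\in X^*$. $(G,X)$ has a logspace normal form if it has a logspace normal form function; $G$ has a logspace normal form if $(G,X)$ does for some finite symmetric generating set $X$. The word problem for a finitely generated group asks to decide, given a word over a finite symmetric generating set, whether it represents the identity; it is logspace decidable if this can be decided by a deterministic logspace machine. *)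

theory Defs
  imports Complex_Main "HOL-Algebra.Generated_Groups"
begin

section \<open>Logspace transducers\<close>

datatype 'x in_sym = LeftEnd | Letter 'x | RightEnd

datatype move = MoveLeft | Stay | MoveRight

text \<open>
  States and work tape symbols are coded by natural numbers; \<open>0\<close> is the blank.
  The transition function maps state, scanned input square and scanned work square to the
  new state, the symbol written to the work tape, the moves of the work head and of the input
  head, and the word appended to the output tape; \<open>None\<close> means that the machine halts.
\<close>

record ('x, 'y) transducer =
  states :: "nat set"
  work_syms :: "nat set"
  start :: nat
  delta :: "nat \<Rightarrow> 'x in_sym \<Rightarrow> nat \<Rightarrow> (nat \<times> nat \<times> move \<times> move \<times> 'y list) option"

text \<open>
  Only finitely many triples (state, input symbol, work symbol) matter when \<open>X\<close> is finite, so
  the number of letters output in one transition is bounded by a constant of the machine.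
\<close>

definition wf_transducer :: "'x set \<Rightarrow> 'y set \<Rightarrow> ('x, 'y) transducer \<Rightarrow> bool" where
  "wf_transducer X Y M \<longleftrightarrow>
     finite (states M) \<and> finite (work_syms M) \<and> start M \<in> states M \<and> 0 \<in> work_syms M \<and>
     (\<forall>q \<in> states M. \<forall>a \<in> {LeftEnd, RightEnd} \<union> Letter ` X. \<forall>s \<in> work_syms M.
        \<forall>q' s' d e u. delta M q a s = Some (q', s', d, e, u) \<longrightarrow>
          q' \<in> states M \<and> s' \<in> work_syms M \<and> u \<in> lists Y)"

record 'y config =
  state :: nat
  in_pos :: nat
  work :: "nat \<Rightarrow> nat"
  work_pos :: nat
  outp :: "'y list"

text \<open>
  The input word \<open>w\<close> occupies the squares \<open>1, \<dots>, length w\<close>, between two end markers.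
  A head told to leave its tape (the input head at either end marker, the work head at the left
  end of the one-way infinite work tape) stays where it is.
\<close>

definition in_sym_at :: "'x list \<Rightarrow> nat \<Rightarrow> 'x in_sym" where
  "in_sym_at w i =
     (if i = 0 then LeftEnd else if i \<le> length w then Letter (w ! (i - 1)) else RightEnd)"

fun move_head :: "move \<Rightarrow> nat \<Rightarrow> nat" where
  "move_head MoveLeft i = i - 1"
| "move_head Stay i = i"
| "move_head MoveRight i = i + 1"

definition init_config :: "('x, 'y) transducer \<Rightarrow> 'y config" where
  "init_config M = \<lparr>state = start M, in_pos = 0, work = (\<lambda>_. 0), work_pos = 0, outp = []\<rparr>"

definition cur_delta ::
  "('x, 'y) transducer \<Rightarrow> 'x list \<Rightarrow> 'y config \<Rightarrow> (nat \<times> nat \<times> move \<times> move \<times> 'y list) option" where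
  "cur_delta M w c = delta M (state c) (in_sym_at w (in_pos c)) (work c (work_pos c))"

definition halted :: "('x, 'y) transducer \<Rightarrow> 'x list \<Rightarrow> 'y config \<Rightarrow> bool" where
  "halted M w c \<longleftrightarrow> cur_delta M w c = None"

definition next_config :: "('x, 'y) transducer \<Rightarrow> 'x list \<Rightarrow> 'y config \<Rightarrow> 'y config" where
  "next_config M w c =
     (case cur_delta M w c of
        None \<Rightarrow> c
      | Some (q, s, d, e, u) \<Rightarrow>
          \<lparr>state = q,
           in_pos = min (move_head e (in_pos c)) (length w + 1),
           work = (work c)(work_pos c := s),
           work_pos = move_head d (work_pos c),
           outp = outp c @ u\<rparr>)"

definition config_at :: "('x, 'y) transducer \<Rightarrow> 'x list \<Rightarrow> nat \<Rightarrow> 'y config" where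
  "config_at M w t = (next_config M w ^^ t) (init_config M)"

definition outputs :: "('x, 'y) transducer \<Rightarrow> 'x list \<Rightarrow> 'y list \<Rightarrow> bool" where
  "outputs M w v \<longleftrightarrow> (\<exists>t. halted M w (config_at M w t) \<and> outp (config_at M w t) = v)"

text \<open>
  The work head never leaves the first \<open>c log n\<close> squares. The shift by \<open>2\<close> only serves to leave
  a constant number of squares for \<open>n \<le> 1\<close>; for \<open>n \<ge> 2\<close> it is absorbed by the constant \<open>c\<close>,
  since \<open>log (n + 2) \<le> 2 log n\<close>.
\<close>

definition logspace_bounded :: "'x set \<Rightarrow> ('x, 'y) transducer \<Rightarrow> bool" where
  "logspace_bounded X M \<longleftrightarrow>
     (\<exists>c::nat. \<forall>w \<in> lists X. \<forall>t.
        real (work_pos (config_at M w t) + 1) \<le> real c * log 2 (real (length w) + 2))"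

definition logspace_computable :: "'x set \<Rightarrow> 'y set \<Rightarrow> ('x list \<Rightarrow> 'y list) \<Rightarrow> bool" where
  "logspace_computable X Y f \<longleftrightarrow>
     finite X \<and> finite Y \<and>
     (\<exists>M. wf_transducer X Y M \<and> logspace_bounded X M \<and> (\<forall>w \<in> lists X. outputs M w (f w)))"

text \<open>A decision procedure is a transducer that answers with the one-letter word yes or no.\<close>

definition logspace_decidable :: "'x set \<Rightarrow> 'x list set \<Rightarrow> bool" where
  "logspace_decidable X A \<longleftrightarrow> logspace_computable X (UNIV :: bool set) (\<lambda>w. [w \<in> A])"


section \<open>Normal forms and the word problem\<close>

definition fin_sym_gen :: "('a, 'b) monoid_scheme \<Rightarrow> 'a set \<Rightarrow> bool" where
  "fin_sym_gen G X \<longleftrightarrow>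
     finite X \<and> X \<subseteq> carrier G \<and> (\<forall>x \<in> X. inv\<^bsub>G\<^esub> x \<in> X) \<and> generate G X = carrier G"

definition word_val :: "('a, 'b) monoid_scheme \<Rightarrow> 'a list \<Rightarrow> 'a" where
  "word_val G w = foldr (\<lambda>x y. x \<otimes>\<^bsub>G\<^esub> y) w \<one>\<^bsub>G\<^esub>"

definition normal_form :: "('a, 'b) monoid_scheme \<Rightarrow> 'a set \<Rightarrow> 'a list set \<Rightarrow> bool" where
  "normal_form G X L \<longleftrightarrow> L \<subseteq> lists X \<and> bij_betw (word_val G) L (carrier G)"

definition logspace_normal_form_function ::
  "('a, 'b) monoid_scheme \<Rightarrow> 'a set \<Rightarrow> ('a list \<Rightarrow> 'a list) \<Rightarrow> bool" where
  "logspace_normal_form_function G X f \<longleftrightarrow>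
     logspace_computable X X f \<and>
     (\<exists>L. normal_form G X L \<and>
        (\<forall>w \<in> lists X. f w \<in> L \<and> word_val G (f w) = word_val G w))"

definition has_logspace_normal_form :: "('a, 'b) monoid_scheme \<Rightarrow> bool" where
  "has_logspace_normal_form G \<longleftrightarrow>
     (\<exists>X f. fin_sym_gen G X \<and> logspace_normal_form_function G X f)"

definition word_problem :: "('a, 'b) monoid_scheme \<Rightarrow> 'a set \<Rightarrow> 'a list set" where
  "word_problem G X = {w \<in> lists X. word_val G w = \<one>\<^bsub>G\<^esub>}"

definition has_logspace_word_problem :: "('a, 'b) monoid_scheme \<Rightarrow> bool" where
  "has_logspace_word_problem G \<longleftrightarrow>
     (\<exists>X. fin_sym_gen G X \<and> logspace_decidable X (word_problem G X))"


section \<open>Free products\<close>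

text \<open>
  The free product is the quotient of the free monoid on the disjoint union of the carriers by
  the congruence that multiplies adjacent letters from the same factor and deletes the letters
  that are identities. The universal property is proved below.
\<close>

abbreviation fp_words :: "('a, 'c) monoid_scheme \<Rightarrow> ('b, 'd) monoid_scheme \<Rightarrow> ('a + 'b) list set" where
  "fp_words G H \<equiv> lists (carrier G <+> carrier H)"

inductive fp_eq :: "('a, 'c) monoid_scheme \<Rightarrow> ('b, 'd) monoid_scheme \<Rightarrow>
    ('a + 'b) list \<Rightarrow> ('a + 'b) list \<Rightarrow> bool"
  for G and H where
  one_l: "u \<in> fp_words G H \<Longrightarrow> v \<in> fp_words G H \<Longrightarrow>
    fp_eq G H (u @ [Inl \<one>\<^bsub>G\<^esub>] @ v) (u @ v)"
| one_r: "u \<in> fp_words G H \<Longrightarrow> v \<in> fp_words G H \<Longrightarrow>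
    fp_eq G H (u @ [Inr \<one>\<^bsub>H\<^esub>] @ v) (u @ v)"
| mult_l: "u \<in> fp_words G H \<Longrightarrow> v \<in> fp_words G H \<Longrightarrow> x \<in> carrier G \<Longrightarrow> y \<in> carrier G \<Longrightarrow>
    fp_eq G H (u @ [Inl x, Inl y] @ v) (u @ [Inl (x \<otimes>\<^bsub>G\<^esub> y)] @ v)"
| mult_r: "u \<in> fp_words G H \<Longrightarrow> v \<in> fp_words G H \<Longrightarrow> x \<in> carrier H \<Longrightarrow> y \<in> carrier H \<Longrightarrow>
    fp_eq G H (u @ [Inr x, Inr y] @ v) (u @ [Inr (x \<otimes>\<^bsub>H\<^esub> y)] @ v)"
| refl: "u \<in> fp_words G H \<Longrightarrow> fp_eq G H u u"
| sym: "fp_eq G H u v \<Longrightarrow> fp_eq G H v u"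
| trans: "fp_eq G H u v \<Longrightarrow> fp_eq G H v w \<Longrightarrow> fp_eq G H u w"

definition fp_rel ::
  "('a, 'c) monoid_scheme \<Rightarrow> ('b, 'd) monoid_scheme \<Rightarrow> (('a + 'b) list \<times> ('a + 'b) list) set" where
  "fp_rel G H = {(u, v). fp_eq G H u v}"

definition free_product ::
  "('a, 'c) monoid_scheme \<Rightarrow> ('b, 'd) monoid_scheme \<Rightarrow> ('a + 'b) list set monoid" where
  "free_product G H =
     \<lparr>carrier = fp_words G H // fp_rel G H,
      mult = (\<lambda>A B. \<Union>u \<in> A. \<Union>v \<in> B. fp_rel G H `` {u @ v}),
      one = fp_rel G H `` {[]}\<rparr>"

definition fp_inl ::
  "('a, 'c) monoid_scheme \<Rightarrow> ('b, 'd) monoid_scheme \<Rightarrow> 'a \<Rightarrow> ('a + 'b) list set" where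
  "fp_inl G H x = fp_rel G H `` {[Inl x]}"

definition fp_inr ::
  "('a, 'c) monoid_scheme \<Rightarrow> ('b, 'd) monoid_scheme \<Rightarrow> 'b \<Rightarrow> ('a + 'b) list set" where
  "fp_inr G H y = fp_rel G H `` {[Inr y]}"

context
  fixes G :: "('a, 'c) monoid_scheme" and H :: "('b, 'd) monoid_scheme"
  assumes G: "group G" and H: "group H"
begin

interpretation G: group G by (rule G)
interpretation H: group H by (rule H)

lemma fp_eq_words: "fp_eq G H u v \<Longrightarrow> u \<in> fp_words G H \<and> v \<in> fp_words G H"
  by (induction rule: fp_eq.induct) auto

lemma fp_eq_append_left:
  "fp_eq G H u v \<Longrightarrow> w \<in> fp_words G H \<Longrightarrow> fp_eq G H (w @ u) (w @ v)"
proof (induction rule: fp_eq.induct)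
  case (one_l u v)
  then show ?case using fp_eq.one_l[of "w @ u" G H v] by simp
next
  case (one_r u v)
  then show ?case using fp_eq.one_r[of "w @ u" G H v] by simp
next
  case (mult_l u v x y)
  then show ?case using fp_eq.mult_l[of "w @ u" G H v x y] by simp
next
  case (mult_r u v x y)
  then show ?case using fp_eq.mult_r[of "w @ u" G H v x y] by simp
next
  case (refl u)
  then show ?case using fp_eq.refl[of "w @ u" G H] by simp
qed (blast intro: fp_eq.sym fp_eq.trans)+

lemma fp_eq_append_right:
  "fp_eq G H u v \<Longrightarrow> w \<in> fp_words G H \<Longrightarrow> fp_eq G H (u @ w) (v @ w)"
proof (induction rule: fp_eq.induct)
  case (one_l u v)
  then show ?case using fp_eq.one_l[of u G H "v @ w"] by simp
next
  case (one_r u v)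
  then show ?case using fp_eq.one_r[of u G H "v @ w"] by simp
next
  case (mult_l u v x y)
  then show ?case using fp_eq.mult_l[of u G H "v @ w" x y] by simp
next
  case (mult_r u v x y)
  then show ?case using fp_eq.mult_r[of u G H "v @ w" x y] by simp
next
  case (refl u)
  then show ?case using fp_eq.refl[of "u @ w" G H] by simp
qed (blast intro: fp_eq.sym fp_eq.trans)+

lemma fp_eq_append:
  assumes "fp_eq G H u u'" "fp_eq G H v v'"
  shows "fp_eq G H (u @ v) (u' @ v')"
  using assms fp_eq_append_left fp_eq_append_right fp_eq_words fp_eq.trans by metis

lemma equiv_fp_rel: "equiv (fp_words G H) (fp_rel G H)"
proof (rule equivI)
  show "fp_rel G H \<subseteq> fp_words G H \<times> fp_words G H"
    using fp_eq_words by (auto simp: fp_rel_def)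
  show "refl_on (fp_words G H) (fp_rel G H)"
    using fp_eq.refl by (fastforce simp: fp_rel_def refl_on_def)
  show "Relation.sym (fp_rel G H)"
    by (auto simp: fp_rel_def sym_def intro: fp_eq.sym)
  show "Relation.trans (fp_rel G H)"
    using fp_eq.trans by (fastforce simp: fp_rel_def trans_def)
qed

lemma fp_class_eq_iff:
  assumes "u \<in> fp_words G H" "v \<in> fp_words G H"
  shows "fp_rel G H `` {u} = fp_rel G H `` {v} \<longleftrightarrow> fp_eq G H u v"
  using eq_equiv_class_iff[OF equiv_fp_rel assms] by (simp add: fp_rel_def)

lemma fp_mult_class:
  assumes "u \<in> fp_words G H" "v \<in> fp_words G H"
  shows "fp_rel G H `` {u} \<otimes>\<^bsub>free_product G H\<^esub> fp_rel G H `` {v} = fp_rel G H `` {u @ v}"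
proof -
  have "congruent2 (fp_rel G H) (fp_rel G H) (\<lambda>u v. fp_rel G H `` {u @ v})"
    by (rule congruent2I')
      (auto simp: fp_rel_def intro: fp_eq.sym fp_eq.trans fp_eq_append)
  from UN_equiv_class2[OF equiv_fp_rel equiv_fp_rel this assms]
  show ?thesis by (simp add: free_product_def)
qed

lemma fp_carrier: "carrier (free_product G H) = (\<lambda>u. fp_rel G H `` {u}) ` fp_words G H"
  by (auto simp: free_product_def quotient_def)

lemma fp_one: "\<one>\<^bsub>free_product G H\<^esub> = fp_rel G H `` {[]}"
  by (simp add: free_product_def)

lemma fp_left_inverse:
  assumes "u \<in> fp_words G H"
  shows "\<exists>v \<in> fp_words G H. fp_eq G H (v @ u) []"
  using assms
proof (induction u)
  case Nil
  then show ?case by (auto intro: fp_eq.refl)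
next
  case (Cons a u)
  then have u: "u \<in> fp_words G H" and a: "a \<in> carrier G <+> carrier H" by auto
  from Cons obtain v where v: "v \<in> fp_words G H" "fp_eq G H (v @ u) []" by auto
  have "\<exists>b \<in> carrier G <+> carrier H. fp_eq G H (v @ [b, a] @ u) (v @ u)"
    using a
  proof (cases a)
    case (Inl x)
    then have x: "x \<in> carrier G" using a by auto
    have "fp_eq G H (v @ [Inl (inv\<^bsub>G\<^esub> x), Inl x] @ u) (v @ [Inl \<one>\<^bsub>G\<^esub>] @ u)"
      using fp_eq.mult_l[OF v(1) u, of "inv\<^bsub>G\<^esub> x" x] x by simp
    then show ?thesis using fp_eq.trans fp_eq.one_l[OF v(1) u] x Inl
      by (intro bexI[of _ "Inl (inv\<^bsub>G\<^esub> x)"]) auto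
  next
    case (Inr y)
    then have y: "y \<in> carrier H" using a by auto
    have "fp_eq G H (v @ [Inr (inv\<^bsub>H\<^esub> y), Inr y] @ u) (v @ [Inr \<one>\<^bsub>H\<^esub>] @ u)"
      using fp_eq.mult_r[OF v(1) u, of "inv\<^bsub>H\<^esub> y" y] y by simp
    then show ?thesis using fp_eq.trans fp_eq.one_r[OF v(1) u] y Inr
      by (intro bexI[of _ "Inr (inv\<^bsub>H\<^esub> y)"]) auto
  qed
  then obtain b where b: "b \<in> carrier G <+> carrier H" "fp_eq G H (v @ [b, a] @ u) (v @ u)"
    by auto
  have "fp_eq G H ((v @ [b]) @ a # u) []" using fp_eq.trans[OF b(2) v(2)] by simp
  then show ?case using b(1) v(1) by (intro bexI[of _ "v @ [b]"]) auto
qed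

lemma group_free_product: "group (free_product G H)"
proof (rule groupI)
  fix A B assume "A \<in> carrier (free_product G H)" "B \<in> carrier (free_product G H)"
  then obtain u v where "u \<in> fp_words G H" "A = fp_rel G H `` {u}"
    "v \<in> fp_words G H" "B = fp_rel G H `` {v}" by (auto simp: fp_carrier)
  then show "A \<otimes>\<^bsub>free_product G H\<^esub> B \<in> carrier (free_product G H)"
    using fp_mult_class[of u v] imageI[of "u @ v" "fp_words G H" "\<lambda>u. fp_rel G H `` {u}"]
    by (simp add: fp_carrier)
next
  show "\<one>\<^bsub>free_product G H\<^esub> \<in> carrier (free_product G H)" by (auto simp: fp_carrier fp_one)
next
  fix A B C
  assume "A \<in> carrier (free_product G H)" "B \<in> carrier (free_product G H)"
    "C \<in> carrier (free_product G H)"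
  then obtain u v w where "u \<in> fp_words G H" "A = fp_rel G H `` {u}"
    "v \<in> fp_words G H" "B = fp_rel G H `` {v}" "w \<in> fp_words G H" "C = fp_rel G H `` {w}"
    by (auto simp: fp_carrier)
  then show "A \<otimes>\<^bsub>free_product G H\<^esub> B \<otimes>\<^bsub>free_product G H\<^esub> C =
      A \<otimes>\<^bsub>free_product G H\<^esub> (B \<otimes>\<^bsub>free_product G H\<^esub> C)"
    using fp_mult_class[of u v] fp_mult_class[of "u @ v" w] fp_mult_class[of v w]
      fp_mult_class[of u "v @ w"] by simp
next
  fix A assume "A \<in> carrier (free_product G H)"
  then obtain u where "u \<in> fp_words G H" "A = fp_rel G H `` {u}" by (auto simp: fp_carrier)
  then show "\<one>\<^bsub>free_product G H\<^esub> \<otimes>\<^bsub>free_product G H\<^esub> A = A"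
    using fp_mult_class[of "[]" u] by (simp add: fp_one)
next
  fix A assume "A \<in> carrier (free_product G H)"
  then obtain u where u: "u \<in> fp_words G H" "A = fp_rel G H `` {u}" by (auto simp: fp_carrier)
  obtain v where v: "v \<in> fp_words G H" "fp_eq G H (v @ u) []" using fp_left_inverse[OF u(1)] by auto
  then have "fp_rel G H `` {v} \<otimes>\<^bsub>free_product G H\<^esub> A = \<one>\<^bsub>free_product G H\<^esub>"
    using u fp_mult_class fp_class_eq_iff[of "v @ u" "[]"] by (simp add: fp_one)
  then show "\<exists>B \<in> carrier (free_product G H). B \<otimes>\<^bsub>free_product G H\<^esub> A = \<one>\<^bsub>free_product G H\<^esub>"
    using v by (auto simp: fp_carrier)
qed

lemma fp_inl_hom: "fp_inl G H \<in> hom G (free_product G H)"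
proof (rule homI)
  fix x y assume "x \<in> carrier G" "y \<in> carrier G"
  then show "fp_inl G H (x \<otimes>\<^bsub>G\<^esub> y) = fp_inl G H x \<otimes>\<^bsub>free_product G H\<^esub> fp_inl G H y"
    using fp_eq.mult_l[of "[]" G H "[]" x y] fp_class_eq_iff[of "[Inl x, Inl y]" "[Inl (x \<otimes>\<^bsub>G\<^esub> y)]"]
      fp_mult_class[of "[Inl x]" "[Inl y]"]
    by (simp add: fp_inl_def InlI InrI)
qed (auto simp: fp_inl_def fp_carrier)

lemma fp_inr_hom: "fp_inr G H \<in> hom H (free_product G H)"
proof (rule homI)
  fix x y assume "x \<in> carrier H" "y \<in> carrier H"
  then show "fp_inr G H (x \<otimes>\<^bsub>H\<^esub> y) = fp_inr G H x \<otimes>\<^bsub>free_product G H\<^esub> fp_inr G H y"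
    using fp_eq.mult_r[of "[]" G H "[]" x y] fp_class_eq_iff[of "[Inr x, Inr y]" "[Inr (x \<otimes>\<^bsub>H\<^esub> y)]"]
      fp_mult_class[of "[Inr x]" "[Inr y]"]
    by (simp add: fp_inr_def InlI InrI)
qed (auto simp: fp_inr_def fp_carrier)

lemma free_product_lift_exists:
  fixes K :: "('k, 'e) monoid_scheme"
  assumes K: "group K" and \<phi>: "\<phi> \<in> hom G K" and \<psi>: "\<psi> \<in> hom H K"
  shows "\<exists>\<theta> \<in> hom (free_product G H) K.
    (\<forall>x \<in> carrier G. \<theta> (fp_inl G H x) = \<phi> x) \<and> (\<forall>y \<in> carrier H. \<theta> (fp_inr G H y) = \<psi> y)"
proof -
  interpret K: group K by (rule K)
  interpret p: group_hom G K \<phi> using \<phi> by unfold_locales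
  interpret q: group_hom H K \<psi> using \<psi> by unfold_locales
  define ev where "ev w = word_val K (map (case_sum \<phi> \<psi>) w)" for w
  have ev_simps [simp]: "ev [] = \<one>\<^bsub>K\<^esub>" "ev (Inl x # w) = \<phi> x \<otimes>\<^bsub>K\<^esub> ev w"
    "ev (Inr y # w) = \<psi> y \<otimes>\<^bsub>K\<^esub> ev w" for x y w
    by (auto simp: ev_def word_val_def)
  have ev_closed [simp]: "ev w \<in> carrier K" if "w \<in> fp_words G H" for w
    using that by (induction w) auto
  have ev_append: "ev (u @ v) = ev u \<otimes>\<^bsub>K\<^esub> ev v"
    if "u \<in> fp_words G H" "v \<in> fp_words G H" for u v
    using that(1)
  proof (induction u)
    case (Cons a u)
    then have u: "u \<in> fp_words G H" by simp
    from Cons have "a \<in> carrier G <+> carrier H" by simp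
    then show ?case
      using Cons.IH K.m_assoc[OF _ ev_closed[OF u] ev_closed[OF that(2)]] by auto
  qed (use ev_closed[OF that(2)] in simp)
  have ev_eq: "ev u = ev v" if "fp_eq G H u v" for u v
    using that
  proof (induction rule: fp_eq.induct)
    case (mult_l u v x y)
    then show ?case using ev_append[of u "Inl x # Inl y # v"] ev_append[of u "Inl (x \<otimes>\<^bsub>G\<^esub> y) # v"]
      by (auto simp: K.m_assoc InlI InrI)
  next
    case (mult_r u v x y)
    then show ?case using ev_append[of u "Inr x # Inr y # v"] ev_append[of u "Inr (x \<otimes>\<^bsub>H\<^esub> y) # v"]
      by (auto simp: K.m_assoc InlI InrI)
  next
    case (one_l u v)
    then show ?case using ev_append[of u "Inl \<one>\<^bsub>G\<^esub> # v"] ev_append[of u v] by (auto simp: InlI InrI)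
  next
    case (one_r u v)
    then show ?case using ev_append[of u "Inr \<one>\<^bsub>H\<^esub> # v"] ev_append[of u v] by (auto simp: InlI InrI)
  qed auto
  define \<theta> where "\<theta> A = ev (SOME u. u \<in> A)" for A
  have \<theta>: "\<theta> (fp_rel G H `` {u}) = ev u" if "u \<in> fp_words G H" for u
  proof -
    have "u \<in> fp_rel G H `` {u}" using that by (auto simp: fp_rel_def intro: fp_eq.refl)
    then have "(SOME v. v \<in> fp_rel G H `` {u}) \<in> fp_rel G H `` {u}" by (rule someI)
    then show ?thesis using ev_eq by (auto simp: \<theta>_def fp_rel_def)
  qed
  show ?thesis
  proof (intro bexI[of _ \<theta>] conjI ballI)
    show "\<theta> \<in> hom (free_product G H) K"
    proof (rule homI)
      fix A assume "A \<in> carrier (free_product G H)"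
      then obtain u where u: "u \<in> fp_words G H" "A = fp_rel G H `` {u}" by (auto simp: fp_carrier)
      show "\<theta> A \<in> carrier K" using \<theta>[OF u(1)] ev_closed[OF u(1)] u(2) by simp
    next
      fix A B assume "A \<in> carrier (free_product G H)" "B \<in> carrier (free_product G H)"
      then obtain u v where u: "u \<in> fp_words G H" "A = fp_rel G H `` {u}"
        and v: "v \<in> fp_words G H" "B = fp_rel G H `` {v}" by (auto simp: fp_carrier)
      have "u @ v \<in> fp_words G H" using u(1) v(1) by simp
      then show "\<theta> (A \<otimes>\<^bsub>free_product G H\<^esub> B) = \<theta> A \<otimes>\<^bsub>K\<^esub> \<theta> B"
        using u v \<theta>[of u] \<theta>[of v] \<theta>[of "u @ v"] fp_mult_class[of u v] ev_append[of u v] by simp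
    qed
  qed (auto simp: fp_inl_def fp_inr_def \<theta> InlI InrI)
qed

lemma free_product_lift_unique:
  fixes K :: "('k, 'e) monoid_scheme"
  assumes K: "group K"
    and \<theta>: "\<theta> \<in> hom (free_product G H) K" and \<theta>': "\<theta>' \<in> hom (free_product G H) K"
    and l: "\<And>x. x \<in> carrier G \<Longrightarrow> \<theta> (fp_inl G H x) = \<theta>' (fp_inl G H x)"
    and r: "\<And>y. y \<in> carrier H \<Longrightarrow> \<theta> (fp_inr G H y) = \<theta>' (fp_inr G H y)"
    and A: "A \<in> carrier (free_product G H)"
  shows "\<theta> A = \<theta>' A"
proof -
  interpret P: group "free_product G H" by (rule group_free_product)
  interpret t: group_hom "free_product G H" K \<theta> using K \<theta> by (auto simp: group_hom_def group_hom_axioms_def P.is_group)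
  interpret t': group_hom "free_product G H" K \<theta>' using K \<theta>' by (auto simp: group_hom_def group_hom_axioms_def P.is_group)
  have "\<theta> (fp_rel G H `` {u}) = \<theta>' (fp_rel G H `` {u})" if "u \<in> fp_words G H" for u
    using that
  proof (induction u)
    case Nil
    then show ?case using t.hom_one t'.hom_one by (simp add: fp_one)
  next
    case (Cons a u)
    then have u: "u \<in> fp_words G H" and a: "a \<in> carrier G <+> carrier H" by auto
    have *: "fp_rel G H `` {a # u} = fp_rel G H `` {[a]} \<otimes>\<^bsub>free_product G H\<^esub> fp_rel G H `` {u}"
      using fp_mult_class[of "[a]" u] a u by simp
    have "\<theta> (fp_rel G H `` {[a]}) = \<theta>' (fp_rel G H `` {[a]})"
      using a l r by (auto simp: fp_inl_def fp_inr_def)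
    moreover have "fp_rel G H `` {[a]} \<in> carrier (free_product G H)"
      "fp_rel G H `` {u} \<in> carrier (free_product G H)"
      using a u by (auto simp: fp_carrier)
    ultimately show ?case using Cons u by (simp add: *)
  qed
  then show ?thesis using A by (auto simp: fp_carrier)
qed

end

end

theory Submission
  imports Defs
begin

text \<open>
  An element of \<open>G * H\<close> is an alternating product \<open>g\<^sub>1 h\<^sub>1 \<dots> g\<^sub>k h\<^sub>k\<close> with \<open>k \<ge> 1\<close> of syllables
  from \<open>G\<close> and \<open>H\<close>, unique once all syllables except possibly the first and the last are
  required to be nontrivial. Its normal form is obtained by writing every syllable in the normal
  form of its factor. The task is to find the syllables of the element given by a word \<open>w\<close> with
  a logarithmic amount of memory.

  Write \<open>w(i, j]\<close> for the letters \<open>i + 1, \<dots>, j\<close> of \<open>w\<close>. If \<open>j\<close> is the last position such that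
  \<open>w(i, j]\<close> represents an element \<open>g\<close> of \<open>G\<close>, then \<open>g\<close> is the first \<open>G\<close>-syllable of the suffix
  that starts after position \<open>i\<close>, and the suffix after position \<open>j\<close> has no \<open>G\<close>-syllable in front
  (\<open>longest_prefix_is_syllable\<close>). The reason is that a word whose reduced form begins with the
  syllable \<open>s\<close> has a nonempty prefix with value \<open>s\<close> (\<open>prefix_of_first_syllable\<close>): a \<open>G\<close>-syllable
  left in front would therefore extend the window. Taking longest windows for \<open>G\<close> and for \<open>H\<close> in
  turn yields all syllables, and these depend on the element only.

  Whether \<open>w(i, j]\<close> lies in \<open>G\<close> is an instance of the word problem. Let \<open>\<rho>\<close> be the retraction of
  \<open>G * H\<close> onto \<open>G\<close> that kills \<open>H\<close>. An element \<open>x\<close> lies in \<open>G\<close> iff \<open>x \<rho>(x)\<^sup>-\<^sup>1 = 1\<close>, and a word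
  for the left side arises from \<open>w(i, j]\<close> letter by letter: one pass forwards for \<open>x\<close> and one
  pass backwards for the inverse of \<open>\<rho>(x)\<close> (\<open>in_factor_iff\<close>). If \<open>x\<close> lies in \<open>G\<close>, then the
  syllable is represented by \<open>w(i, j]\<close> with each letter replaced by its retraction, and the
  machine for \<open>G\<close> rewrites that word. So it suffices to remember the window and to simulate the
  given machines on words that are read off the window on the fly (\<open>awp_sim\<close>). Two binary
  counters, for the distances from the input head to the two ends of the window, and the work
  tape of the simulated machine are what the work tape has to hold.

  Transducers with a single work tape are inconvenient to program. The construction is therefore
  carried out for structured programs over a finite control state and finitely many stacks, with
  a predicate transformer \<open>wp\<close> that demands termination and bounded stack heights. One theorem,
  \<open>logspace_computable_prog\<close>, turns such programs into logspace transducers: each stack occupies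
  a track of the work tape.
\<close>

section \<open>Programs with finitely many stacks\<close>

text \<open>
  Programs work on a control state of type \<open>'f\<close>, a two-way input head, stacks named by \<open>'r\<close> and
  an output tape. Only \<open>Act\<close> sees the input, and \<open>Pop\<close> on an empty stack reports \<open>None\<close>, which
  is the only way to inspect a stack.
\<close>

datatype ('f, 'r, 'x, 'y) prog =
    Act "'f \<Rightarrow> 'x in_sym \<Rightarrow> 'f \<times> move \<times> 'y list"
  | Push 'r "'f \<Rightarrow> nat"
  | Pop 'r "nat option \<Rightarrow> 'f \<Rightarrow> 'f"
  | Seq "('f, 'r, 'x, 'y) prog" "('f, 'r, 'x, 'y) prog"
  | Cond "'f \<Rightarrow> bool" "('f, 'r, 'x, 'y) prog" "('f, 'r, 'x, 'y) prog"
  | Loop "'f \<Rightarrow> bool" "('f, 'r, 'x, 'y) prog"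

type_synonym ('f, 'r, 'y) store = "'f \<times> nat \<times> ('r \<Rightarrow> nat list) \<times> 'y list"

text \<open>
  Total correctness: a loop is a least fixed point, so \<open>wp w N c Q s\<close> implies that \<open>c\<close>
  terminates. The number \<open>N\<close> bounds the height of every stack; only a push can violate it.
\<close>

primrec wp :: "'x list \<Rightarrow> nat \<Rightarrow> ('f, 'r, 'x, 'y) prog \<Rightarrow>
    (('f, 'r, 'y) store \<Rightarrow> bool) \<Rightarrow> ('f, 'r, 'y) store \<Rightarrow> bool" where
  "wp w N (Act g) = (\<lambda>Q (f, p, st, o1). case g f (in_sym_at w p) of
     (f', e, u) \<Rightarrow> Q (f', min (move_head e p) (length w + 1), st, o1 @ u))"
| "wp w N (Push r g) = (\<lambda>Q (f, p, st, o1).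
     length (st r) < N \<and> Q (f, p, st(r := g f # st r), o1))"
| "wp w N (Pop r h) = (\<lambda>Q (f, p, st, o1). case st r of
     [] \<Rightarrow> Q (h None f, p, st, o1)
   | v # vs \<Rightarrow> Q (h (Some v) f, p, st(r := vs), o1))"
| "wp w N (Seq c d) = (\<lambda>Q. wp w N c (wp w N d Q))"
| "wp w N (Cond b c d) = (\<lambda>Q s. if b (fst s) then wp w N c Q s else wp w N d Q s)"
| "wp w N (Loop b c) = (\<lambda>Q. lfp (\<lambda>Z s. if b (fst s) then wp w N c Z s else Q s))"

lemma wp_mono: "Q \<le> Q' \<Longrightarrow> wp w N c Q \<le> wp w N c Q'"
proof (induction c arbitrary: Q Q')
  case (Act g)
  then show ?case by (auto 0 3 simp: le_fun_def split: prod.splits)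
next
  case (Push r g)
  then show ?case by (auto 0 3 simp: le_fun_def)
next
  case (Pop r h)
  then show ?case by (auto 0 3 simp: le_fun_def split: list.splits)
next
  case (Seq c d)
  then show ?case by simp
next
  case (Cond b c d)
  then show ?case by (simp add: le_fun_def)
next
  case (Loop b c)
  have "lfp (\<lambda>Z s. if b (fst s) then wp w N c Z s else Q s) \<le>
        lfp (\<lambda>Z s. if b (fst s) then wp w N c Z s else Q' s)"
    by (rule lfp_mono) (use Loop.prems in \<open>auto simp: le_fun_def\<close>)
  then show ?case by simp
qed

lemma wp_conseq:
  assumes "wp w N c Q s" "\<And>s'. Q s' \<Longrightarrow> Q' s'"
  shows "wp w N c Q' s"
proof -
  have "Q \<le> Q'" using assms(2) by (simp add: le_fun_def)
  from le_funD[OF wp_mono[OF this], of w N c s] assms(1) show ?thesis by simp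
qed

lemma wp_Loop_unfold:
  fixes c :: "('f, 'r, 'x, 'y) prog"
  shows "wp w N (Loop b c) Q s = (if b (fst s) then wp w N c (wp w N (Loop b c) Q) s else Q s)"
proof -
  have "mono (\<lambda>Z s. if b (fst s) then wp w N c Z s else Q s)"
  proof (rule monoI)
    fix Z Z' :: "('f, 'r, 'y) store \<Rightarrow> bool" assume "Z \<le> Z'"
    from wp_mono[OF this, of w N c]
    show "(\<lambda>s. if b (fst s) then wp w N c Z s else Q s) \<le>
        (\<lambda>s. if b (fst s) then wp w N c Z' s else Q s)"
      by (simp add: le_fun_def)
  qed
  from fun_cong[OF lfp_unfold[OF this], of s] show ?thesis by (simp only: wp.simps)
qed

text \<open>
  The control state stays in the set \<open>F\<close> and the stack symbols in \<open>S\<close>. Both will be finite,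
  which makes the compiled machine finite.
\<close>

primrec wf_prog :: "'x set \<Rightarrow> 'y set \<Rightarrow> 'f set \<Rightarrow> nat set \<Rightarrow> ('f, 'r, 'x, 'y) prog \<Rightarrow> bool" where
  "wf_prog X Y F S (Act g) \<longleftrightarrow>
     (\<forall>f \<in> F. \<forall>a \<in> {LeftEnd, RightEnd} \<union> Letter ` X. fst (g f a) \<in> F \<and> snd (snd (g f a)) \<in> lists Y)"
| "wf_prog X Y F S (Push r g) \<longleftrightarrow> (\<forall>f \<in> F. g f \<in> S)"
| "wf_prog X Y F S (Pop r h) \<longleftrightarrow> (\<forall>f \<in> F. \<forall>v \<in> insert None (Some ` S). h v f \<in> F)"
| "wf_prog X Y F S (Seq c d) \<longleftrightarrow> wf_prog X Y F S c \<and> wf_prog X Y F S d"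
| "wf_prog X Y F S (Cond b c d) \<longleftrightarrow> wf_prog X Y F S c \<and> wf_prog X Y F S d"
| "wf_prog X Y F S (Loop b c) \<longleftrightarrow> wf_prog X Y F S c"


section \<open>Compilation of stack programs to transducers\<close>

text \<open>
  The machine rests on square 0 in mode \<open>Ready\<close>. For a stack instruction it runs right in the
  same mode to the first square whose track is empty. \<open>Take\<close> is the step left onto the topmost
  symbol of a stack that is popped, and \<open>Back\<close> is the way back to square 0. \<open>Init\<close> marks square
  0 once and for all: a head that is told to leave the tape stays where it is, so without a mark
  the machine could not recognise the left end.
\<close>

datatype mode = Init | Ready | Back | Take

instance mode :: finite
proof
  have "UNIV = {Init, Ready, Back, Take}" using mode.exhaust by auto
  then show "finite (UNIV :: mode set)" by (metis finite.simps)
qed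

text \<open>
  A square carries the mark of the left end and one symbol or blank for every track.
\<close>

type_synonym 'r cell = "bool \<times> ('r \<Rightarrow> nat option)"

fun raw_step :: "('f, 'r, 'x, 'y) prog list \<times> 'f \<times> mode \<Rightarrow> 'x in_sym \<Rightarrow> 'r cell \<Rightarrow>
    ((('f, 'r, 'x, 'y) prog list \<times> 'f \<times> mode) \<times> 'r cell \<times> move \<times> move \<times> 'y list) option" where
  "raw_step (k, f, Init) a (m, t) = Some ((k, f, Ready), (True, t), Stay, Stay, [])"
| "raw_step (k, f, Back) a (m, t) =
     (if m then Some ((k, f, Ready), (m, t), Stay, Stay, [])
      else Some ((k, f, Back), (m, t), MoveLeft, Stay, []))"
| "raw_step (k, f, Take) a (m, t) =
     (case k of
        Pop r h # k' \<Rightarrow> Some ((k', h (t r) f, Back), (m, t(r := None)), Stay, Stay, [])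
      | _ \<Rightarrow> None)"
| "raw_step ([], f, Ready) a (m, t) = None"
| "raw_step (Act g # k, f, Ready) a (m, t) =
     (case g f a of (f', e, u) \<Rightarrow> Some ((k, f', Ready), (m, t), Stay, e, u))"
| "raw_step (Push r g # k, f, Ready) a (m, t) =
     (if t r = None then Some ((k, f, Back), (m, t(r := Some (g f))), Stay, Stay, [])
      else Some ((Push r g # k, f, Ready), (m, t), MoveRight, Stay, []))"
| "raw_step (Pop r h # k, f, Ready) a (m, t) =
     (if t r \<noteq> None then Some ((Pop r h # k, f, Ready), (m, t), MoveRight, Stay, [])
      else if m then Some ((k, h None f, Ready), (m, t), Stay, Stay, [])
      else Some ((Pop r h # k, f, Take), (m, t), MoveLeft, Stay, []))"
| "raw_step (Seq c d # k, f, Ready) a (m, t) = Some ((c # d # k, f, Ready), (m, t), Stay, Stay, [])"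
| "raw_step (Cond b c d # k, f, Ready) a (m, t) =
     Some (((if b f then c else d) # k, f, Ready), (m, t), Stay, Stay, [])"
| "raw_step (Loop b c # k, f, Ready) a (m, t) =
     Some ((if b f then c # Loop b c # k else k, f, Ready), (m, t), Stay, Stay, [])"

text \<open>
  The list of programs still to be executed is part of the machine state. During the execution
  of \<open>c\<close> in front of \<open>k\<close> only the finitely many lists in \<open>conts c k\<close> occur, and \<open>k\<close> at the end.
\<close>

primrec conts :: "('f, 'r, 'x, 'y) prog \<Rightarrow> ('f, 'r, 'x, 'y) prog list \<Rightarrow> ('f, 'r, 'x, 'y) prog list set" where
  "conts (Act g) k = {Act g # k}"
| "conts (Push r g) k = {Push r g # k}"
| "conts (Pop r h) k = {Pop r h # k}"
| "conts (Seq c d) k = insert (Seq c d # k) (conts c (d # k) \<union> conts d k)"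
| "conts (Cond b c d) k = insert (Cond b c d # k) (conts c k \<union> conts d k)"
| "conts (Loop b c) k = insert (Loop b c # k) (conts c (Loop b c # k))"

lemma finite_conts: "finite (conts c k)"
  by (induction c arbitrary: k) auto

lemma conts_self: "c # k \<in> conts c k"
  by (cases c) auto

definition reaches :: "('x, 'y) transducer \<Rightarrow> 'x list \<Rightarrow> nat \<Rightarrow> 'y config \<Rightarrow> 'y config \<Rightarrow> bool" where
  "reaches M w N c c' \<longleftrightarrow> (\<exists>t. (next_config M w ^^ t) c = c' \<and>
     (\<forall>s \<le> t. work_pos ((next_config M w ^^ s) c) \<le> N))"

lemma reaches_refl: "work_pos c \<le> N \<Longrightarrow> reaches M w N c c"
  unfolding reaches_def by (rule exI[of _ 0]) simp

lemma reaches_step: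
  assumes "work_pos c \<le> N" "reaches M w N (next_config M w c) c'"
  shows "reaches M w N c c'"
proof -
  from assms(2) obtain t where t: "(next_config M w ^^ t) (next_config M w c) = c'"
    "\<And>s. s \<le> t \<Longrightarrow> work_pos ((next_config M w ^^ s) (next_config M w c)) \<le> N"
    unfolding reaches_def by blast
  have "work_pos ((next_config M w ^^ s) c) \<le> N" if "s \<le> Suc t" for s
    using that assms(1) t(2)[of "s - 1"] by (cases s) (auto simp: funpow_Suc_right simp del: funpow.simps)
  then show ?thesis unfolding reaches_def using t(1)
    by (intro exI[of _ "Suc t"]) (auto simp: funpow_Suc_right simp del: funpow.simps)
qed

lemma reaches_trans:
  assumes "reaches M w N a b" "reaches M w N b c"
  shows "reaches M w N a c"
proof -
  from assms(1) obtain t where t: "(next_config M w ^^ t) a = b"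
    "\<And>s. s \<le> t \<Longrightarrow> work_pos ((next_config M w ^^ s) a) \<le> N"
    unfolding reaches_def by blast
  from assms(2) obtain t' where t': "(next_config M w ^^ t') b = c"
    "\<And>s. s \<le> t' \<Longrightarrow> work_pos ((next_config M w ^^ s) b) \<le> N"
    unfolding reaches_def by blast
  have *: "(next_config M w ^^ (t + s)) a = (next_config M w ^^ s) b" for s
    using t(1) by (simp add: add.commute[of t s] funpow_add)
  have "work_pos ((next_config M w ^^ s) a) \<le> N" if "s \<le> t + t'" for s
    using t(2)[of s] t'(2)[of "s - t"] *[of "s - t"] that by (cases "s \<le> t") auto
  then show ?thesis unfolding reaches_def using * t'(1) by blast
qed

text \<open>Tracks store stacks with the top at the right.\<close>

definition tape_of :: "('r \<Rightarrow> nat list) \<Rightarrow> nat \<Rightarrow> 'r cell" where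
  "tape_of st i = (i = 0, \<lambda>r. if i < length (st r) then Some (rev (st r) ! i) else None)"

lemma tape_of_push:
  "(tape_of st)(length (st r) := (length (st r) = 0, (snd (tape_of st (length (st r))))(r := Some v))) =
   tape_of (st(r := v # st r))"
  by (auto simp: tape_of_def fun_eq_iff nth_append)

lemma tape_of_pop:
  assumes "st r = v # vs"
  shows "(tape_of st)(length vs := (length vs = 0, (snd (tape_of st (length vs)))(r := None))) =
   tape_of (st(r := vs))"
  using assms by (auto simp: tape_of_def fun_eq_iff nth_append)

lemma finite_cells:
  assumes "finite S"
  shows "finite (UNIV \<times> {t :: 'r :: finite \<Rightarrow> nat option. range t \<subseteq> insert None (Some ` S)} :: 'r cell set)"
proof -
  have "{t :: 'r \<Rightarrow> nat option. range t \<subseteq> insert None (Some ` S)} =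
      (\<Pi>\<^sub>E r \<in> UNIV. insert None (Some ` S))"
    by (auto simp: PiE_UNIV_domain)
  moreover have "finite (\<Pi>\<^sub>E r \<in> (UNIV :: 'r set). insert None (Some ` S))"
    using assms by (intro finite_PiE) auto
  ultimately show ?thesis by (intro finite_cartesian_product) simp_all
qed

text \<open>
  States and squares are coded by natural numbers through \<open>ep\<close> and \<open>ec\<close>, injective on the finite
  sets \<open>P\<close> and \<open>C\<close> that are used. The blank square has to get the code 0.
\<close>

locale compilation =
  fixes X :: "'x set" and Y :: "'y set" and F :: "'f set" and S :: "nat set"
    and c0 :: "('f, 'r :: finite, 'x, 'y) prog" and f0 :: 'f
    and ep :: "('f, 'r, 'x, 'y) prog list \<times> 'f \<times> mode \<Rightarrow> nat"
    and ec :: "'r cell \<Rightarrow> nat"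
    and Ks P C
  defines "Ks \<equiv> insert [] (conts c0 [])"
    and "P \<equiv> Ks \<times> F \<times> UNIV"
    and "C \<equiv> UNIV \<times> {t. range t \<subseteq> insert None (Some ` S)}"
  assumes finF: "finite F" and finS: "finite S" and f0: "f0 \<in> F" and wf0: "wf_prog X Y F S c0"
    and ep: "inj_on ep P" and ec: "inj_on ec C" and ec0: "ec (False, \<lambda>_. None) = 0"
begin

text \<open>
  The machine halts rather than leave \<open>P\<close>, \<open>C\<close> and \<open>Y\<close>. Thus it is well-formed by definition,
  and that a run stays inside becomes part of the simulation argument.
\<close>

definition machine :: "('x, 'y) transducer" where
  "machine = \<lparr>states = ep ` P, work_syms = ec ` C, start = ep ([c0], f0, Init),
     delta = (\<lambda>q a s. if q \<in> ep ` P \<and> s \<in> ec ` C then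
         (case raw_step (inv_into P ep q) a (inv_into C ec s) of
            None \<Rightarrow> None
          | Some (p, t, d, e, u) \<Rightarrow>
              if p \<in> P \<and> t \<in> C \<and> u \<in> lists Y then Some (ep p, ec t, d, e, u) else None)
       else None)\<rparr>"

definition conf where
  "conf ctl p tp i o1 = \<lparr>state = ep ctl, in_pos = p, work = (\<lambda>i. ec (tp i)), work_pos = i, outp = o1\<rparr>"

lemma finite_P: "finite P"
  by (simp add: P_def Ks_def finite_conts finF)

lemma finite_C: "finite C"
  unfolding C_def by (rule finite_cells[OF finS])

lemma wf_machine: "wf_transducer X Y machine"
  unfolding wf_transducer_def
proof (intro conjI ballI allI impI)
  show "finite (states machine)" "finite (work_syms machine)"
    by (simp_all add: machine_def finite_P finite_C)
  show "start machine \<in> states machine"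
    using conts_self[of c0 "[]"] f0 by (auto simp: machine_def P_def Ks_def)
  have "(False, \<lambda>_. None) \<in> C" by (simp add: C_def)
  then show "0 \<in> work_syms machine" using ec0 by (force simp: machine_def)
qed (auto simp: machine_def split: if_splits option.splits prod.splits)

lemma next_conf:
  assumes "raw_step ctl (in_sym_at w p) (tp i) = Some (ctl', t, d, e, u)"
    and "ctl \<in> P" "tp i \<in> C" "ctl' \<in> P" "t \<in> C" "u \<in> lists Y"
  shows "next_config machine w (conf ctl p tp i o1) =
    conf ctl' (min (move_head e p) (length w + 1)) (tp(i := t)) (move_head d i) (o1 @ u)"
  using assms
  by (auto simp: next_config_def cur_delta_def machine_def conf_def
      inv_into_f_f[OF ep] inv_into_f_f[OF ec] fun_eq_iff)

lemma halted_conf: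
  assumes "([], f, Ready) \<in> P" "tp i \<in> C"
  shows "halted machine w (conf ([], f, Ready) p tp i o1)"
proof -
  obtain m t where "tp i = (m, t)" by force
  then show ?thesis using assms
    by (auto simp: halted_def cur_delta_def machine_def conf_def
      inv_into_f_f[OF ep] inv_into_f_f[OF ec])
qed

lemma reaches_next:
  assumes step: "raw_step ctl (in_sym_at w p) (tp i) = Some (ctl', t, d, e, u)"
    and "ctl \<in> P" "tp i \<in> C" "ctl' \<in> P" "t \<in> C" "u \<in> lists Y" "i \<le> N"
    and "reaches machine w N
      (conf ctl' (min (move_head e p) (length w + 1)) (tp(i := t)) (move_head d i) (o1 @ u)) c"
  shows "reaches machine w N (conf ctl p tp i o1) c"
proof (rule reaches_step)
  show "work_pos (conf ctl p tp i o1) \<le> N" using assms(7) by (simp add: conf_def)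
  show "reaches machine w N (next_config machine w (conf ctl p tp i o1)) c"
    using assms(8) next_conf[of ctl w p tp i, OF step assms(2-6)] by simp
qed

lemma reaches_move:
  assumes "raw_step ctl (in_sym_at w p) (tp i) = Some (ctl', tp i, d, Stay, [])"
    and "reaches machine w N (conf ctl' p tp (move_head d i) o1) c"
    and "ctl \<in> P" "ctl' \<in> P" "tp i \<in> C" "i \<le> N" "p \<le> length w + 1"
  shows "reaches machine w N (conf ctl p tp i o1) c"
  by (rule reaches_next[of ctl w p tp i, OF assms(1)]) (use assms(2-) in \<open>simp_all add: min_def\<close>)

definition ok :: "'x list \<Rightarrow> nat \<Rightarrow> ('f, 'r, 'y) store \<Rightarrow> bool" where
  "ok w N s = (case s of (f, p, st, o1) \<Rightarrow> f \<in> F \<and> p \<le> length w + 1 \<and>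
     (\<forall>r. length (st r) \<le> N \<and> set (st r) \<subseteq> S))"

definition conf_of where
  "conf_of k s = (case s of (f, p, st, o1) \<Rightarrow> conf (k, f, Ready) p (tape_of st) 0 o1)"

lemma tape_of_in_C:
  assumes "\<And>r. set (st r) \<subseteq> S"
  shows "tape_of st i \<in> C"
proof -
  have "rev (st r) ! i \<in> S" if "i < length (st r)" for r
    using that assms[of r] nth_mem[of i "rev (st r)"] by auto
  then show ?thesis by (auto simp: C_def tape_of_def)
qed

lemma reaches_back:
  assumes "k \<in> Ks" "f \<in> F" "\<And>r. set (st r) \<subseteq> S" "i \<le> N" "p \<le> length w + 1"
  shows "reaches machine w N (conf (k, f, Back) p (tape_of st) i o1)
    (conf (k, f, Ready) p (tape_of st) 0 o1)"
  using assms(4)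
proof (induction i)
  case 0
  have rs: "raw_step (k, f, Back) (in_sym_at w p) (tape_of st 0) =
      Some ((k, f, Ready), tape_of st 0, Stay, Stay, [])"
    by (simp add: tape_of_def)
  have "reaches machine w N (conf (k, f, Ready) p (tape_of st) 0 o1) (conf (k, f, Ready) p (tape_of st) 0 o1)"
    by (rule reaches_refl) (simp add: conf_def)
  note refl = this
  show ?case
    by (rule reaches_move[of _ _ _ "tape_of st", OF rs]) (use refl assms tape_of_in_C[of st] in \<open>simp_all add: P_def\<close>)
next
  case (Suc i)
  have rs: "raw_step (k, f, Back) (in_sym_at w p) (tape_of st (Suc i)) =
      Some ((k, f, Back), tape_of st (Suc i), MoveLeft, Stay, [])"
    by (simp add: tape_of_def)
  show ?case
    by (rule reaches_move[of _ _ _ "tape_of st", OF rs]) (use assms tape_of_in_C[of st] Suc in \<open>simp_all add: P_def\<close>)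
qed

text \<open>Both stack instructions scan a track to its first empty square.\<close>

lemma reaches_scan:
  assumes "c = Push r g \<or> c = Pop r h"
    and "c # k \<in> Ks" "f \<in> F" "\<And>r. set (st r) \<subseteq> S" "length (st r) \<le> N" "p \<le> length w + 1"
    and "i \<le> length (st r)"
  shows "reaches machine w N (conf (c # k, f, Ready) p (tape_of st) i o1)
    (conf (c # k, f, Ready) p (tape_of st) (length (st r)) o1)"
  using assms(7)
proof (induction i rule: inc_induct)
  case base
  show ?case by (rule reaches_refl) (use assms in \<open>simp add: conf_def\<close>)
next
  case (step i)
  have rs: "raw_step (c # k, f, Ready) (in_sym_at w p) (tape_of st i) =
      Some ((c # k, f, Ready), tape_of st i, MoveRight, Stay, [])"
    using assms(1) step(2) by (auto simp: tape_of_def)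
  show ?case
    by (rule reaches_move[of _ _ _ "tape_of st", OF rs])
      (use assms tape_of_in_C[of st] step in \<open>simp_all add: P_def\<close>)
qed

lemma reaches_control:
  assumes "raw_step (k, f, Ready) (in_sym_at w p) (tape_of st 0) =
      Some ((k', f, Ready), tape_of st 0, Stay, Stay, [])"
    and "reaches machine w N (conf_of k' (f, p, st, o1)) c"
    and "ok w N (f, p, st, o1)" "k \<in> Ks" "k' \<in> Ks"
  shows "reaches machine w N (conf_of k (f, p, st, o1)) c"
  unfolding conf_of_def prod.case
  by (rule reaches_move[of _ _ _ "tape_of st", OF assms(1)])
    (use assms(2-) tape_of_in_C[of st] in \<open>simp_all add: P_def ok_def conf_of_def\<close>)

text \<open>
  By induction on the program, for all control stacks \<open>k\<close> below it. In the case of a loop the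
  claim itself, as a predicate of the store, is shown to be a prefixed point of the functional
  that defines \<open>wp\<close>, so the least fixed point implies it.
\<close>

lemma sound:
  assumes "wp w N c Q s" "ok w N s" "wf_prog X Y F S c" "conts c k \<subseteq> Ks" "k \<in> Ks" "w \<in> lists X"
  shows "\<exists>s'. Q s' \<and> ok w N s' \<and> reaches machine w N (conf_of (c # k) s) (conf_of k s')"
  using assms
proof (induction c arbitrary: Q s k)
  case (Act g)
  obtain f p st o1 where s: "s = (f, p, st, o1)" by (cases s) auto
  obtain f' e u where g: "g f (in_sym_at w p) = (f', e, u)" by (cases "g f (in_sym_at w p)") auto
  have sym: "in_sym_at w p \<in> {LeftEnd, RightEnd} \<union> Letter ` X"
    using Act.prems(6) nth_mem[of "p - 1" w] by (auto simp: in_sym_at_def)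
  have f: "f \<in> F" "p \<le> length w + 1" "\<And>r. set (st r) \<subseteq> S" using Act.prems(2) by (auto simp: s ok_def)
  have "fst (g f (in_sym_at w p)) \<in> F \<and> snd (snd (g f (in_sym_at w p))) \<in> lists Y"
    using bspec[OF bspec[OF Act.prems(3)[unfolded wf_prog.simps] f(1)] sym] .
  then have f': "f' \<in> F" and u: "u \<in> lists Y" by (simp_all add: g)
  define s' where "s' = (f', min (move_head e p) (length w + 1), st, o1 @ u)"
  have ok': "ok w N s'" using Act.prems f' by (auto simp: s s'_def ok_def)
  have "reaches machine w N (conf_of k s') (conf_of k s')"
    by (rule reaches_refl) (simp add: conf_of_def conf_def s'_def)
  then have r: "reaches machine w N (conf (k, f', Ready) (min (move_head e p) (length w + 1))
      ((tape_of st)(0 := tape_of st 0)) (move_head Stay 0) (o1 @ u)) (conf_of k s')"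
    by (simp add: conf_of_def s'_def)
  have rs: "raw_step (Act g # k, f, Ready) (in_sym_at w p) (tape_of st 0) =
      Some ((k, f', Ready), tape_of st 0, Stay, e, u)"
    by (simp add: tape_of_def g)
  have "reaches machine w N (conf (Act g # k, f, Ready) p (tape_of st) 0 o1) (conf_of k s')"
    by (rule reaches_next[of _ _ _ "tape_of st", OF rs])
      (use Act.prems(4,5) f f' u r tape_of_in_C[of st] in \<open>simp_all add: P_def\<close>)
  then have "reaches machine w N (conf_of (Act g # k) s) (conf_of k s')"
    by (simp add: conf_of_def s)
  moreover have "Q s'" using Act.prems(1) g by (simp add: s s'_def)
  ultimately show ?case using ok' by blast
next
  case (Push r g)
  obtain f p st o1 where s: "s = (f, p, st, o1)" by (cases s) auto
  have f: "f \<in> F" "p \<le> length w + 1" "\<And>r. set (st r) \<subseteq> S" "length (st r) < N" "g f \<in> S"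
    using Push.prems by (auto simp: s ok_def)
  define st' where "st' = st(r := g f # st r)"
  define s' where "s' = (f, p, st', o1)"
  have ok': "ok w N s'" using Push.prems f by (auto simp: s s'_def st'_def ok_def)
  have 1: "reaches machine w N (conf (Push r g # k, f, Ready) p (tape_of st) 0 o1)
    (conf (Push r g # k, f, Ready) p (tape_of st) (length (st r)) o1)"
    by (rule reaches_scan) (use Push.prems f in auto)
  have t: "(tape_of st)(length (st r) := (length (st r) = 0, (snd (tape_of st (length (st r))))(r := Some (g f)))) =
    tape_of st'"
    unfolding st'_def by (rule tape_of_push)
  have return: "reaches machine w N (conf (k, f, Back) p (tape_of st') (length (st r)) o1)
    (conf (k, f, Ready) p (tape_of st') 0 o1)"
    by (rule reaches_back) (use Push.prems f ok' in \<open>auto simp: ok_def s'_def\<close>)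
  define tt where "tt = (length (st r) = 0, (snd (tape_of st (length (st r))))(r := Some (g f)))"
  have t': "(tape_of st)(length (st r) := tt) = tape_of st'" using t by (simp only: tt_def)
  have "tape_of st' (length (st r)) = tt"
    by (simp only: tt_def t[symmetric] fun_upd_same)
  then have tt: "tt \<in> C" using tape_of_in_C[of st' "length (st r)"] ok' by (auto simp: ok_def s'_def)
  have rs: "raw_step (Push r g # k, f, Ready) (in_sym_at w p) (tape_of st (length (st r))) =
      Some ((k, f, Back), tt, Stay, Stay, [])"
    by (simp add: tape_of_def tt_def)
  have 2: "reaches machine w N (conf (Push r g # k, f, Ready) p (tape_of st) (length (st r)) o1)
    (conf (k, f, Ready) p (tape_of st') 0 o1)"
    by (rule reaches_next[of _ _ _ "tape_of st", OF rs])
      (use Push.prems f tape_of_in_C[of st] t' return tt in \<open>simp_all add: P_def min_def\<close>)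
  have "Q s'" using Push.prems(1) by (simp add: s s'_def st'_def)
  then show ?case using reaches_trans[OF 1 2] ok' by (auto simp: conf_of_def s s'_def)
next
  case (Pop r h)
  obtain f p st o1 where s: "s = (f, p, st, o1)" by (cases s) auto
  have f: "f \<in> F" "p \<le> length w + 1" "\<And>r. set (st r) \<subseteq> S" "length (st r) \<le> N"
    using Pop.prems by (auto simp: s ok_def)
  have 1: "reaches machine w N (conf (Pop r h # k, f, Ready) p (tape_of st) 0 o1)
    (conf (Pop r h # k, f, Ready) p (tape_of st) (length (st r)) o1)"
    by (rule reaches_scan) (use Pop.prems f in auto)
  show ?case
  proof (cases "st r")
    case Nil
    define s' where "s' = (h None f, p, st, o1)"
    have ok': "ok w N s'" using Pop.prems f by (auto simp: s s'_def ok_def)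
    have rs: "raw_step (Pop r h # k, f, Ready) (in_sym_at w p) (tape_of st 0) =
        Some ((k, h None f, Ready), tape_of st 0, Stay, Stay, [])"
      using Nil by (simp add: tape_of_def)
    have "reaches machine w N (conf (k, h None f, Ready) p (tape_of st) 0 o1)
        (conf (k, h None f, Ready) p (tape_of st) 0 o1)"
      by (rule reaches_refl) (simp add: conf_def)
    note refl = this
    have "reaches machine w N (conf (Pop r h # k, f, Ready) p (tape_of st) 0 o1)
        (conf (k, h None f, Ready) p (tape_of st) 0 o1)"
      by (rule reaches_move[of _ _ _ "tape_of st", OF rs])
        (use refl Pop.prems f tape_of_in_C[of st] ok' in \<open>simp_all add: P_def ok_def s'_def\<close>)
    moreover have "Q s'" using Pop.prems(1) Nil by (simp add: s s'_def)
    ultimately show ?thesis using ok' by (auto simp: conf_of_def s s'_def)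
  next
    case (Cons v vs)
    define st' where "st' = st(r := vs)"
    define s' where "s' = (h (Some v) f, p, st', o1)"
    have v: "v \<in> S" using f(3)[of r] Cons by auto
    have "h (Some v) f \<in> F" using Pop.prems(3) f(1) v by simp
    moreover have "length (st' r') \<le> N" "set (st' r') \<subseteq> S" for r'
      using Pop.prems(2) f(3)[of r] f(4) Cons by (auto simp: s ok_def st'_def)
    ultimately have ok': "ok w N s'" using f(2) by (simp add: s'_def ok_def)
    have t: "(tape_of st)(length vs := (length vs = 0, (snd (tape_of st (length vs)))(r := None))) =
      tape_of st'"
      unfolding st'_def by (rule tape_of_pop[of st r v vs]) (rule Cons)
    have sv: "snd (tape_of st (length vs)) r = Some v" by (simp add: tape_of_def Cons nth_append)
    have return: "reaches machine w N (conf (k, h (Some v) f, Back) p (tape_of st') (length vs) o1)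
      (conf (k, h (Some v) f, Ready) p (tape_of st') 0 o1)"
      by (rule reaches_back) (use Pop.prems f ok' Cons in \<open>auto simp: ok_def s'_def\<close>)
    define tt where "tt = (length vs = 0, (snd (tape_of st (length vs)))(r := None))"
    have t': "(tape_of st)(length vs := tt) = tape_of st'" using t by (simp only: tt_def)
    have "tape_of st' (length vs) = tt"
      by (simp only: tt_def t[symmetric] fun_upd_same)
    then have tt: "tt \<in> C" using tape_of_in_C[of st' "length vs"] ok' by (auto simp: ok_def s'_def)
    have rs: "raw_step (Pop r h # k, f, Take) (in_sym_at w p) (tape_of st (length vs)) =
        Some ((k, h (Some v) f, Back), tt, Stay, Stay, [])"
      using sv by (simp add: tape_of_def tt_def)
    have take: "reaches machine w N (conf (Pop r h # k, f, Take) p (tape_of st) (length vs) o1)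
      (conf (k, h (Some v) f, Ready) p (tape_of st') 0 o1)"
      by (rule reaches_next[of _ _ _ "tape_of st", OF rs])
        (use Pop.prems f tape_of_in_C[of st] t' return tt ok' Cons in
          \<open>simp_all add: P_def min_def ok_def s'_def\<close>)
    have rs: "raw_step (Pop r h # k, f, Ready) (in_sym_at w p) (tape_of st (length (st r))) =
        Some ((Pop r h # k, f, Take), tape_of st (length (st r)), MoveLeft, Stay, [])"
      using Cons by (simp add: tape_of_def)
    have 2: "reaches machine w N (conf (Pop r h # k, f, Ready) p (tape_of st) (length (st r)) o1)
      (conf (k, h (Some v) f, Ready) p (tape_of st') 0 o1)"
      by (rule reaches_move[of _ _ _ "tape_of st", OF rs])
        (use Pop.prems f tape_of_in_C[of st] Cons take in \<open>simp_all add: P_def\<close>)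
    have "Q s'" using Pop.prems(1) Cons by (simp add: s s'_def st'_def)
    then show ?thesis using reaches_trans[OF 1 2] ok' by (auto simp: conf_of_def s s'_def)
  qed
next
  case (Seq c d)
  obtain f p st o1 where s: "s = (f, p, st, o1)" by (cases s) auto
  from Seq.prems(3) have wf: "wf_prog X Y F S c" "wf_prog X Y F S d" by simp_all
  from Seq.prems have K: "conts c (d # k) \<subseteq> Ks" "conts d k \<subseteq> Ks" "d # k \<in> Ks" "c # d # k \<in> Ks"
    using conts_self[of d k] conts_self[of c "d # k"] by auto
  obtain s' where s': "wp w N d Q s'" "ok w N s'"
    and 1: "reaches machine w N (conf_of (c # d # k) s) (conf_of (d # k) s')"
    using Seq.IH(1)[of "wp w N d Q" s "d # k", OF _ Seq.prems(2) wf(1) K(1,3) Seq.prems(6)] Seq.prems(1)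
    by (simp only: wp.simps) blast
  obtain s'' where s'': "Q s''" "ok w N s''"
    and 2: "reaches machine w N (conf_of (d # k) s') (conf_of k s'')"
    using Seq.IH(2)[OF s' wf(2) K(2) Seq.prems(5,6)] by blast
  have "reaches machine w N (conf_of (Seq c d # k) s) (conf_of (d # k) s')"
    unfolding s by (rule reaches_control[where k' = "c # d # k"])
      (use 1 Seq.prems K in \<open>simp_all add: tape_of_def s\<close>)
  from reaches_trans[OF this 2] show ?case using s'' by blast
next
  case (Cond b c d)
  obtain f p st o1 where s: "s = (f, p, st, o1)" by (cases s) auto
  let ?e = "if b f then c else d"
  obtain s' where s': "Q s'" "ok w N s'"
    and 1: "reaches machine w N (conf_of (?e # k) s) (conf_of k s')"
    using Cond.IH(1)[of Q s k] Cond.IH(2)[of Q s k] Cond.prems by (cases "b f") (auto simp: s)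
  have "reaches machine w N (conf_of (Cond b c d # k) s) (conf_of k s')"
    unfolding s by (rule reaches_control[where k' = "?e # k"])
      (use 1 Cond.prems conts_self[of c k] conts_self[of d k] in \<open>simp_all add: tape_of_def s subset_iff\<close>)
  then show ?case using s' by blast
next
  case (Loop b c)
  let ?L = "Loop b c"
  define Good where "Good s \<longleftrightarrow> (ok w N s \<longrightarrow>
    (\<exists>s'. Q s' \<and> ok w N s' \<and> reaches machine w N (conf_of (?L # k) s) (conf_of k s')))" for s
  have K: "conts c (?L # k) \<subseteq> Ks" "?L # k \<in> Ks" "c # ?L # k \<in> Ks"
    using Loop.prems conts_self[of c "?L # k"] by auto
  have "(\<lambda>s. if b (fst s) then wp w N c Good s else Q s) \<le> Good"
  proof (rule le_funI, rule le_boolI)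
    fix s assume *: "if b (fst s) then wp w N c Good s else Q s"
    obtain f p st o1 where s: "s = (f, p, st, o1)" by (cases s) auto
    show "Good s" unfolding Good_def
    proof
      assume ok: "ok w N s"
      show "\<exists>s'. Q s' \<and> ok w N s' \<and> reaches machine w N (conf_of (?L # k) s) (conf_of k s')"
      proof (cases "b f")
        case True
        obtain s' where s': "Good s'" "ok w N s'"
          and 1: "reaches machine w N (conf_of (c # ?L # k) s) (conf_of (?L # k) s')"
          using Loop.IH[of Good s "?L # k"] Loop.prems K ok * True by (auto simp: s)
        have "reaches machine w N (conf_of (?L # k) s) (conf_of (?L # k) s')"
          unfolding s by (rule reaches_control[where k' = "c # ?L # k"])
            (use 1 K ok True in \<open>simp_all add: tape_of_def s\<close>)
        from reaches_trans[OF this] show ?thesis using s' unfolding Good_def by blast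
      next
        case False
        have "reaches machine w N (conf_of k s) (conf_of k s)"
          by (rule reaches_refl) (simp add: conf_of_def conf_def s)
        note stop = this
        have "reaches machine w N (conf_of (?L # k) s) (conf_of k s)"
          unfolding s by (rule reaches_control[where k' = k and k = "?L # k"])
            (use stop Loop.prems(5) K ok False in \<open>simp_all add: tape_of_def s\<close>)
        then show ?thesis using * ok False by (auto simp: s)
      qed
    qed
  qed
  then have "wp w N ?L Q \<le> Good" by (simp add: lfp_lowerbound)
  then have "Good s" using Loop.prems(1) by (rule predicate1D)
  then show ?case using Loop.prems(2) unfolding Good_def by blast
qed

lemma machine_outputs:
  assumes "wp w N c0 (\<lambda>s. snd (snd (snd s)) = v) (f0, 0, \<lambda>_. [], [])" "w \<in> lists X"
  shows "outputs machine w v" "\<forall>t. work_pos (config_at machine w t) \<le> N"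
proof -
  let ?s = "(f0, 0, \<lambda>_. [], [])"
  have K: "conts c0 [] \<subseteq> Ks" "[] \<in> Ks" "[c0] \<in> Ks"
    using conts_self[of c0 "[]"] by (auto simp: Ks_def)
  have ok: "ok w N ?s" by (simp add: ok_def f0)
  obtain s' where s': "snd (snd (snd s')) = v" "ok w N s'"
    and r: "reaches machine w N (conf_of [c0] ?s) (conf_of [] s')"
    using sound[OF assms(1) ok wf0 K(1,2) assms(2)] by blast
  have init: "init_config machine = conf ([c0], f0, Init) 0 (\<lambda>_. (False, \<lambda>_. None)) 0 []"
    by (simp add: init_config_def conf_def machine_def ec0)
  have t: "(\<lambda>_. (False, \<lambda>_. None))(0 := (True, \<lambda>_. None)) = tape_of (\<lambda>_ :: 'r. [])"
    by (auto simp: tape_of_def fun_eq_iff)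
  have rs: "raw_step ([c0], f0, Init) (in_sym_at w 0) (False, \<lambda>_ :: 'r. None) =
      Some (([c0], f0, Ready), (True, \<lambda>_. None), Stay, Stay, [])"
    by simp
  have "reaches machine w N (init_config machine) (conf_of [] s')"
    unfolding init
    by (rule reaches_next[of _ _ _ "\<lambda>_. (False, \<lambda>_. None)", OF rs])
      (use r K f0 in \<open>simp_all add: P_def C_def t conf_of_def\<close>)
  then obtain T where T: "config_at machine w T = conf_of [] s'"
    and TN: "\<And>t. t \<le> T \<Longrightarrow> work_pos (config_at machine w t) \<le> N"
    unfolding reaches_def config_at_def by blast
  obtain f p st o1 where s: "s' = (f, p, st, o1)" by (cases s') auto
  have h: "halted machine w (conf_of [] s')"
    using s'(2) K tape_of_in_C[of st] unfolding conf_of_def s prod.case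
    by (intro halted_conf) (auto simp: P_def ok_def)
  then show "outputs machine w v"
    using s'(1) T unfolding outputs_def by (intro exI[of _ T]) (simp add: conf_of_def conf_def s)
  have "config_at machine w (T + d) = conf_of [] s'" for d
    by (induction d) (use T h in \<open>auto simp: config_at_def next_config_def halted_def\<close>)
  then have "work_pos (config_at machine w t) \<le> N" for t
    using TN[of t] TN[of T] T by (cases "t \<le> T") (metis le_add_diff_inverse linorder_le_cases order_refl)+
  then show "\<forall>t. work_pos (config_at machine w t) \<le> N" by blast
qed

end

text \<open>
  Control stacks, control states and squares are finite in number, so codes for them exist. The
  work head never passes square \<open>N\<close>, one beyond the top of a stack of maximal height.
\<close>

theorem logspace_computable_prog:
  fixes c :: "('f, 'r :: finite, 'x, 'y) prog"
  assumes "finite X" "finite Y" "finite F" "finite S" "f0 \<in> F" "wf_prog X Y F S c"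
    and wp: "\<And>w. w \<in> lists X \<Longrightarrow>
      wp w (N (length w)) c (\<lambda>s. snd (snd (snd s)) = g w) (f0, 0, \<lambda>_. [], [])"
    and N: "\<And>n. real (N n + 1) \<le> real d * log 2 (real n + 2)"
  shows "logspace_computable X Y g"
proof -
  let ?P = "insert [] (conts c []) \<times> F \<times> (UNIV :: mode set)"
  let ?C = "(UNIV :: bool set) \<times> {t :: 'r \<Rightarrow> nat option. range t \<subseteq> insert None (Some ` S)}"
  have fP: "finite ?P" using assms by (simp add: finite_conts)
  then obtain ep :: "_ \<Rightarrow> nat" where ep: "inj_on ep ?P"
    using finite_imp_inj_to_nat_seg by blast
  have "finite ?C" using finite_cells[OF \<open>finite S\<close>] .
  then obtain e1 :: "_ \<Rightarrow> nat" where e1: "inj_on e1 ?C"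
    using finite_imp_inj_to_nat_seg by blast
  define ec where "ec t = (if t = (False, \<lambda>_. None) then 0 else Suc (e1 t))" for t
  have ec: "inj_on ec ?C" using e1 by (auto simp: inj_on_def ec_def)
  interpret compilation X Y F S c f0 ep ec "insert [] (conts c [])" ?P ?C
    by unfold_locales (use assms ep ec in \<open>auto simp: ec_def\<close>)
  have "logspace_bounded X machine"
    unfolding logspace_bounded_def
  proof (intro exI[of _ d] ballI allI)
    fix w t assume w: "w \<in> lists X"
    have "real (work_pos (config_at machine w t) + 1) \<le> real (N (length w) + 1)"
      using machine_outputs(2)[OF wp[OF w] w] by (simp add: le_diff_conv)
    also have "\<dots> \<le> real d * log 2 (real (length w) + 2)" by (rule N)
    finally show "real (work_pos (config_at machine w t) + 1) \<le> real d * log 2 (real (length w) + 2)" .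
  qed
  then show ?thesis unfolding logspace_computable_def
    using wf_machine machine_outputs(1)[OF wp] assms by blast
qed

section \<open>Binary counters\<close>

text \<open>
  The control state of the programs below. The first four components are bounded by a constant
  of the program. \<open>busy\<close> controls the loops inside counter operations and is false outside of
  them, and \<open>nonzero\<close> is the result of the last decrement or zero test.
\<close>

record vars =
  sim_state :: nat
  sim_sym :: nat
  popped :: nat
  offset :: nat
  back_pass :: bool
  busy :: bool
  nonzero :: bool
  again :: bool
  running :: bool
  answer :: bool
  work_move :: move
  input_move :: move

text \<open>
  \<open>LeftPart\<close> and \<open>RightPart\<close> hold the work tape of a simulated machine on both sides of its
  head. The two counters are kept in binary, least significant bit on top. \<open>Carry\<close> is empty
  between counter operations.
\<close>

datatype reg = LeftPart | RightPart | CountA | CountB | Carry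

instance reg :: finite
proof
  have "UNIV = {LeftPart, RightPart, CountA, CountB, Carry}" using reg.exhaust by auto
  then show "finite (UNIV :: reg set)" by (metis finite.simps)
qed

type_synonym ('x, 'y) vprog = "(vars, reg, 'x, 'y) prog"

definition skip :: "('f, 'r, 'x, 'y) prog" where
  "skip = Act (\<lambda>f a. (f, Stay, []))"

definition upd :: "('f \<Rightarrow> 'f) \<Rightarrow> ('f, 'r, 'x, 'y) prog" where
  "upd g = Act (\<lambda>f a. (g f, Stay, []))"

definition mv :: "move \<Rightarrow> ('f, 'r, 'x, 'y) prog" where
  "mv e = Act (\<lambda>f a. (f, e, []))"

text \<open>
  A counter operation pops the low bits that all have the same value and counts them in unary on
  \<open>Carry\<close>; this loop puts the same number of bits back, all equal to the value of \<open>g\<close>.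
\<close>

definition restore_loop :: "reg \<Rightarrow> (vars \<Rightarrow> nat) \<Rightarrow> ('x, 'y) vprog" where
  "restore_loop r g = Loop busy (Seq (Pop Carry (\<lambda>v f. f\<lparr>busy := v \<noteq> None\<rparr>)) (Cond busy (Push r g) skip))"

definition restore :: "reg \<Rightarrow> (vars \<Rightarrow> nat) \<Rightarrow> ('x, 'y) vprog" where
  "restore r g = Seq (upd (\<lambda>f. f\<lparr>busy := True\<rparr>)) (restore_loop r g)"

definition inc_scan :: "reg \<Rightarrow> ('x, 'y) vprog" where
  "inc_scan r = Loop busy (Seq (Pop r (\<lambda>v f. f\<lparr>busy := (v = Some 1)\<rparr>)) (Cond busy (Push Carry (\<lambda>_. 0)) skip))"

definition inc :: "reg \<Rightarrow> ('x, 'y) vprog" where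
  "inc r = Seq (upd (\<lambda>f. f\<lparr>busy := True\<rparr>)) (Seq (inc_scan r)
     (Seq (Push r (\<lambda>_. 1)) (restore r (\<lambda>_. 0))))"

text \<open>
  A decrement turns low bits \<open>0 \<dots> 0 1\<close> into \<open>1 \<dots> 1 0\<close>. If no bit 1 is found, then the counter is
  zero and the bits are put back unchanged. The length never shrinks, so leading zeros may
  occur; the counter is zero iff all bits are zero.
\<close>

definition dec_scan :: "reg \<Rightarrow> ('x, 'y) vprog" where
  "dec_scan r = Loop busy (Seq (Pop r (\<lambda>v f. f\<lparr>busy := (v = Some 0), nonzero := (v = Some 1)\<rparr>))
        (Cond busy (Push Carry (\<lambda>_. 0)) skip))"

definition dec :: "reg \<Rightarrow> ('x, 'y) vprog" where
  "dec r = Seq (upd (\<lambda>f. f\<lparr>busy := True\<rparr>)) (Seq (dec_scan r)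
     (Seq (Cond nonzero (Push r (\<lambda>_. 0)) skip) (restore r (\<lambda>f. if nonzero f then 1 else 0))))"

definition ztest :: "reg \<Rightarrow> ('x, 'y) vprog" where
  "ztest r = Seq (dec r) (Cond nonzero (inc r) skip)"

fun binval :: "nat list \<Rightarrow> nat" where
  "binval [] = 0"
| "binval (b # bs) = b + 2 * binval bs"

fun inc_bits :: "nat list \<Rightarrow> nat list" where
  "inc_bits [] = [1]"
| "inc_bits (b # bs) = (if b = 1 then 0 # inc_bits bs else 1 # bs)"

fun dec_bits :: "nat list \<Rightarrow> nat list" where
  "dec_bits [] = []"
| "dec_bits (b # bs) = (if b = 0 then 1 # dec_bits bs else 0 # bs)"

definition counts :: "nat \<Rightarrow> nat list \<Rightarrow> nat \<Rightarrow> bool" where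
  "counts K bs n \<longleftrightarrow> set bs \<subseteq> {0, 1} \<and> length bs \<le> K \<and> binval bs = n"

lemma binval_inc_bits: "set bs \<subseteq> {0, 1} \<Longrightarrow> binval (inc_bits bs) = binval bs + 1"
  by (induction bs) auto

lemma set_inc_bits: "set bs \<subseteq> {0, 1} \<Longrightarrow> set (inc_bits bs) \<subseteq> {0, 1}"
  by (induction bs) auto

text \<open>
  A new bit is needed only if all bits are 1, that is, at a value \<open>2 ^ k - 1\<close> where \<open>k\<close> is the
  length; so \<open>K\<close> bits suffice as long as the values stay below \<open>2 ^ K\<close>, although leading zeros
  are never dropped.
\<close>

lemma length_inc_bits:
  "set bs \<subseteq> {0, 1} \<Longrightarrow> length bs \<le> K \<Longrightarrow> binval bs + 1 < 2 ^ K \<Longrightarrow> length (inc_bits bs) \<le> K"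
proof (induction bs arbitrary: K)
  case Nil
  then show ?case by (cases K) auto
next
  case (Cons b bs)
  then obtain K' where K': "K = Suc K'" by (cases K) auto
  show ?case using Cons.prems Cons.IH[of K'] by (auto simp: K')
qed

lemma counts_inc: "counts K bs n \<Longrightarrow> n + 1 < 2 ^ K \<Longrightarrow> counts K (inc_bits bs) (n + 1)"
  unfolding counts_def using binval_inc_bits set_inc_bits length_inc_bits by simp

lemma dec_bits_props:
  "set bs \<subseteq> {0, 1} \<Longrightarrow> binval bs \<noteq> 0 \<Longrightarrow>
     set (dec_bits bs) \<subseteq> {0, 1} \<and> length (dec_bits bs) = length bs \<and> binval (dec_bits bs) = binval bs - 1"
  by (induction bs) auto

lemma counts_dec: "counts K bs n \<Longrightarrow> n \<noteq> 0 \<Longrightarrow> counts K (dec_bits bs) (n - 1)"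
  unfolding counts_def using dec_bits_props[of bs] by auto

lemma wp_simps:
  "wp w N skip Q s = (case s of (f, p, st, o1) \<Rightarrow> Q (f, min p (length w + 1), st, o1))"
  "wp w N (upd g) Q s = (case s of (f, p, st, o1) \<Rightarrow> Q (g f, min p (length w + 1), st, o1))"
  "wp w N (mv e) Q s = (case s of (f, p, st, o1) \<Rightarrow> Q (f, min (move_head e p) (length w + 1), st, o1))"
  by (auto simp: skip_def upd_def mv_def)

declare wp.simps(6) [simp del]

text \<open>Pointwise descriptions of the final store avoid comparing chains of updates.\<close>

lemma wp_restore_loop:
  assumes "st Carry = replicate k 0" "length (st r) + k \<le> N" "r \<noteq> Carry" "p \<le> length w + 1"
    and "\<And>x. g (f\<lparr>busy := x\<rparr>) = v"
    and "st' Carry = []" "st' r = replicate k v @ st r"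
    and "\<And>r'. r' \<noteq> r \<Longrightarrow> r' \<noteq> Carry \<Longrightarrow> st' r' = st r'"
    and "Q (f\<lparr>busy := False\<rparr>, p, st', o1)"
  shows "wp w N (restore_loop r g) Q
    (f\<lparr>busy := True\<rparr>, p, st, o1)"
  using assms
proof (induction k arbitrary: st)
  case 0
  have "st' r' = st r'" for r' using 0 by (cases "r' = Carry"; cases "r' = r") auto
  then have "st' = st" by (simp add: fun_eq_iff)
  with 0 show ?case
    unfolding restore_loop_def by (subst wp_Loop_unfold) (simp add: wp_simps min_def wp_Loop_unfold[of w N busy _ _ "(f\<lparr>busy := False\<rparr>, p, st, o1)"])
next
  case (Suc k)
  let ?st = "st(Carry := replicate k 0, r := v # st r)"
  have "wp w N (restore_loop r g) Q
      (f\<lparr>busy := True\<rparr>, p, ?st, o1)"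
    by (rule Suc.IH) (use Suc.prems in \<open>auto simp: replicate_app_Cons_same\<close>)
  with Suc.prems show ?case
    unfolding restore_loop_def by (subst wp_Loop_unfold) (simp add: wp_simps)
qed

lemma wp_restore:
  assumes "st Carry = replicate k 0" "length (st r) + k \<le> N" "r \<noteq> Carry" "p \<le> length w + 1"
    and "\<And>x. g (f\<lparr>busy := x\<rparr>) = v"
    and "st' Carry = []" "st' r = replicate k v @ st r"
    and "\<And>r'. r' \<noteq> r \<Longrightarrow> r' \<noteq> Carry \<Longrightarrow> st' r' = st r'"
    and "Q (f\<lparr>busy := False\<rparr>, p, st', o1)"
  shows "wp w N (restore r g) Q (f, p, st, o1)"
proof -
  have "wp w N (restore_loop r g) Q
    (f\<lparr>busy := True\<rparr>, p, st, o1)"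
    by (rule wp_restore_loop[of st k r N p w g f v st' Q]) (use assms in simp_all)
  then show ?thesis unfolding restore_def using assms(4) by (simp add: wp_simps min_def)
qed

text \<open>
  \<open>k\<close> bits 1 have been popped already and the remaining bits are \<open>bs\<close>.
\<close>

lemma wp_inc_aux:
  assumes "st r = bs" "st Carry = replicate k 0" "k + length bs \<le> N" "k + length (inc_bits bs) \<le> N"
    "r \<noteq> Carry" "p \<le> length w + 1"
    and "st' Carry = []" "st' r = replicate k 0 @ inc_bits bs"
    and "\<And>r'. r' \<noteq> r \<Longrightarrow> r' \<noteq> Carry \<Longrightarrow> st' r' = st r'"
    and "Q (f\<lparr>busy := False\<rparr>, p, st', o1)"
  shows "wp w N (inc_scan r)
     (wp w N (Seq (Push r (\<lambda>_. 1)) (restore r (\<lambda>_. 0))) Q) (f\<lparr>busy := True\<rparr>, p, st, o1)"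
  using assms
proof (induction bs arbitrary: st k)
  case Nil
  have "wp w N (restore r (\<lambda>_. 0)) Q (f\<lparr>busy := False\<rparr>, p, st(r := [1]), o1)"
    by (rule wp_restore[where k = k and v = 0 and st' = st' and Q = Q]) (use Nil in simp_all)
  with Nil show ?case
    unfolding inc_scan_def by (subst wp_Loop_unfold)
      (simp add: wp_simps min_def wp_Loop_unfold[of w N busy _ _ "(f\<lparr>busy := False\<rparr>, p, st, o1)"])
next
  case (Cons b bs)
  show ?case
  proof (cases "b = 1")
    case True
    let ?st = "st(r := bs, Carry := replicate (Suc k) 0)"
    have "wp w N (inc_scan r)
     (wp w N (Seq (Push r (\<lambda>_. 1)) (restore r (\<lambda>_. 0))) Q) (f\<lparr>busy := True\<rparr>, p, ?st, o1)"
      by (rule Cons.IH[where k = "Suc k"]) (use Cons.prems True in \<open>auto simp: replicate_app_Cons_same\<close>)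
    with Cons.prems True show ?thesis
      unfolding inc_scan_def by (subst wp_Loop_unfold) (simp add: wp_simps)
  next
    case False
    have "wp w N (restore r (\<lambda>_. 0)) Q (f\<lparr>busy := False\<rparr>, p, st(r := 1 # bs), o1)"
      by (rule wp_restore[where k = k and v = 0 and st' = st' and Q = Q]) (use Cons.prems False in simp_all)
    with Cons.prems False show ?thesis
      unfolding inc_scan_def by (subst wp_Loop_unfold)
        (simp add: wp_simps min_def wp_Loop_unfold[of w N busy _ _ "(f\<lparr>busy := False\<rparr>, p, _, o1)"])
  qed
qed

lemma wp_inc:
  assumes "st Carry = []" "counts K (st r) n" "n + 1 < 2 ^ K" "K \<le> N"
    "r \<noteq> Carry" "p \<le> length w + 1" "\<not> busy f"
    and "\<And>bs. counts K bs (n + 1) \<Longrightarrow> Q (f, p, st(r := bs), o1)"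
  shows "wp w N (inc r) Q (f, p, st, o1)"
proof -
  have f: "f\<lparr>busy := False\<rparr> = f" using assms(7) by (cases f) simp
  have bs: "counts K (inc_bits (st r)) (n + 1)" by (rule counts_inc) fact+
  have "wp w N (inc_scan r)
     (wp w N (Seq (Push r (\<lambda>_. 1)) (restore r (\<lambda>_. 0))) Q) (f\<lparr>busy := True\<rparr>, p, st, o1)"
  proof (rule wp_inc_aux[where k = 0 and st' = "st(r := inc_bits (st r))" and Q = Q, OF HOL.refl])
    show "Q (f\<lparr>busy := False\<rparr>, p, st(r := inc_bits (st r)), o1)"
      unfolding f by (rule assms(8)[OF bs])
  qed (use assms bs in \<open>auto simp: counts_def\<close>)
  then show ?thesis unfolding inc_def using assms(6) by (simp add: wp_simps min_def)
qed

text \<open>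
  \<open>k\<close> bits 0 have been popped already and the remaining bits are \<open>bs\<close>.
\<close>

lemma wp_dec_aux:
  assumes "st r = bs" "st Carry = replicate k 0" "k + length bs \<le> N" "set bs \<subseteq> {0, 1}"
    "r \<noteq> Carry" "p \<le> length w + 1"
    and "st' Carry = []"
    and "st' r = (if binval bs \<noteq> 0 then replicate k 1 @ dec_bits bs else replicate k 0 @ bs)"
    and "\<And>r'. r' \<noteq> r \<Longrightarrow> r' \<noteq> Carry \<Longrightarrow> st' r' = st r'"
    and "f' = f\<lparr>busy := False, nonzero := binval bs \<noteq> 0\<rparr>"
    and "Q (f', p, st', o1)"
  shows "wp w N (dec_scan r)
     (wp w N (Seq (Cond nonzero (Push r (\<lambda>_. 0)) skip) (restore r (\<lambda>f. if nonzero f then 1 else 0))) Q)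
     (f\<lparr>busy := True\<rparr>, p, st, o1)"
  using assms
proof (induction bs arbitrary: st k f)
  case Nil
  have f: "f' = f\<lparr>busy := False, nonzero := False\<rparr>\<lparr>busy := False\<rparr>"
    using Nil by (cases f) simp
  have "wp w N (restore r (\<lambda>f. if nonzero f then 1 else 0)) Q (f\<lparr>busy := False, nonzero := False\<rparr>, p, st, o1)"
    by (rule wp_restore[where k = k and v = 0 and st' = st' and Q = Q]) (use Nil f in simp_all)
  with Nil show ?case
    unfolding dec_scan_def by (subst wp_Loop_unfold)
      (simp add: wp_simps min_def wp_Loop_unfold[of w N busy _ _ "(f\<lparr>busy := False, nonzero := False\<rparr>, p, _, o1)"])
next
  case (Cons b bs)
  show ?case
  proof (cases "b = 0")
    case True
    let ?st = "st(r := bs, Carry := replicate (Suc k) 0)"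
    let ?f = "f\<lparr>nonzero := False\<rparr>"
    have "wp w N (dec_scan r)
     (wp w N (Seq (Cond nonzero (Push r (\<lambda>_. 0)) skip) (restore r (\<lambda>f. if nonzero f then 1 else 0))) Q)
     (?f\<lparr>busy := True\<rparr>, p, ?st, o1)"
    proof (rule Cons.IH[where k = "Suc k"])
      show "f' = ?f\<lparr>busy := False, nonzero := binval bs \<noteq> 0\<rparr>"
        using Cons.prems(10) True by (cases f) simp
    qed (use Cons.prems True in \<open>auto simp: replicate_app_Cons_same\<close>)
    moreover have "?f\<lparr>busy := True\<rparr> = f\<lparr>busy := True, nonzero := False\<rparr>"
      by (cases f) simp
    ultimately show ?thesis using Cons.prems True
      unfolding dec_scan_def by (subst wp_Loop_unfold) (simp add: wp_simps)
  next
    case False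
    then have b: "b = 1" using Cons.prems by auto
    have f: "f' = f\<lparr>busy := False, nonzero := True\<rparr>\<lparr>busy := False\<rparr>"
      using Cons.prems(10) b by (cases f) simp
    have "wp w N (restore r (\<lambda>f. if nonzero f then 1 else 0)) Q (f\<lparr>busy := False, nonzero := True\<rparr>, p, st(r := 0 # bs), o1)"
      by (rule wp_restore[where k = k and v = 1 and st' = st' and Q = Q]) (use Cons.prems f b in simp_all)
    with Cons.prems b show ?thesis
      unfolding dec_scan_def by (subst wp_Loop_unfold)
        (simp add: wp_simps min_def wp_Loop_unfold[of w N busy _ _ "(f\<lparr>busy := False, nonzero := True\<rparr>, p, _, o1)"])
  qed
qed

lemma wp_dec:
  assumes "st Carry = []" "counts K (st r) n" "K \<le> N"
    "r \<noteq> Carry" "p \<le> length w + 1" "\<not> busy f"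
    and "\<And>bs. counts K bs (n - 1) \<Longrightarrow> Q (f\<lparr>nonzero := n \<noteq> 0\<rparr>, p, st(r := bs), o1)"
  shows "wp w N (dec r) Q (f, p, st, o1)"
proof -
  have n: "binval (st r) = n" "set (st r) \<subseteq> {0, 1}" "length (st r) \<le> K"
    using assms(2) by (auto simp: counts_def)
  define bs where "bs = (if n \<noteq> 0 then dec_bits (st r) else st r)"
  have bs: "counts K bs (n - 1)" using counts_dec[OF assms(2)] assms(2) by (auto simp: bs_def)
  have "wp w N (dec_scan r)
     (wp w N (Seq (Cond nonzero (Push r (\<lambda>_. 0)) skip) (restore r (\<lambda>f. if nonzero f then 1 else 0))) Q)
     (f\<lparr>busy := True\<rparr>, p, st, o1)"
  proof (rule wp_dec_aux[where k = 0 and st' = "st(r := bs)" and Q = Q, OF HOL.refl])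
    show "f\<lparr>nonzero := n \<noteq> 0\<rparr> = f\<lparr>busy := False, nonzero := binval (st r) \<noteq> 0\<rparr>"
      using assms(6) n by (cases f) simp
    show "Q (f\<lparr>nonzero := n \<noteq> 0\<rparr>, p, st(r := bs), o1)" using assms(7)[OF bs] .
  qed (use assms n in \<open>auto simp: bs_def\<close>)
  then show ?thesis unfolding dec_def using assms(5) by (simp add: wp_simps min_def)
qed

section \<open>Programs with two counters and a simulated tape\<close>

(* Stores stay single variables instead of being split into tuples. *)
declare split_paired_All [simp del] split_paired_Ex [simp del]

text \<open>
  Abstract stores: control, position of the input head, the two parts of the simulated tape, the
  values of the two counters, output. The representation of the counters is hidden from here on.
\<close>

type_synonym 'y astate = "vars \<times> nat \<times> nat list \<times> nat list \<times> nat \<times> nat \<times> 'y list"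

definition shows_as :: "nat \<Rightarrow> 'x list \<Rightarrow> 'y astate \<Rightarrow> (vars, reg, 'y) store \<Rightarrow> bool" where
  "shows_as K w \<sigma> s \<longleftrightarrow> (case \<sigma> of (f, p, L, R, a, b, o1) \<Rightarrow> case s of (f', p', st, o') \<Rightarrow>
     f' = f \<and> p' = p \<and> o' = o1 \<and> \<not> busy f \<and> p \<le> length w + 1 \<and>
     st LeftPart = L \<and> st RightPart = R \<and> st Carry = [] \<and>
     counts K (st CountA) a \<and> counts K (st CountB) b)"

text \<open>
  The predicate transformer on abstract stores. Its rules are backward rules, one per
  instruction, so that a program is verified by introduction. Every abstract store comes with \<open>\<not>
  busy f\<close> and a bound on the head position; the rules make these facts available where they are
  needed.
\<close>

definition awp :: "'x list \<Rightarrow> nat \<Rightarrow> nat \<Rightarrow> ('x, 'y) vprog \<Rightarrow> ('y astate \<Rightarrow> bool) \<Rightarrow> 'y astate \<Rightarrow> bool" where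
  "awp w N K c Q \<sigma> \<longleftrightarrow> (\<forall>s. shows_as K w \<sigma> s \<longrightarrow> wp w N c (\<lambda>s'. \<exists>\<sigma>'. shows_as K w \<sigma>' s' \<and> Q \<sigma>') s)"

definition top_of :: "nat list \<Rightarrow> nat option" where
  "top_of L = (case L of [] \<Rightarrow> None | v # _ \<Rightarrow> Some v)"

lemma top_of_simps [simp]: "top_of [] = None" "top_of (v # L) = Some v"
  by (simp_all add: top_of_def)

lemma awp_Seq: "awp w N K c (awp w N K d Q) \<sigma> \<Longrightarrow> awp w N K (Seq c d) Q \<sigma>"
  unfolding awp_def[of _ _ _ "Seq c d"] wp.simps
proof (intro allI impI)
  fix s assume "awp w N K c (awp w N K d Q) \<sigma>" "shows_as K w \<sigma> s"
  then have "wp w N c (\<lambda>s'. \<exists>\<sigma>'. shows_as K w \<sigma>' s' \<and> awp w N K d Q \<sigma>') s" by (simp add: awp_def)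
  then show "wp w N c (wp w N d (\<lambda>s'. \<exists>\<sigma>'. shows_as K w \<sigma>' s' \<and> Q \<sigma>')) s"
    by (rule wp_conseq) (auto simp: awp_def)
qed

lemma awp_Cond:
  "(if b (fst \<sigma>) then awp w N K c Q \<sigma> else awp w N K d Q \<sigma>) \<Longrightarrow> awp w N K (Cond b c d) Q \<sigma>"
  by (auto simp: awp_def shows_as_def split: if_splits)

lemma awp_Loop:
  assumes "if b (fst \<sigma>) then awp w N K c (awp w N K (Loop b c) Q) \<sigma> else Q \<sigma>"
  shows "awp w N K (Loop b c) Q \<sigma>"
  unfolding awp_def
proof (intro allI impI)
  let ?Q = "\<lambda>s'. \<exists>\<sigma>'. shows_as K w \<sigma>' s' \<and> Q \<sigma>'"
  fix s assume s: "shows_as K w \<sigma> s"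
  then have f: "fst s = fst \<sigma>" by (auto simp: shows_as_def)
  show "wp w N (Loop b c) ?Q s"
  proof (cases "b (fst \<sigma>)")
    case True
    with assms s have "wp w N c (\<lambda>s'. \<exists>\<sigma>'. shows_as K w \<sigma>' s' \<and> awp w N K (Loop b c) Q \<sigma>') s"
      by (simp add: awp_def)
    then have "wp w N c (wp w N (Loop b c) ?Q) s"
      by (rule wp_conseq) (auto simp: awp_def)
    then show ?thesis using True f by (subst wp_Loop_unfold) simp
  next
    case False
    then show ?thesis using assms s f by (subst wp_Loop_unfold) auto
  qed
qed

lemma awpI:
  assumes "\<And>st. st LeftPart = L \<Longrightarrow> st RightPart = R \<Longrightarrow> st Carry = [] \<Longrightarrow>
    counts K (st CountA) a \<Longrightarrow> counts K (st CountB) b \<Longrightarrow> \<not> busy f \<Longrightarrow> p \<le> length w + 1 \<Longrightarrow>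
    wp w N c (\<lambda>s. \<exists>\<sigma>. shows_as K w \<sigma> s \<and> Q \<sigma>) (f, p, st, o1)"
  shows "awp w N K c Q (f, p, L, R, a, b, o1)"
  using assms by (auto simp: awp_def shows_as_def)

lemma ex_shows_asI:
  assumes "Q (f, p, st LeftPart, st RightPart, a, b, o1)" "\<not> busy f" "p \<le> length w + 1" "st Carry = []"
    "counts K (st CountA) a" "counts K (st CountB) b"
  shows "\<exists>\<sigma>. shows_as K w \<sigma> (f, p, st, o1) \<and> Q \<sigma>"
  by (rule exI[of _ "(f, p, st LeftPart, st RightPart, a, b, o1)"]) (use assms in \<open>simp add: shows_as_def\<close>)

lemma awp_Act:
  assumes "g f (in_sym_at w p) = (f', e, u)"
    and "\<not> busy f \<Longrightarrow> \<not> busy f'"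
    and "Q (f', min (move_head e p) (length w + 1), L, R, a, b, o1 @ u)"
  shows "awp w N K (Act g) Q (f, p, L, R, a, b, o1)"
  using assms by (intro awpI) (auto intro!: ex_shows_asI)

lemma awp_Act_Stay:
  assumes "\<not> busy f \<Longrightarrow> \<not> busy (g f (in_sym_at w p))"
    and "Q (g f (in_sym_at w p), p, L, R, a, b, o1)"
  shows "awp w N K (Act (\<lambda>f x. (g f x, Stay, []))) Q (f, p, L, R, a, b, o1)"
  using assms by (intro awpI) (auto simp: min_def intro!: ex_shows_asI)

lemma awp_upd:
  assumes "\<not> busy f \<Longrightarrow> \<not> busy (g f)" "p \<le> length w + 1 \<Longrightarrow> Q (g f, p, L, R, a, b, o1)"
  shows "awp w N K (upd g) Q (f, p, L, R, a, b, o1)"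
  using assms by (intro awpI) (auto simp: wp_simps min_def intro!: ex_shows_asI)

lemma awp_skip:
  assumes "Q (f, p, L, R, a, b, o1)"
  shows "awp w N K skip Q (f, p, L, R, a, b, o1)"
  using assms by (intro awpI) (auto simp: wp_simps min_def intro!: ex_shows_asI)

lemma awp_mv:
  assumes "Q (f, min (move_head e p) (length w + 1), L, R, a, b, o1)"
  shows "awp w N K (mv e) Q (f, p, L, R, a, b, o1)"
  using assms by (intro awpI) (auto simp: wp_simps intro!: ex_shows_asI)

lemma awp_Push_Left:
  assumes "length L < N" "Q (f, p, g f # L, R, a, b, o1)"
  shows "awp w N K (Push LeftPart g) Q (f, p, L, R, a, b, o1)"
  using assms by (intro awpI) (auto intro!: ex_shows_asI)

lemma awp_Push_Right:
  assumes "length R < N" "Q (f, p, L, g f # R, a, b, o1)"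
  shows "awp w N K (Push RightPart g) Q (f, p, L, R, a, b, o1)"
  using assms by (intro awpI) (auto intro!: ex_shows_asI)

lemma awp_Pop_Left:
  assumes "\<not> busy f \<Longrightarrow> \<not> busy (h (top_of L) f)" "Q (h (top_of L) f, p, tl L, R, a, b, o1)"
  shows "awp w N K (Pop LeftPart h) Q (f, p, L, R, a, b, o1)"
  using assms by (intro awpI) (auto split: list.splits intro!: ex_shows_asI)

lemma awp_Pop_Right:
  assumes "\<not> busy f \<Longrightarrow> \<not> busy (h (top_of R) f)" "Q (h (top_of R) f, p, L, tl R, a, b, o1)"
  shows "awp w N K (Pop RightPart h) Q (f, p, L, R, a, b, o1)"
  using assms by (intro awpI) (auto split: list.splits intro!: ex_shows_asI)

context
  fixes w :: "'x list" and N K :: nat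
  assumes KN: "K \<le> N"
begin

lemma awp_inc_A:
  assumes "a + 1 < 2 ^ K" "Q (f, p, L, R, a + 1, b, o1)"
  shows "awp w N K (inc CountA) Q (f, p, L, R, a, b, o1)"
  using assms KN by (intro awpI wp_inc[where K = K and n = a]) (auto intro!: ex_shows_asI)

lemma awp_inc_B:
  assumes "b + 1 < 2 ^ K" "Q (f, p, L, R, a, b + 1, o1)"
  shows "awp w N K (inc CountB) Q (f, p, L, R, a, b, o1)"
  using assms KN by (intro awpI wp_inc[where K = K and n = b]) (auto intro!: ex_shows_asI)

lemma awp_dec_A:
  assumes "Q (f\<lparr>nonzero := a \<noteq> 0\<rparr>, p, L, R, a - 1, b, o1)"
  shows "awp w N K (dec CountA) Q (f, p, L, R, a, b, o1)"
  using assms KN by (intro awpI wp_dec[where K = K and n = a]) (auto intro!: ex_shows_asI)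

lemma awp_dec_B:
  assumes "Q (f\<lparr>nonzero := b \<noteq> 0\<rparr>, p, L, R, a, b - 1, o1)"
  shows "awp w N K (dec CountB) Q (f, p, L, R, a, b, o1)"
  using assms KN by (intro awpI wp_dec[where K = K and n = b]) (auto intro!: ex_shows_asI)

lemma awp_ztest_A:
  assumes "a < 2 ^ K" "Q (f\<lparr>nonzero := a \<noteq> 0\<rparr>, p, L, R, a, b, o1)"
  shows "awp w N K (ztest CountA) Q (f, p, L, R, a, b, o1)"
  unfolding ztest_def
  using assms by (intro awp_Seq awp_dec_A awp_Cond) (auto intro!: awp_inc_A awp_skip)

end

section \<open>Simulating a transducer on a word derived from a window of the input\<close>

text \<open>
  Let \<open>w(i, j]\<close> be a window of the input. The virtual word is what the map \<open>\<alpha>\<close> makes of the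
  letters in a pass forwards, followed by what \<open>\<beta>\<close> makes of them in a pass backwards. The real
  head at position \<open>p\<close> is accompanied by the counters \<open>p - i\<close> and \<open>j - p\<close>. Together with the
  direction of the pass and an offset into the block of letters that \<open>\<alpha>\<close> or \<open>\<beta>\<close> assigns to the
  current letter, it represents a position of the head on the virtual word. Position \<open>i\<close>, just
  before the window, stands for the left end marker in the first pass and for the right end
  marker in the second.
\<close>

definition blk :: "('x \<Rightarrow> 'z list) \<Rightarrow> ('x \<Rightarrow> 'z list) \<Rightarrow> bool \<Rightarrow> 'x in_sym \<Rightarrow> 'z list" where
  "blk \<alpha> \<beta> bp x = (case x of Letter z \<Rightarrow> (if bp then \<beta> z else \<alpha> z) | _ \<Rightarrow> [])"

definition vsym :: "('x \<Rightarrow> 'z list) \<Rightarrow> ('x \<Rightarrow> 'z list) \<Rightarrow> vars \<Rightarrow> 'x in_sym \<Rightarrow> 'z in_sym" where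
  "vsym \<alpha> \<beta> f x = (if \<not> nonzero f then (if back_pass f then RightEnd else LeftEnd)
     else Letter (blk \<alpha> \<beta> (back_pass f) x ! offset f))"

definition blen :: "('x \<Rightarrow> 'z list) \<Rightarrow> ('x \<Rightarrow> 'z list) \<Rightarrow> vars \<Rightarrow> 'x in_sym \<Rightarrow> nat" where
  "blen \<alpha> \<beta> f x = (if nonzero f then length (blk \<alpha> \<beta> (back_pass f) x) else 1)"

text \<open>
  One block on (\<open>fwd\<close>) or back. The real head goes right iff the direction of the virtual head
  and the direction of the pass agree. At the right end of the window the pass changes instead
  and the head stays, because the last letter of the window ends one pass and begins the next.
\<close>

definition hop :: "bool \<Rightarrow> ('x, 'y) vprog" where
  "hop fwd = Seq (Cond (\<lambda>f. back_pass f \<noteq> fwd)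
       (Seq (dec CountB) (Cond nonzero (Seq (inc CountA) (mv MoveRight))
          (upd (\<lambda>f. f\<lparr>back_pass := \<not> back_pass f\<rparr>))))
       (Seq (dec CountA) (Seq (inc CountB) (mv MoveLeft))))
     (ztest CountA)"

text \<open>Empty blocks contain no square of the virtual tape and are skipped.\<close>

definition vmove_loop :: "('x \<Rightarrow> 'z list) \<Rightarrow> ('x \<Rightarrow> 'z list) \<Rightarrow> bool \<Rightarrow> ('x, 'y) vprog" where
  "vmove_loop \<alpha> \<beta> fwd = Loop again (Seq (hop fwd) (Act (\<lambda>f x.
     (f\<lparr>offset := (if fwd then 0 else blen \<alpha> \<beta> f x - 1), again := (blen \<alpha> \<beta> f x = 0)\<rparr>, Stay, []))))"

text \<open>
  The move inside a block. If it would leave the block, then \<open>again\<close> requests a hop, except at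
  the end markers, where the virtual head stays.
\<close>

definition vmove_act :: "('x \<Rightarrow> 'z list) \<Rightarrow> ('x \<Rightarrow> 'z list) \<Rightarrow> bool \<Rightarrow> vars \<Rightarrow> 'x in_sym \<Rightarrow> vars" where
  "vmove_act \<alpha> \<beta> fwd f x =
     (if (if fwd then offset f + 1 < blen \<alpha> \<beta> f x else 0 < offset f)
      then f\<lparr>offset := (if fwd then offset f + 1 else offset f - 1), again := False\<rparr>
      else f\<lparr>again := (nonzero f \<or> back_pass f \<noteq> fwd)\<rparr>)"

definition vmove :: "('x \<Rightarrow> 'z list) \<Rightarrow> ('x \<Rightarrow> 'z list) \<Rightarrow> bool \<Rightarrow> ('x, 'y) vprog" where
  "vmove \<alpha> \<beta> fwd = Seq (Act (\<lambda>f x. (vmove_act \<alpha> \<beta> fwd f x, Stay, []))) (vmove_loop \<alpha> \<beta> fwd)"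

definition keeps :: "vars \<Rightarrow> vars \<Rightarrow> bool" where
  "keeps f f' \<longleftrightarrow> sim_state f' = sim_state f \<and> sim_sym f' = sim_sym f \<and> running f' = running f \<and>
     answer f' = answer f"

lemma in_sym_at_ends: "h \<le> length u + 1 \<Longrightarrow> in_sym_at u h = (LeftEnd # map Letter u @ [RightEnd]) ! h"
  by (cases h) (auto simp: in_sym_at_def nth_append not_less less_Suc_eq_le)

lemma split_two_passes: "[0..<2 * n + 2] = 0 # [1..<n + 1] @ [n + 1..<2 * n + 1] @ [2 * n + 1]" for n :: nat
proof -
  have "[0..<2 * n + 2] = [0..<2 * n + 1] @ [2 * n + 1]" by simp
  also have "[0..<2 * n + 1] = 0 # [1..<2 * n + 1]" by (simp add: upt_rec[of 0] del: upt_Suc)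
  also have "[1..<2 * n + 1] = [1..<n + 1] @ [n + 1..<2 * n + 1]"
    using upt_add_eq_append[of 1 "n + 1" n] by (simp add: mult_2 del: upt_Suc)
  finally show ?thesis by simp
qed

locale window =
  fixes w :: "'x list" and N K i j :: nat and \<alpha> \<beta> :: "'x \<Rightarrow> 'z list"
  assumes KN: "K \<le> N" and wK: "length w < 2 ^ K" and ij: "i \<le> j" and jw: "j \<le> length w"
begin

definition m :: nat where "m = j - i"

lemma im: "i + m = j"
  using ij by (simp add: m_def)

definition seg :: "'x list" where
  "seg = take (j - i) (drop i w)"

definition vword :: "'z list" where
  "vword = concat (map \<alpha> seg) @ concat (map \<beta> (rev seg))"

text \<open>
  The virtual tape, end markers included, is the concatenation of the blocks \<open>0, \<dots>, 2 * m + 1\<close>.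
  Block \<open>k\<close> lies at distance \<open>dist k\<close> from position \<open>i\<close>, and \<open>pref k\<close> is the position of its
  first square.
\<close>

definition block :: "nat \<Rightarrow> 'z in_sym list" where
  "block k = (if k = 0 then [LeftEnd] else if k \<le> m then map Letter (\<alpha> (seg ! (k - 1)))
     else if k \<le> 2 * m then map Letter (\<beta> (seg ! (2 * m - k))) else [RightEnd])"

definition pref :: "nat \<Rightarrow> nat" where
  "pref k = length (concat (map block [0..<k]))"

definition dist :: "nat \<Rightarrow> nat" where
  "dist k = (if k \<le> m then k else 2 * m + 1 - k)"

definition at_block :: "nat \<Rightarrow> vars \<Rightarrow> nat \<Rightarrow> nat \<Rightarrow> nat \<Rightarrow> bool" where
  "at_block k f p a b \<longleftrightarrow> k \<le> 2 * m + 1 \<and> back_pass f = (m < k) \<and> a = dist k \<and> p = i + dist k \<and> b = m - dist k"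

definition vat :: "nat \<Rightarrow> vars \<Rightarrow> nat \<Rightarrow> nat \<Rightarrow> nat \<Rightarrow> bool" where
  "vat h f p a b \<longleftrightarrow> (\<exists>k. at_block k f p a b \<and> offset f < length (block k) \<and> h = pref k + offset f)"

lemma length_seg: "length seg = m"
  using ij jw by (simp add: seg_def m_def)

lemma pref_Suc: "pref (Suc k) = pref k + length (block k)"
  by (simp add: pref_def)

lemma dist_le: "dist k \<le> m"
  by (auto simp: dist_def)

lemma concat_blocks: "concat (map block [0..<2 * m + 2]) = LeftEnd # map Letter vword @ [RightEnd]"
proof -
  have s: "[0..<2 * m + 2] = 0 # [1..<m + 1] @ [m + 1..<2 * m + 1] @ [2 * m + 1]"
    by (rule split_two_passes)
  have a: "map block [1..<m + 1] = map (\<lambda>z. map Letter (\<alpha> z)) seg"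
    by (rule nth_equalityI) (auto simp: length_seg block_def simp del: upt_Suc)
  have b: "map block [m + 1..<2 * m + 1] = map (\<lambda>z. map Letter (\<beta> z)) (rev seg)"
    by (rule nth_equalityI) (auto simp: length_seg block_def rev_nth mult_2 simp del: upt_Suc)
  show ?thesis unfolding s
    by (simp only: map_append list.map a b concat.simps concat_append)
      (simp add: block_def vword_def map_concat comp_def rev_map)
qed

lemma pref_last: "pref (2 * m + 2) = length vword + 2"
  unfolding pref_def concat_blocks by simp

lemma block_at:
  assumes "k \<le> 2 * m + 1" "r < length (block k)"
  shows "in_sym_at vword (pref k + r) = block k ! r" "pref k + r \<le> length vword + 1"
proof -
  have "[0..<2 * m + 2] = [0..<k] @ [k..<2 * m + 2]"
    using upt_add_eq_append[of 0 k "2 * m + 2 - k"] assms(1) by simp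
  also have "[k..<2 * m + 2] = k # [Suc k..<2 * m + 2]"
    using assms(1) by (subst upt_rec) simp
  finally have *: "concat (map block [0..<2 * m + 2]) =
      concat (map block [0..<k]) @ block k @ concat (map block [Suc k..<2 * m + 2])"
    by simp
  have "length (concat (map block [0..<2 * m + 2])) = length vword + 2"
    unfolding concat_blocks by simp
  then show le: "pref k + r \<le> length vword + 1" using assms(2) unfolding * pref_def by simp
  show "in_sym_at vword (pref k + r) = block k ! r"
    unfolding in_sym_at_ends[OF le] concat_blocks[symmetric] * using assms(2)
    by (simp add: pref_def nth_append)
qed

lemma real_sym:
  assumes "0 < a" "a \<le> m"
  shows "in_sym_at w (i + a) = Letter (seg ! (a - 1))"
  using assms im jw by (auto simp: in_sym_at_def seg_def m_def)

lemma at_block_blk: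
  assumes "at_block k f p a b" "a \<noteq> 0"
  shows "map Letter (blk \<alpha> \<beta> (back_pass f) (in_sym_at w p)) = block k"
proof -
  have d: "0 < dist k" "dist k \<le> m" using assms dist_le by (auto simp: at_block_def)
  have "in_sym_at w p = Letter (seg ! (dist k - 1))"
    using real_sym[OF d] assms(1) by (simp add: at_block_def)
  then show ?thesis using assms d by (auto simp: at_block_def blk_def block_def dist_def split: if_splits)
qed

lemma block_zero:
  assumes "at_block k f p 0 b"
  shows "block k = (if back_pass f then [RightEnd] else [LeftEnd])"
  using assms by (auto simp: at_block_def block_def dist_def split: if_splits)

lemma blen_block:
  assumes "at_block k f p a b" "nonzero f = (a \<noteq> 0)"
  shows "blen \<alpha> \<beta> f (in_sym_at w p) = length (block k)"
proof (cases "a = 0")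
  case True
  then show ?thesis using assms block_zero[of k f p b] by (simp add: blen_def)
next
  case False
  then show ?thesis using assms arg_cong[OF at_block_blk[OF assms(1) False], of length] by (simp add: blen_def)
qed

lemma vsym_block:
  assumes "at_block k f p a b" "nonzero f = (a \<noteq> 0)" "offset f < length (block k)"
  shows "vsym \<alpha> \<beta> f (in_sym_at w p) = block k ! offset f"
proof (cases "a = 0")
  case True
  then show ?thesis using assms block_zero[of k f p b] by (auto simp: vsym_def)
next
  case False
  have "offset f < length (blk \<alpha> \<beta> (back_pass f) (in_sym_at w p))"
    using blen_block[OF assms(1,2)] assms(2,3) False by (simp add: blen_def)
  then show ?thesis using assms(2) False
    by (simp add: vsym_def flip: at_block_blk[OF assms(1) False])
qed

lemma vsym_vat:
  assumes "vat h f p a b" "nonzero f = (a \<noteq> 0)"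
  shows "vsym \<alpha> \<beta> f (in_sym_at w p) = in_sym_at vword h"
  using assms vsym_block block_at(1) unfolding vat_def by (metis at_block_def)

lemma awp_hop:
  assumes "at_block k f p a b"
    and k': "if fwd then k < 2 * m + 1 \<and> k' = k + 1 else 0 < k \<and> k' = k - 1"
    and Q: "\<And>f' p' a' b'. at_block k' f' p' a' b' \<Longrightarrow> nonzero f' = (a' \<noteq> 0) \<Longrightarrow> keeps f f' \<Longrightarrow>
      Q (f', p', L, R, a', b', o1)"
  shows "awp w N K (hop fwd) Q (f, p, L, R, a, b, o1)"
proof -
  have at: "k \<le> 2 * m + 1" "back_pass f = (m < k)" "a = dist k" "p = i + dist k" "b = m - dist k"
    using assms(1) by (auto simp: at_block_def)
  have mw: "m < 2 ^ K" "m \<le> length w" using wK jw im by linarith+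
  have pw: "i + dist k \<le> length w" using dist_le[of k] im jw by linarith
  show ?thesis
  proof (cases "back_pass f \<noteq> fwd")
    case True
    show ?thesis
    proof (cases "b = 0")
      case b0: True
      let ?f = "f\<lparr>nonzero := False, back_pass := \<not> back_pass f, nonzero := dist k \<noteq> 0\<rparr>"
      have dk: "dist k = m" using at b0 dist_le[of k] by simp
      have "at_block k' ?f p a b"
      proof (cases fwd)
        case fwd: True
        then have "k = m" using at True dk by (simp add: dist_def)
        then show ?thesis using at fwd k' by (auto simp: at_block_def dist_def)
      next
        case fwd: False
        then have "k = m + 1" using at True dk by (simp add: dist_def)
        then show ?thesis using at fwd k' by (auto simp: at_block_def dist_def)
      qed
      then have "Q (?f, p, L, R, a, b, o1)" by (rule Q) (use at in \<open>auto simp: keeps_def\<close>)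
      then show ?thesis unfolding hop_def using True b0 at mw dist_le[of k]
        by (intro awp_Seq awp_Cond) (auto intro!: awp_Seq awp_dec_B[OF KN] awp_Cond awp_upd awp_ztest_A[OF KN])
    next
      case b0: False
      let ?f = "f\<lparr>nonzero := True, nonzero := a + 1 \<noteq> 0\<rparr>"
      have a1: "a + 1 \<le> m" using b0 at by auto
      have "at_block k' ?f (p + 1) (a + 1) (b - 1)"
        using at True k' b0 by (auto simp: at_block_def dist_def split: if_splits)
      then have "Q (?f, p + 1, L, R, a + 1, b - 1, o1)" by (rule Q) (auto simp: keeps_def)
      then show ?thesis unfolding hop_def using True b0 mw a1 at pw
        by (intro awp_Seq awp_Cond)
          (auto simp: min_def intro!: awp_Seq awp_dec_B[OF KN] awp_Cond awp_inc_A[OF KN] awp_mv awp_ztest_A[OF KN])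
    qed
  next
    case False
    let ?f = "f\<lparr>nonzero := True, nonzero := a - 1 \<noteq> 0\<rparr>"
    have a0: "a \<noteq> 0" using at False k' by (auto simp: dist_def split: if_splits)
    have "at_block k' ?f (p - 1) (a - 1) (b + 1)"
      using at False k' a0 by (auto simp: at_block_def dist_def split: if_splits)
    then have "Q (?f, p - 1, L, R, a - 1, b + 1, o1)" by (rule Q) (auto simp: keeps_def)
    then show ?thesis unfolding hop_def using False a0 mw at pw dist_le[of k]
      by (intro awp_Seq awp_Cond)
        (auto simp: min_def intro!: awp_Seq awp_dec_A[OF KN] awp_inc_B[OF KN] awp_mv awp_ztest_A[OF KN])
  qed
qed

lemma block_ends: "block 0 \<noteq> []" "block (2 * m + 1) \<noteq> []"
  by (auto simp: block_def)

text \<open>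
  The offset is that of the first square, and the target \<open>pref k\<close> is the same for all empty
  blocks in a row.
\<close>

lemma awp_vmove_loop_fwd:
  assumes "at_block k f p a b" "again f = (block k = [])" "offset f = 0"
    and Q: "\<And>f' p' a' b'. vat (pref k) f' p' a' b' \<Longrightarrow> keeps f f' \<Longrightarrow> Q (f', p', L, R, a', b', o1)"
  shows "awp w N K (vmove_loop \<alpha> \<beta> True) Q (f, p, L, R, a, b, o1)"
  using assms
proof (induction "2 * m + 1 - k" arbitrary: k f p a b rule: less_induct)
  case less
  show ?case
  proof (cases "block k = []")
    case True
    then have k: "k < 2 * m + 1" using less.prems(1) block_ends
      by (metis at_block_def le_neq_implies_less)
    have "awp w N K (hop True) (awp w N K (Act (\<lambda>f x. (f\<lparr>offset := 0, again := (blen \<alpha> \<beta> f x = 0)\<rparr>, Stay, [])))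
      (awp w N K (vmove_loop \<alpha> \<beta> True) Q)) (f, p, L, R, a, b, o1)"
    proof (rule awp_hop[OF less.prems(1), where k' = "k + 1"])
      fix f' p' a' b'
      assume f': "at_block (k + 1) f' p' a' b'" "nonzero f' = (a' \<noteq> 0)" "keeps f f'"
      let ?f = "f'\<lparr>offset := 0, again := (blen \<alpha> \<beta> f' (in_sym_at w p') = 0)\<rparr>"
      have p': "p' \<le> length w + 1"
        using f'(1) dist_le[of "k + 1"] im jw unfolding at_block_def by linarith
      have "awp w N K (vmove_loop \<alpha> \<beta> True) Q (?f, p', L, R, a', b', o1)"
      proof (rule less.hyps[of "k + 1"])
        show "2 * m + 1 - (k + 1) < 2 * m + 1 - k" using k by simp
        show "at_block (k + 1) ?f p' a' b'" using f'(1) by (simp add: at_block_def)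
        show "again ?f = (block (k + 1) = [])" using blen_block[OF f'(1,2)] by simp
        show "offset ?f = 0" by simp
        fix f'' p'' a'' b'' assume "vat (pref (k + 1)) f'' p'' a'' b''" "keeps ?f f''"
        then show "Q (f'', p'', L, R, a'', b'', o1)"
          using less.prems(4)[of f'' p'' a'' b''] f'(3) True by (simp add: pref_Suc keeps_def)
      qed
      then show "awp w N K (Act (\<lambda>f x. (f\<lparr>offset := 0, again := (blen \<alpha> \<beta> f x = 0)\<rparr>, Stay, [])))
        (awp w N K (vmove_loop \<alpha> \<beta> True) Q) (f', p', L, R, a', b', o1)"
        by (intro awp_Act_Stay) simp_all
    qed (use k in auto)
    then show ?thesis using less.prems(2) True unfolding vmove_loop_def
      by (intro awp_Loop) (auto intro!: awp_Seq)
  next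
    case False
    have "vat (pref k) f p a b" using less.prems False by (auto simp: vat_def)
    then have "Q (f, p, L, R, a, b, o1)" by (rule less.prems(4)) (simp add: keeps_def)
    then show ?thesis using less.prems(2) False unfolding vmove_loop_def by (intro awp_Loop) simp
  qed
qed

text \<open>
  The target \<open>h\<close> is the last square before \<open>pref k + length (block k)\<close>, which is again the same
  for all empty blocks in a row.
\<close>

lemma awp_vmove_loop_bwd:
  assumes "at_block k f p a b" "again f = (block k = [])" "offset f = length (block k) - 1"
    and "pref k + length (block k) = h + 1"
    and Q: "\<And>f' p' a' b'. vat h f' p' a' b' \<Longrightarrow> keeps f f' \<Longrightarrow> Q (f', p', L, R, a', b', o1)"
  shows "awp w N K (vmove_loop \<alpha> \<beta> False) Q (f, p, L, R, a, b, o1)"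
  using assms
proof (induction k arbitrary: f p a b)
  case 0
  then have "vat h f p a b" by (auto simp: vat_def block_def intro!: exI[of _ 0])
  then have "Q (f, p, L, R, a, b, o1)" by (rule 0(5)) (simp add: keeps_def)
  then show ?case using 0 block_ends unfolding vmove_loop_def by (intro awp_Loop) simp
next
  case (Suc k)
  show ?case
  proof (cases "block (Suc k) = []")
    case True
    have "awp w N K (hop False) (awp w N K
       (Act (\<lambda>f x. (f\<lparr>offset := blen \<alpha> \<beta> f x - 1, again := (blen \<alpha> \<beta> f x = 0)\<rparr>, Stay, [])))
      (awp w N K (vmove_loop \<alpha> \<beta> False) Q)) (f, p, L, R, a, b, o1)"
    proof (rule awp_hop[OF Suc.prems(1), where k' = k])
      fix f' p' a' b'
      assume f': "at_block k f' p' a' b'" "nonzero f' = (a' \<noteq> 0)" "keeps f f'"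
      let ?l = "blen \<alpha> \<beta> f' (in_sym_at w p')"
      let ?f = "f'\<lparr>offset := ?l - 1, again := (?l = 0)\<rparr>"
      have p': "p' \<le> length w + 1"
        using f'(1) dist_le[of k] im jw unfolding at_block_def by linarith
      have "awp w N K (vmove_loop \<alpha> \<beta> False) Q (?f, p', L, R, a', b', o1)"
      proof (rule Suc.IH)
        show "at_block k ?f p' a' b'" using f'(1) by (simp add: at_block_def)
        show "again ?f = (block k = [])" using blen_block[OF f'(1,2)] by simp
        show "offset ?f = length (block k) - 1" using blen_block[OF f'(1,2)] by simp
        show "pref k + length (block k) = h + 1" using Suc.prems(4) True by (simp add: pref_Suc)
        fix f'' p'' a'' b'' assume "vat h f'' p'' a'' b''" "keeps ?f f''"
        then show "Q (f'', p'', L, R, a'', b'', o1)"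
          using Suc.prems(5)[of f'' p'' a'' b''] f'(3) by (simp add: keeps_def)
      qed
      then show "awp w N K
       (Act (\<lambda>f x. (f\<lparr>offset := blen \<alpha> \<beta> f x - 1, again := (blen \<alpha> \<beta> f x = 0)\<rparr>, Stay, [])))
        (awp w N K (vmove_loop \<alpha> \<beta> False) Q) (f', p', L, R, a', b', o1)"
        by (intro awp_Act_Stay) simp_all
    qed auto
    then show ?thesis using Suc.prems(2) True unfolding vmove_loop_def
      by (intro awp_Loop) (auto intro!: awp_Seq)
  next
    case False
    then have "0 < length (block (Suc k))" by simp
    then have "offset f < length (block (Suc k))" "h = pref (Suc k) + offset f"
      using Suc.prems(3,4) by linarith+
    then have "vat h f p a b" using Suc.prems(1) unfolding vat_def by blast
    then have "Q (f, p, L, R, a, b, o1)" by (rule Suc.prems(5)) (simp add: keeps_def)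
    then show ?thesis using Suc.prems(2) False unfolding vmove_loop_def by (intro awp_Loop) simp
  qed
qed

lemma vat_p: "vat h f p a b \<Longrightarrow> p = i + a \<and> a \<le> m \<and> b = m - a \<and> p \<le> length w"
proof -
  assume "vat h f p a b"
  then obtain k where "p = i + dist k" "a = dist k" "b = m - dist k"
    by (auto simp: vat_def at_block_def)
  then show ?thesis using dist_le[of k] im jw by simp
qed

lemma vat_h: "vat h f p a b \<Longrightarrow> h \<le> length vword + 1"
  using block_at(2) unfolding vat_def at_block_def by blast

lemma awp_vmove:
  assumes "vat h f p a b" "nonzero f = (a \<noteq> 0)"
    and Q: "\<And>f' p' a' b'. vat (if fwd then min (h + 1) (length vword + 1) else h - 1) f' p' a' b' \<Longrightarrow>
      keeps f f' \<Longrightarrow> Q (f', p', L, R, a', b', o1)"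
  shows "awp w N K (vmove \<alpha> \<beta> fwd) Q (f, p, L, R, a, b, o1)"
proof -
  let ?h = "if fwd then min (h + 1) (length vword + 1) else h - 1"
  let ?f = "vmove_act \<alpha> \<beta> fwd f (in_sym_at w p)"
  obtain k where k: "at_block k f p a b" "offset f < length (block k)" "h = pref k + offset f"
    using assms(1) by (auto simp: vat_def)
  have k2: "k \<le> 2 * m + 1" and bp: "back_pass f = (m < k)" and a: "a = dist k"
    using k(1) by (auto simp: at_block_def)
  have p: "p \<le> length w" using vat_p[OF assms(1)] by simp
  have bl: "blen \<alpha> \<beta> f (in_sym_at w p) = length (block k)" by (rule blen_block) fact+
  have kf: "keeps f ?f" by (auto simp: keeps_def vmove_act_def)
  have "awp w N K (vmove_loop \<alpha> \<beta> fwd) Q (?f, p, L, R, a, b, o1)"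
  proof (cases "again ?f")
    case False
    have "vat ?h ?f p a b"
    proof (cases "if fwd then offset f + 1 < length (block k) else 0 < offset f")
      case True
      have "at_block k ?f p a b" using k(1) by (auto simp: at_block_def vmove_act_def)
      moreover have "offset ?f = (if fwd then offset f + 1 else offset f - 1)"
        using True by (cases fwd) (simp_all add: vmove_act_def bl)
      moreover have "pref k + offset f + 1 \<le> length vword + 1" if fwd
        using block_at(2)[OF k2, of "offset f + 1"] True that by simp
      ultimately show ?thesis using True k unfolding vat_def by (intro exI[of _ k]) auto
    next
      case nin: False
      then have f: "?f = f\<lparr>again := (nonzero f \<or> back_pass f \<noteq> fwd)\<rparr>"
        by (auto simp: vmove_act_def bl split: if_splits)
      then have e: "dist k = 0" "(m < k) = fwd" using False assms(2) a bp by auto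
      have "?h = h"
      proof (cases fwd)
        case True
        then have "k = 2 * m + 1" using e k2 by (auto simp: dist_def split: if_splits)
        then have "pref k + length (block k) = length vword + 2" using pref_last pref_Suc[of k] by simp
        then show ?thesis using True nin k by simp
      next
        case False
        then have "k = 0" using e k2 by (auto simp: dist_def split: if_splits)
        then show ?thesis using False nin k by (simp add: pref_def)
      qed
      then show ?thesis using k f unfolding vat_def by (intro exI[of _ k]) (auto simp: at_block_def)
    qed
    then have "Q (?f, p, L, R, a, b, o1)" using kf by (rule Q)
    then show ?thesis using False unfolding vmove_loop_def by (intro awp_Loop) simp
  next
    case True
    then have nin: "\<not> (if fwd then offset f + 1 < length (block k) else 0 < offset f)"
      and ag: "nonzero f \<or> back_pass f \<noteq> fwd"
      by (auto simp: vmove_act_def bl split: if_splits)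
    define k' where "k' = (if fwd then k + 1 else k - 1)"
    have kk: "if fwd then k < 2 * m + 1 \<and> k' = k + 1 else 0 < k \<and> k' = k - 1"
      using ag assms(2) a bp k2 by (auto simp: k'_def dist_def split: if_splits)
    have "at_block k ?f p a b" using k(1) by (auto simp: at_block_def vmove_act_def)
    then have "awp w N K (hop fwd) (awp w N K
       (Act (\<lambda>f x. (f\<lparr>offset := (if fwd then 0 else blen \<alpha> \<beta> f x - 1), again := (blen \<alpha> \<beta> f x = 0)\<rparr>, Stay, [])))
      (awp w N K (vmove_loop \<alpha> \<beta> fwd) Q)) (?f, p, L, R, a, b, o1)"
    proof (rule awp_hop[where k' = k'])
      fix f' p' a' b'
      assume f': "at_block k' f' p' a' b'" "nonzero f' = (a' \<noteq> 0)" "keeps ?f f'"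
      let ?l = "blen \<alpha> \<beta> f' (in_sym_at w p')"
      let ?g = "f'\<lparr>offset := (if fwd then 0 else ?l - 1), again := (?l = 0)\<rparr>"
      have p': "p' \<le> length w + 1"
        using f'(1) dist_le[of k'] im jw unfolding at_block_def by linarith
      have g: "at_block k' ?g p' a' b'" "again ?g = (block k' = [])"
        "offset ?g = (if fwd then 0 else length (block k') - 1)"
        using f'(1) blen_block[OF f'(1,2)] by (simp_all add: at_block_def)
      have QQ: "Q (f'', p'', L, R, a'', b'', o1)" if "vat ?h f'' p'' a'' b''" "keeps ?g f''" for f'' p'' a'' b''
        using Q[OF that(1)] that(2) f'(3) kf by (simp add: keeps_def)
      have "awp w N K (vmove_loop \<alpha> \<beta> fwd) Q (?g, p', L, R, a', b', o1)"
      proof (cases fwd)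
        case fwd: True
        have h1: "pref k' = h + 1" using fwd nin k by (simp add: k'_def pref_Suc)
        have "awp w N K (vmove_loop \<alpha> \<beta> True) Q (?g, p', L, R, a', b', o1)"
        proof (rule awp_vmove_loop_fwd[where k = k'])
          show "Q (f'', p'', L, R, a'', b'', o1)" if "vat (pref k') f'' p'' a'' b''" "keeps ?g f''" for f'' p'' a'' b''
          proof (rule QQ[OF _ that(2)])
            show "vat ?h f'' p'' a'' b''" using that(1) vat_h[OF that(1)] h1 fwd by simp
          qed
        qed (use g fwd in auto)
        then show ?thesis using fwd by simp
      next
        case fwd: False
        have "Suc k' = k" using kk fwd by auto
        then have h1: "pref k' + length (block k') = h" using fwd nin k pref_Suc[of k'] by auto
        moreover have "0 < pref k"
        proof -
          have "[0..<k] = 0 # [1..<k]" using \<open>Suc k' = k\<close> by (auto simp: upt_rec[of 0])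
          then show ?thesis using block_ends(1) by (simp add: pref_def)
        qed
        ultimately have h2: "pref k' + length (block k') = (h - 1) + 1" using k(3) by simp
        have "awp w N K (vmove_loop \<alpha> \<beta> False) Q (?g, p', L, R, a', b', o1)"
          by (rule awp_vmove_loop_bwd[where k = k', OF _ _ _ h2]) (use g fwd QQ in auto)
        then show ?thesis using fwd by simp
      qed
      then show "awp w N K
       (Act (\<lambda>f x. (f\<lparr>offset := (if fwd then 0 else blen \<alpha> \<beta> f x - 1), again := (blen \<alpha> \<beta> f x = 0)\<rparr>, Stay, [])))
        (awp w N K (vmove_loop \<alpha> \<beta> fwd) Q) (f', p', L, R, a', b', o1)"
        by (intro awp_Act_Stay) simp_all
    qed (rule kk)
    then show ?thesis using True unfolding vmove_loop_def
      by (intro awp_Loop) (auto intro!: awp_Seq)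
  qed
  then show ?thesis unfolding vmove_def using p
    by (intro awp_Seq awp_Act_Stay) (simp_all add: vmove_act_def)
qed

end

text \<open>
  The transition function cut down to the results that a well-formed machine produces on its own
  configurations. This makes the simulating program well-formed for arbitrary control states.
\<close>

definition cdelta :: "('z, 'v) transducer \<Rightarrow> 'v set \<Rightarrow> nat \<Rightarrow> nat \<Rightarrow> 'z in_sym \<Rightarrow> nat \<Rightarrow>
    (nat \<times> nat \<times> move \<times> move \<times> 'v list) option" where
  "cdelta M V D q a s = (case delta M q a s of
     None \<Rightarrow> None
   | Some (q', s', d, e, u) \<Rightarrow> if q' < D \<and> s' < D \<and> u \<in> lists V then Some (q', s', d, e, u) else None)"

text \<open>
  One transition of \<open>M\<close>. Each output letter \<open>v\<close> of \<open>M\<close> is translated to the word \<open>em v\<close>, and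
  \<open>answer\<close> records whether a letter with property \<open>test\<close> has been output. A halting
  configuration is treated as a transition that changes nothing, in agreement with
  \<open>next_config\<close>.
\<close>

definition sim_act :: "('z, 'v) transducer \<Rightarrow> 'v set \<Rightarrow> nat \<Rightarrow> ('x \<Rightarrow> 'z list) \<Rightarrow> ('x \<Rightarrow> 'z list) \<Rightarrow>
    ('v \<Rightarrow> 'y list) \<Rightarrow> ('v \<Rightarrow> bool) \<Rightarrow> vars \<Rightarrow> 'x in_sym \<Rightarrow> vars \<times> move \<times> 'y list" where
  "sim_act M V D \<alpha> \<beta> em test f x =
     (case cdelta M V D (sim_state f) (vsym \<alpha> \<beta> f x) (sim_sym f) of
        None \<Rightarrow> (f\<lparr>running := False, work_move := Stay, input_move := Stay\<rparr>, Stay, [])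
      | Some (q', s', d, e, u) \<Rightarrow>
          (f\<lparr>sim_state := q', sim_sym := s', work_move := d, input_move := e,
             answer := answer f \<or> (\<exists>v \<in> set u. test v)\<rparr>, Stay, concat (map em u)))"

text \<open>
  The tape of \<open>M\<close> is split at its head: the squares to the left form one stack, those to the
  right another, and the scanned symbol is in the control state. An empty right stack stands for
  blanks, an empty left stack for the left end of the tape.
\<close>

definition work_prog :: "('x, 'y) vprog" where
  "work_prog = Cond (\<lambda>f. work_move f = MoveRight)
     (Seq (Push LeftPart sim_sym)
        (Pop RightPart (\<lambda>v f. f\<lparr>sim_sym := (case v of None \<Rightarrow> 0 | Some x \<Rightarrow> x)\<rparr>)))
     (Cond (\<lambda>f. work_move f = MoveLeft)
        (Seq (Pop LeftPart (\<lambda>v f. f\<lparr>popped := (case v of None \<Rightarrow> 0 | Some x \<Rightarrow> x), again := v \<noteq> None\<rparr>))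
           (Cond again (Seq (Push RightPart sim_sym) (upd (\<lambda>f. f\<lparr>sim_sym := popped f\<rparr>))) skip))
        skip)"

definition input_prog :: "('x \<Rightarrow> 'z list) \<Rightarrow> ('x \<Rightarrow> 'z list) \<Rightarrow> ('x, 'y) vprog" where
  "input_prog \<alpha> \<beta> = Cond (\<lambda>f. input_move f = Stay) skip
     (Cond (\<lambda>f. input_move f = MoveRight) (vmove \<alpha> \<beta> True) (vmove \<alpha> \<beta> False))"

definition sim_loop where
  "sim_loop M V D \<alpha> \<beta> em test = Loop running
     (Seq (ztest CountA) (Seq (Act (sim_act M V D \<alpha> \<beta> em test)) (Seq work_prog (input_prog \<alpha> \<beta>))))"

definition clear :: "reg \<Rightarrow> ('x, 'y) vprog" where
  "clear r = Seq (upd (\<lambda>f. f\<lparr>again := True\<rparr>)) (Loop again (Pop r (\<lambda>v f. f\<lparr>again := v \<noteq> None\<rparr>)))"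

definition sim :: "('z, 'v) transducer \<Rightarrow> 'v set \<Rightarrow> nat \<Rightarrow> ('x \<Rightarrow> 'z list) \<Rightarrow> ('x \<Rightarrow> 'z list) \<Rightarrow>
    ('v \<Rightarrow> 'y list) \<Rightarrow> ('v \<Rightarrow> bool) \<Rightarrow> ('x, 'y) vprog" where
  "sim M V D \<alpha> \<beta> em test =
     Seq (upd (\<lambda>f. f\<lparr>sim_state := start M, sim_sym := 0, back_pass := False, offset := 0,
            answer := False, running := True\<rparr>))
     (Seq (sim_loop M V D \<alpha> \<beta> em test) (Seq (clear LeftPart) (clear RightPart)))"

definition tape :: "nat list \<Rightarrow> nat \<Rightarrow> nat" where
  "tape xs i = (if i < length xs then xs ! i else 0)"

lemma tape_pad: "tape (xs @ [0]) = tape xs"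
  by (auto simp: tape_def fun_eq_iff nth_append)

lemma tape_update: "(tape (xs @ s # ys))(length xs := t) = tape (xs @ t # ys)"
  by (auto simp: tape_def fun_eq_iff nth_append nth_Cons split: nat.split)

lemma tape_at: "tape (xs @ s # ys) (length xs) = s"
  by (simp add: tape_def)

lemma config_at_wf:
  assumes "wf_transducer X V M" "u \<in> lists X"
  shows "state (config_at M u t) \<in> states M \<and> (\<forall>k. work (config_at M u t) k \<in> work_syms M) \<and>
    in_pos (config_at M u t) \<le> length u + 1"
proof (induction t)
  case 0
  then show ?case using assms by (auto simp: config_at_def init_config_def wf_transducer_def)
next
  case (Suc t)
  let ?c = "config_at M u t"
  have sym: "in_sym_at u (in_pos ?c) \<in> {LeftEnd, RightEnd} \<union> Letter ` X"
    using assms(2) nth_mem[of "in_pos ?c - 1" u] by (auto simp: in_sym_at_def)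
  have n: "config_at M u (Suc t) = next_config M u ?c" by (simp add: config_at_def)
  show ?case
  proof (cases "cur_delta M u ?c")
    case None
    then show ?thesis using Suc by (simp add: n next_config_def)
  next
    case (Some r)
    obtain q s d e v where r: "r = (q, s, d, e, v)" by (cases r) auto
    have "q \<in> states M \<and> s \<in> work_syms M"
      using assms(1) Suc sym Some unfolding wf_transducer_def cur_delta_def r by blast
    then show ?thesis using Suc Some by (simp add: n next_config_def r)
  qed
qed

lemma cdelta_config_at:
  assumes "wf_transducer X V M" "u \<in> lists X" "states M \<union> work_syms M \<subseteq> {..<D}"
    and "c = config_at M u t"
  shows "cdelta M V D (state c) (in_sym_at u (in_pos c)) (work c (work_pos c)) = cur_delta M u c"
proof -
  have sym: "in_sym_at u (in_pos c) \<in> {LeftEnd, RightEnd} \<union> Letter ` X"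
    using assms(2) nth_mem[of "in_pos c - 1" u] by (auto simp: in_sym_at_def)
  have c: "state c \<in> states M" "work c (work_pos c) \<in> work_syms M"
    using config_at_wf[OF assms(1,2), of t] assms(4) by auto
  show ?thesis
  proof (cases "cur_delta M u c")
    case None
    then show ?thesis by (simp add: cdelta_def cur_delta_def)
  next
    case (Some r)
    obtain q s d e v where r: "r = (q, s, d, e, v)" by (cases r) auto
    have "q \<in> states M \<and> s \<in> work_syms M \<and> v \<in> lists V"
      using assms(1) c sym Some unfolding wf_transducer_def cur_delta_def r by blast
    then have "q < D" "s < D" "v \<in> lists V" using assms(3) by auto
    then show ?thesis using Some by (simp add: cdelta_def cur_delta_def r)
  qed
qed

definition keeps_work :: "vars \<Rightarrow> vars \<Rightarrow> bool" where
  "keeps_work f f' \<longleftrightarrow> sim_state f' = sim_state f \<and> running f' = running f \<and> answer f' = answer f \<and>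
     input_move f' = input_move f \<and> back_pass f' = back_pass f \<and> offset f' = offset f \<and>
     nonzero f' = nonzero f"

text \<open>
  The two stacks together are never higher than the number of squares visited: moves to the left
  and to the right shift squares between them, and only a move onto a fresh square adds one.
\<close>

lemma awp_work_prog:
  assumes "length L + length R \<le> B" "move_head (work_move f) (length L) \<le> B" "B < N"
    and Q: "\<And>f' L' R'. keeps_work f f' \<Longrightarrow> length L' = move_head (work_move f) (length L) \<Longrightarrow>
      length L' + length R' \<le> B \<Longrightarrow>
      tape (rev L' @ sim_sym f' # R') = tape (rev L @ sim_sym f # R) \<Longrightarrow> Q (f', p, L', R', a, b, o1)"
  shows "awp w N K work_prog Q (f, p, L, R, a, b, o1)"
proof (cases "work_move f")
  case MoveRight
  have "Q (f\<lparr>sim_sym := (case top_of R of None \<Rightarrow> 0 | Some x \<Rightarrow> x)\<rparr>, p, sim_sym f # L, tl R, a, b, o1)"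
  proof (rule Q)
    show "tape (rev (sim_sym f # L) @ sim_sym (f\<lparr>sim_sym := (case top_of R of None \<Rightarrow> 0 | Some x \<Rightarrow> x)\<rparr>) # tl R) =
      tape (rev L @ sim_sym f # R)"
      using tape_pad[of "rev L @ [sim_sym f]"] by (cases R) auto
  qed (use assms MoveRight in \<open>cases R; auto simp: keeps_work_def\<close>)+
  then show ?thesis unfolding work_prog_def using assms MoveRight
    by (intro awp_Cond) (auto intro!: awp_Seq awp_Push_Left awp_Pop_Right)
next
  case Stay
  have "Q (f, p, L, R, a, b, o1)" by (rule Q) (use assms Stay in \<open>auto simp: keeps_work_def\<close>)
  then show ?thesis unfolding work_prog_def using Stay
    by (intro awp_Cond) (auto intro!: awp_Cond awp_skip)
next
  case MoveLeft
  show ?thesis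
  proof (cases L)
    case Nil
    let ?f = "f\<lparr>popped := 0, again := False\<rparr>"
    have "Q (?f, p, L, R, a, b, o1)" by (rule Q) (use assms MoveLeft Nil in \<open>auto simp: keeps_work_def\<close>)
    then show ?thesis unfolding work_prog_def using MoveLeft Nil
      by (intro awp_Cond) (auto intro!: awp_Cond awp_skip awp_Seq awp_Pop_Left)
  next
    case (Cons s L')
    let ?f = "f\<lparr>popped := s, again := True, sim_sym := s\<rparr>"
    have "Q (?f, p, L', sim_sym f # R, a, b, o1)"
      by (rule Q) (use assms MoveLeft Cons in \<open>auto simp: keeps_work_def\<close>)
    then show ?thesis unfolding work_prog_def using MoveLeft Cons assms
      by (intro awp_Cond) (auto intro!: awp_Cond awp_upd awp_Seq awp_Pop_Left awp_Push_Right)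
  qed
qed

lemma awp_clear_Left:
  assumes "Q (f\<lparr>again := False\<rparr>, p, [], R, a, b, o1)"
  shows "awp w N K (clear LeftPart) Q (f, p, L, R, a, b, o1)"
proof -
  have "awp w N K (Loop again (Pop LeftPart (\<lambda>v f. f\<lparr>again := v \<noteq> None\<rparr>))) Q (f\<lparr>again := True\<rparr>, p, L, R, a, b, o1)"
  proof (induction L)
    case Nil
    then show ?case using assms by (auto intro!: awp_Loop awp_Pop_Left)
  next
    case (Cons s L)
    then show ?case by (intro awp_Loop) (auto intro!: awp_Pop_Left)
  qed
  then show ?thesis unfolding clear_def by (intro awp_Seq awp_upd) simp_all
qed

lemma awp_clear_Right:
  assumes "Q (f\<lparr>again := False\<rparr>, p, L, [], a, b, o1)"
  shows "awp w N K (clear RightPart) Q (f, p, L, R, a, b, o1)"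
proof -
  have "awp w N K (Loop again (Pop RightPart (\<lambda>v f. f\<lparr>again := v \<noteq> None\<rparr>))) Q (f\<lparr>again := True\<rparr>, p, L, R, a, b, o1)"
  proof (induction R)
    case Nil
    then show ?case using assms by (auto intro!: awp_Loop awp_Pop_Right)
  next
    case (Cons s R)
    then show ?case by (intro awp_Loop) (auto intro!: awp_Pop_Right)
  qed
  then show ?thesis unfolding clear_def by (intro awp_Seq awp_upd) simp_all
qed

context window
begin

text \<open>
  The store represents the configuration \<open>c\<close> of \<open>M\<close>, started when the output was \<open>o0\<close>.
\<close>

definition simulates where
  "simulates B em test o0 c \<sigma> \<longleftrightarrow> (case \<sigma> of (f, p, L, R, a, b, o1) \<Rightarrow>
     vat (in_pos c) f p a b \<and> sim_state f = state c \<and> length L = work_pos c \<and>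
     work c = tape (rev L @ sim_sym f # R) \<and> length L + length R \<le> B \<and>
     o1 = o0 @ concat (map em (outp c)) \<and> answer f = (\<exists>v \<in> set (outp c). test v))"

lemma awp_sim_body:
  assumes M: "wf_transducer X V M" "vword \<in> lists X" "states M \<union> work_syms M \<subseteq> {..<D}"
    and B: "\<And>t. work_pos (config_at M vword t) \<le> B" "B < N"
    and c: "c = config_at M vword t"
    and s: "simulates B em test o0 c (f, p, L, R, a, b, o1)" and run: "running f"
    and Q: "\<And>\<sigma>. simulates B em test o0 (next_config M vword c) \<sigma> \<Longrightarrow>
      running (fst \<sigma>) = (\<not> halted M vword c) \<Longrightarrow> Q \<sigma>"
  shows "awp w N K (Seq (ztest CountA) (Seq (Act (sim_act M V D \<alpha> \<beta> em test))
     (Seq work_prog (input_prog \<alpha> \<beta>)))) Q (f, p, L, R, a, b, o1)"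
proof -
  let ?c = "next_config M vword c"
  let ?f0 = "f\<lparr>nonzero := a \<noteq> 0\<rparr>"
  have s': "vat (in_pos c) f p a b" "sim_state f = state c" "length L = work_pos c"
     "work c = tape (rev L @ sim_sym f # R)" "length L + length R \<le> B"
     "o1 = o0 @ concat (map em (outp c))" "answer f = (\<exists>v \<in> set (outp c). test v)"
    using s by (auto simp: simulates_def)
  have sym: "sim_sym f = work c (work_pos c)"
    using s' tape_at[of "rev L" "sim_sym f" R] by simp
  have vp: "p = i + a" "a \<le> m" "p \<le> length w" using vat_p[OF s'(1)] by auto
  have aK: "a < 2 ^ K" using vp wK by linarith
  have v0: "vat (in_pos c) ?f0 p a b" using s'(1) by (auto simp: vat_def at_block_def)
  have vs: "vsym \<alpha> \<beta> ?f0 (in_sym_at w p) = in_sym_at vword (in_pos c)"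
    by (rule vsym_vat[OF v0]) simp
  have cd: "cdelta M V D (sim_state ?f0) (vsym \<alpha> \<beta> ?f0 (in_sym_at w p)) (sim_sym ?f0) = cur_delta M vword c"
    using cdelta_config_at[OF M c] s'(2) sym vs by simp
  have vin: "in_pos c \<le> length vword + 1" by (rule vat_h[OF s'(1)])
  obtain f1 u where act: "sim_act M V D \<alpha> \<beta> em test ?f0 (in_sym_at w p) = (f1, Stay, u)"
    and f1: "vat (in_pos c) f1 p a b" "nonzero f1 = (a \<noteq> 0)" "sim_state f1 = state ?c"
      "work ?c = tape (rev L @ sim_sym f1 # R)" "work_pos ?c = move_head (work_move f1) (length L)"
      "in_pos ?c = min (move_head (input_move f1) (in_pos c)) (length vword + 1)"
      "o1 @ u = o0 @ concat (map em (outp ?c))" "answer f1 = (\<exists>v \<in> set (outp ?c). test v)"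
      "running f1 = (\<not> halted M vword c)" "busy f1 = busy f"
  proof (cases "cur_delta M vword c")
    case None
    then have n: "?c = c" by (simp add: next_config_def)
    have h: "halted M vword c" using None by (simp add: halted_def)
    let ?f1 = "?f0\<lparr>running := False, work_move := Stay, input_move := Stay\<rparr>"
    show ?thesis
      by (rule that[of ?f1 "[]"])
        (use None cd v0 s' h vin in \<open>auto simp: sim_act_def n vat_def at_block_def\<close>)
  next
    case (Some r)
    obtain q' t' d e v where r: "r = (q', t', d, e, v)" by (cases r) auto
    have n: "?c = \<lparr>state = q', in_pos = min (move_head e (in_pos c)) (length vword + 1),
           work = (work c)(work_pos c := t'), work_pos = move_head d (work_pos c), outp = outp c @ v\<rparr>"
      using Some by (simp add: next_config_def r)
    have h: "\<not> halted M vword c" using Some by (simp add: halted_def)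
    let ?f1 = "?f0\<lparr>sim_state := q', sim_sym := t', work_move := d, input_move := e,
             answer := answer ?f0 \<or> (\<exists>x \<in> set v. test x)\<rparr>"
    have wt: "(tape (rev L @ sim_sym f # R))(work_pos c := t') = tape (rev L @ t' # R)"
      using tape_update[of "rev L" "sim_sym f" R t'] s' by simp
    have vf: "vat (in_pos c) ?f1 p a b" using v0 by (auto simp: vat_def at_block_def)
    show ?thesis
      by (rule that[of ?f1 "concat (map em v)"])
        (use Some cd vf s' h run in \<open>auto simp: sim_act_def n r wt\<close>)
  qed
  have wp': "move_head (work_move f1) (length L) \<le> B"
    using B(1)[of "Suc t"] f1(5) c by (simp add: config_at_def)
  have "awp w N K work_prog (awp w N K (input_prog \<alpha> \<beta>) Q) (f1, p, L, R, a, b, o1 @ u)"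
  proof (rule awp_work_prog[OF s'(5) wp' B(2)])
    fix f2 L' R'
    assume f2: "keeps_work f1 f2" "length L' = move_head (work_move f1) (length L)"
      "length L' + length R' \<le> B" "tape (rev L' @ sim_sym f2 # R') = tape (rev L @ sim_sym f1 # R)"
    have k: "sim_state f2 = sim_state f1" "running f2 = running f1" "answer f2 = answer f1"
      "input_move f2 = input_move f1" "nonzero f2 = nonzero f1"
      using f2(1) by (auto simp: keeps_work_def)
    have v2: "vat (in_pos c) f2 p a b" using f1(1) f2(1) by (simp add: vat_def at_block_def keeps_work_def)
    have fin: "Q (f3, p', L', R', a', b', o1 @ u)"
      if "vat (in_pos ?c) f3 p' a' b'" "keeps f2 f3" for f3 p' a' b'
    proof (rule Q)
      show "simulates B em test o0 ?c (f3, p', L', R', a', b', o1 @ u)"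
        using that f1 f2 k by (simp add: simulates_def keeps_def)
      show "running (fst (f3, p', L', R', a', b', o1 @ u)) = (\<not> halted M vword c)"
        using that f1 k by (simp add: keeps_def)
    qed
    show "awp w N K (input_prog \<alpha> \<beta>) Q (f2, p, L', R', a, b, o1 @ u)"
    proof (cases "input_move f1")
      case Stay
      have "Q (f2, p, L', R', a, b, o1 @ u)"
        by (rule fin) (use v2 f1(6) Stay vin in \<open>simp_all add: keeps_def\<close>)
      then show ?thesis unfolding input_prog_def using Stay k
        by (intro awp_Cond) (auto intro!: awp_skip)
    next
      case MoveRight
      have "awp w N K (vmove \<alpha> \<beta> True) Q (f2, p, L', R', a, b, o1 @ u)"
      proof (rule awp_vmove[OF v2])
        have "in_pos ?c = min (in_pos c + 1) (length vword + 1)" using f1(6) MoveRight by simp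
        then show "Q (f3, p', L', R', a', b', o1 @ u)"
          if "vat (if True then min (in_pos c + 1) (length vword + 1) else in_pos c - 1) f3 p' a' b'"
            "keeps f2 f3" for f3 p' a' b'
          using fin that by simp
      qed (use f1(2) k(5) in simp)
      then show ?thesis unfolding input_prog_def using MoveRight k
        by (intro awp_Cond) (auto intro!: awp_Cond)
    next
      case MoveLeft
      have "awp w N K (vmove \<alpha> \<beta> False) Q (f2, p, L', R', a, b, o1 @ u)"
      proof (rule awp_vmove[OF v2])
        have "in_pos ?c = in_pos c - 1" using f1(6) MoveLeft vin by simp
        then show "Q (f3, p', L', R', a', b', o1 @ u)"
          if "vat (if False then min (in_pos c + 1) (length vword + 1) else in_pos c - 1) f3 p' a' b'"
            "keeps f2 f3" for f3 p' a' b'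
          using fin that by simp
      qed (use f1(2) k(5) in simp)
      then show ?thesis unfolding input_prog_def using MoveLeft k
        by (intro awp_Cond) (auto intro!: awp_Cond)
    qed
  qed
  then show ?thesis using vp act f1(10)
    by (intro awp_Seq awp_ztest_A[OF KN aK] awp_Act[where g = "sim_act M V D \<alpha> \<beta> em test" and f = ?f0 and w = w and p = p, OF act]) (simp_all add: min_def)
qed

lemma awp_sim_loop:
  assumes M: "wf_transducer X V M" "vword \<in> lists X" "states M \<union> work_syms M \<subseteq> {..<D}"
    and B: "\<And>t. work_pos (config_at M vword t) \<le> B" "B < N"
    and T: "halted M vword (config_at M vword T)"
    and "t \<le> T" "simulates B em test o0 (config_at M vword t) (f, p, L, R, a, b, o1)" "running f"
    and Q: "\<And>f' p' L' R' a' b' o'.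
      simulates B em test o0 (config_at M vword T) (f', p', L', R', a', b', o') \<Longrightarrow>
      Q (f', p', L', R', a', b', o')"
  shows "awp w N K (sim_loop M V D \<alpha> \<beta> em test) Q (f, p, L, R, a, b, o1)"
  using assms(7-9)
proof (induction "T - t" arbitrary: t f p L R a b o1 rule: less_induct)
  case less
  let ?c = "config_at M vword t"
  let ?body = "Seq (ztest CountA) (Seq (Act (sim_act M V D \<alpha> \<beta> em test))
     (Seq work_prog (input_prog \<alpha> \<beta>)))"
  have "awp w N K ?body (awp w N K (sim_loop M V D \<alpha> \<beta> em test) Q) (f, p, L, R, a, b, o1)"
  proof (rule awp_sim_body[OF M B HOL.refl less.prems(2,3)])
    fix \<sigma> assume \<sigma>: "simulates B em test o0 (next_config M vword ?c) \<sigma>"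
      "running (fst \<sigma>) = (\<not> halted M vword ?c)"
    obtain f' p' L' R' a' b' o' where \<sigma>': "\<sigma> = (f', p', L', R', a', b', o')" by (cases \<sigma>) auto
    show "awp w N K (sim_loop M V D \<alpha> \<beta> em test) Q \<sigma>"
    proof (cases "halted M vword ?c")
      case True
      then have n: "next_config M vword ?c = ?c" by (simp add: next_config_def halted_def)
      have "config_at M vword (t + d) = ?c" for d
        by (induction d) (use n in \<open>auto simp: config_at_def\<close>)
      from this[of "T - t"] have "config_at M vword T = ?c" using less.prems(1) by simp
      then have "Q \<sigma>" using Q \<sigma>(1) n by (simp add: \<sigma>')
      then show ?thesis using \<sigma>(2) True unfolding sim_loop_def by (intro awp_Loop) simp
    next
      case False
      then have "t < T" using T less.prems(1) by (metis le_neq_implies_less)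
      then show ?thesis unfolding \<sigma>'
        by (intro less.hyps[of "Suc t"]) (use \<sigma> False in \<open>auto simp: \<sigma>' config_at_def\<close>)
    qed
  qed
  then show ?case using less.prems(3) unfolding sim_loop_def by (intro awp_Loop) simp
qed

text \<open>
  The simulated run of \<open>M\<close> on the virtual word. Afterwards the real head is somewhere in the
  window and the counters still tell where.
\<close>

lemma awp_sim:
  assumes M: "wf_transducer X V M" "vword \<in> lists X" "states M \<union> work_syms M \<subseteq> {..<D}"
    and B: "\<And>t. work_pos (config_at M vword t) \<le> B" "B < N"
    and v: "outputs M vword v"
    and Q: "\<And>f' a'. a' \<le> m \<Longrightarrow> answer f' = (\<exists>x \<in> set v. test x) \<Longrightarrow>
      Q (f', i + a', [], [], a', m - a', o1 @ concat (map em v))"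
  shows "awp w N K (sim M V D \<alpha> \<beta> em test) Q (f, i, [], [], 0, m, o1)"
proof -
  obtain T where T: "halted M vword (config_at M vword T)" "outp (config_at M vword T) = v"
    using v by (auto simp: outputs_def)
  let ?f = "f\<lparr>sim_state := start M, sim_sym := 0, back_pass := False, offset := 0,
            answer := False, running := True\<rparr>"
  have z: "tape [0] = (\<lambda>_. 0)" by (auto simp: tape_def fun_eq_iff)
  have "vat 0 ?f i 0 m"
    unfolding vat_def by (rule exI[of _ 0]) (simp add: at_block_def dist_def block_def pref_def)
  then have s0: "simulates B em test o1 (config_at M vword 0) (?f, i, [], [], 0, m, o1)"
    by (simp add: simulates_def config_at_def init_config_def z)
  have "awp w N K (sim_loop M V D \<alpha> \<beta> em test)
      (awp w N K (Seq (clear LeftPart) (clear RightPart)) Q) (?f, i, [], [], 0, m, o1)"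
  proof (rule awp_sim_loop[OF M B T(1) _ s0])
    fix f' p' L' R' a' b' o'
    assume s: "simulates B em test o1 (config_at M vword T) (f', p', L', R', a', b', o')"
    then have "vat (in_pos (config_at M vword T)) f' p' a' b'" by (simp add: simulates_def)
    from vat_p[OF this] have p: "p' = i + a'" "a' \<le> m" "b' = m - a'" by auto
    have "Q (f'\<lparr>again := False, again := False\<rparr>, i + a', [], [], a', m - a', o1 @ concat (map em v))"
      by (rule Q) (use p s T(2) in \<open>auto simp: simulates_def\<close>)
    then show "awp w N K (Seq (clear LeftPart) (clear RightPart)) Q (f', p', L', R', a', b', o')"
      using p s T(2) by (intro awp_Seq awp_clear_Left awp_clear_Right) (simp add: simulates_def)
  qed simp_all
  then show ?thesis unfolding sim_def by (intro awp_Seq awp_upd) simp_all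
qed

end

section \<open>The greedy factorisation program\<close>

definition rewind :: "('x, 'y) vprog" where
  "rewind = Seq (dec CountA) (Loop nonzero (Seq (inc CountB) (Seq (mv MoveLeft) (dec CountA))))"

definition advance :: "('x, 'y) vprog" where
  "advance = Seq (dec CountB) (Loop nonzero (Seq (mv MoveRight) (dec CountB)))"

definition check_end :: "('x, 'y) vprog" where
  "check_end = Act (\<lambda>f x. (f\<lparr>again := x \<noteq> RightEnd\<rparr>, Stay, []))"

text \<open>
  Makes the window as large as possible: the head runs to the end of the input and returns, and
  the way back is counted in \<open>CountB\<close>. The input head stands on position \<open>i\<close> before and after.
\<close>

definition open_window :: "('x, 'y) vprog" where
  "open_window = Seq (mv MoveRight) (Seq check_end
     (Seq (Loop again (Seq (inc CountA) (Seq (mv MoveRight) check_end))) (Seq (mv MoveLeft) rewind)))"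

text \<open>Shrinks the window from the right until the test succeeds.\<close>

definition search :: "('x, 'y) vprog \<Rightarrow> ('x, 'y) vprog" where
  "search test = Seq (Seq test rewind)
     (Loop (\<lambda>f. \<not> answer f) (Seq (dec CountB) (Seq test rewind)))"

definition factor_step :: "('x, 'y) vprog \<Rightarrow> ('x, 'y) vprog \<Rightarrow> ('x, 'y) vprog" where
  "factor_step test emit = Seq open_window (Seq (search test) (Seq emit (Seq rewind advance)))"

definition round_prog :: "('x, 'y) vprog \<Rightarrow> ('x, 'y) vprog \<Rightarrow> ('x, 'y) vprog" where
  "round_prog c d = Seq c (Seq d (Seq (mv MoveRight) (Seq check_end (mv MoveLeft))))"

text \<open>
  At least one round is performed, even on the empty input: the empty word and the nonempty
  words with value 1 have to produce the same output.
\<close>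

definition main_prog :: "('x, 'y) vprog \<Rightarrow> ('x, 'y) vprog \<Rightarrow> ('x, 'y) vprog" where
  "main_prog c d = Seq (round_prog c d) (Loop again (round_prog c d))"

lemma awp_check_end:
  assumes "Q (f\<lparr>again := in_sym_at w p \<noteq> RightEnd\<rparr>, p, L, R, a, b, o1)"
  shows "awp w N K check_end Q (f, p, L, R, a, b, o1)"
  unfolding check_end_def using assms by (intro awp_Act_Stay) simp_all

context
  fixes w :: "'x list" and N K :: nat
  assumes KN: "K \<le> N" and wK: "length w < 2 ^ K"
begin

lemma awp_rewind:
  assumes "p = i + a" "p \<le> length w + 1" "a + b < 2 ^ K"
    and Q: "\<And>f'. answer f' = answer f \<Longrightarrow> Q (f', i, L, R, 0, a + b, o1)"
  shows "awp w N K rewind Q (f, p, L, R, a, b, o1)"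
proof -
  have loop: "awp w N K (Loop nonzero (Seq (inc CountB) (Seq (mv MoveLeft) (dec CountA)))) Q
      (g, i + a, L, R, a - 1, b, o1)"
    if "nonzero g = (a \<noteq> 0)" "answer g = answer f" "i + a \<le> length w + 1" "a + b < 2 ^ K"
      "\<And>f'. answer f' = answer f \<Longrightarrow> Q (f', i, L, R, 0, a + b, o1)" for g a b
    using that
  proof (induction a arbitrary: g b)
    case 0
    then show ?case by (intro awp_Loop) simp
  next
    case (Suc a)
    have "awp w N K (Loop nonzero (Seq (inc CountB) (Seq (mv MoveLeft) (dec CountA)))) Q
      (g\<lparr>nonzero := a \<noteq> 0\<rparr>, i + a, L, R, a - 1, b + 1, o1)"
      by (rule Suc.IH) (use Suc.prems in auto)
    then show ?case using Suc.prems
      by (intro awp_Loop) (auto simp: min_def intro!: awp_Seq awp_inc_B[OF KN] awp_mv awp_dec_A[OF KN])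
  qed
  have "awp w N K (Loop nonzero (Seq (inc CountB) (Seq (mv MoveLeft) (dec CountA)))) Q
      (f\<lparr>nonzero := a \<noteq> 0\<rparr>, i + a, L, R, a - 1, b, o1)"
    by (rule loop) (use assms in auto)
  then show ?thesis unfolding rewind_def using assms(1) by (intro awp_Seq awp_dec_A[OF KN]) simp
qed

lemma awp_advance:
  assumes "p + b \<le> length w"
    and Q: "\<And>f'. Q (f', p + b, L, R, a, 0, o1)"
  shows "awp w N K advance Q (f, p, L, R, a, b, o1)"
proof -
  have loop: "awp w N K (Loop nonzero (Seq (mv MoveRight) (dec CountB))) Q (g, p, L, R, a, b - 1, o1)"
    if "nonzero g = (b \<noteq> 0)" "p + b \<le> length w" "\<And>f'. Q (f', p + b, L, R, a, 0, o1)" for g p b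
    using that
  proof (induction b arbitrary: g p)
    case 0
    then show ?case by (intro awp_Loop) simp
  next
    case (Suc b)
    have "awp w N K (Loop nonzero (Seq (mv MoveRight) (dec CountB))) Q
      (g\<lparr>nonzero := b \<noteq> 0\<rparr>, p + 1, L, R, a, b - 1, o1)"
      by (rule Suc.IH) (use Suc.prems in auto)
    then show ?case using Suc.prems
      by (intro awp_Loop) (auto simp: min_def intro!: awp_Seq awp_mv awp_dec_B[OF KN])
  qed
  have "awp w N K (Loop nonzero (Seq (mv MoveRight) (dec CountB))) Q
      (f\<lparr>nonzero := b \<noteq> 0\<rparr>, p, L, R, a, b - 1, o1)"
    by (rule loop) (use assms in auto)
  then show ?thesis unfolding advance_def by (intro awp_Seq awp_dec_B[OF KN])
qed

lemma in_sym_at_RightEnd: "0 < p \<Longrightarrow> (in_sym_at w p = RightEnd) = (length w < p)"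
  by (auto simp: in_sym_at_def)

lemma awp_open_window:
  assumes "i \<le> length w"
    and Q: "\<And>f'. Q (f', i, L, R, 0, length w - i, o1)"
  shows "awp w N K open_window Q (f, i, L, R, 0, 0, o1)"
proof -
  let ?n = "length w - i"
  let ?loop = "Loop again (Seq (inc CountA) (Seq (mv MoveRight) check_end)) :: ('x, 'b) vprog"
  let ?Q = "awp w N K (Seq (mv MoveLeft) rewind) Q"
  have fin: "?Q (g, length w + 1, L, R, ?n, 0, o1)" for g
    using assms wK by (intro awp_Seq awp_mv awp_rewind[where i = i]) auto
  have loop: "awp w N K ?loop ?Q (g, i + 1 + a, L, R, a, 0, o1)"
    if "again g = (in_sym_at w (i + 1 + a) \<noteq> RightEnd)" "a \<le> ?n" for g a
    using that
  proof (induction "?n - a" arbitrary: g a)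
    case 0
    then have "a = ?n" by simp
    then have "i + 1 + a = length w + 1" using assms(1) by simp
    then show ?case using 0 fin[of g] \<open>a = ?n\<close> by (intro awp_Loop) (simp add: in_sym_at_RightEnd)
  next
    case (Suc d)
    let ?g = "g\<lparr>again := in_sym_at w (i + 1 + (a + 1)) \<noteq> RightEnd\<rparr>"
    have an: "a < ?n" using Suc.hyps(2) by linarith
    have "awp w N K ?loop ?Q (?g, i + 1 + (a + 1), L, R, a + 1, 0, o1)"
      by (rule Suc.hyps(1)) (use Suc.hyps(2) an in auto)
    moreover have "again g" using Suc.prems an by (simp add: in_sym_at_RightEnd)
    moreover have "a + 1 < 2 ^ K" using an wK by linarith
    moreover have "min (i + 1 + a + 1) (length w + 1) = i + 1 + (a + 1)" using an by simp
    ultimately show ?case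
      by (intro awp_Loop) (auto intro!: awp_Seq[of _ _ _ "inc CountA"] awp_Seq[of _ _ _ "mv MoveRight"]
        awp_inc_A[OF KN] awp_mv awp_check_end)
  qed
  have "awp w N K ?loop ?Q (f\<lparr>again := in_sym_at w (i + 1) \<noteq> RightEnd\<rparr>, i + 1, L, R, 0, 0, o1)"
    using loop[of "f\<lparr>again := in_sym_at w (i + 1) \<noteq> RightEnd\<rparr>" 0] by simp
  then have "awp w N K check_end (awp w N K (Seq ?loop (Seq (mv MoveLeft) rewind)) Q) (f, i + 1, L, R, 0, 0, o1)"
    by (intro awp_check_end awp_Seq[of _ _ _ ?loop])
  then show ?thesis unfolding open_window_def using assms(1)
    by (intro awp_Seq[of _ _ _ "mv MoveRight"] awp_Seq[of _ _ _ check_end] awp_mv) (simp add: min_def)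
qed

text \<open>
  The test \<open>T i\<close> of the empty window succeeds, so the search ends, and it ends at the largest
  \<open>j\<close> for which \<open>T j\<close> holds.
\<close>

lemma awp_search:
  assumes "i \<le> length w" "T i"
    and test: "\<And>j f Q. i \<le> j \<Longrightarrow> j \<le> length w \<Longrightarrow>
      (\<And>f' a'. a' \<le> j - i \<Longrightarrow> answer f' = T j \<Longrightarrow> Q (f', i + a', [], [], a', (j - i) - a', o1)) \<Longrightarrow>
      awp w N K test Q (f, i, [], [], 0, j - i, o1)"
    and Q: "\<And>f' j. i \<le> j \<Longrightarrow> j \<le> length w \<Longrightarrow> T j \<Longrightarrow> (\<And>k. j < k \<Longrightarrow> k \<le> length w \<Longrightarrow> \<not> T k) \<Longrightarrow>
      Q (f', i, [], [], 0, j - i, o1)"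
  shows "awp w N K (search test) Q (f, i, [], [], 0, length w - i, o1)"
proof -
  have tr: "awp w N K (Seq test rewind) P (g, i, [], [], 0, j - i, o1)"
    if "i \<le> j" "j \<le> length w" "\<And>f'. answer f' = T j \<Longrightarrow> P (f', i, [], [], 0, j - i, o1)" for g j P
  proof (rule awp_Seq, rule test[OF that(1,2)])
    fix f' :: vars and a' assume a': "a' \<le> j - i" "answer f' = T j"
    have "j - i < 2 ^ K" using that wK by linarith
    then show "awp w N K rewind P (f', i + a', [], [], a', (j - i) - a', o1)"
      by (intro awp_rewind[where i = i]) (use a' that in auto)
  qed
  let ?loop = "Loop (\<lambda>f. \<not> answer f) (Seq (dec CountB) (Seq test rewind))"
  have loop: "awp w N K ?loop Q (g, i, [], [], 0, j - i, o1)"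
    if "i \<le> j" "j \<le> length w" "answer g = T j" "\<And>k. j < k \<Longrightarrow> k \<le> length w \<Longrightarrow> \<not> T k" for g j
    using that
  proof (induction "j - i" arbitrary: g j)
    case 0
    then have "j = i" by simp
    then show ?case using 0 Q[of j g] assms(2) by (intro awp_Loop) simp
  next
    case (Suc d)
    show ?case
    proof (cases "T j")
      case True
      then show ?thesis using Suc.prems Q[of j g] by (intro awp_Loop) simp
    next
      case False
      have j: "i \<le> j - 1" "j - 1 \<le> length w" "d = (j - 1) - i" using Suc by auto
      have up: "\<not> T k" if "j - 1 < k" "k \<le> length w" for k
        using Suc.prems(4)[of k] False that by (cases "k = j") auto
      have "awp w N K (Seq test rewind) (awp w N K ?loop Q) (g\<lparr>nonzero := j - i \<noteq> 0\<rparr>, i, [], [], 0, (j - 1) - i, o1)"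
        by (rule tr[OF j(1,2)]) (use Suc.hyps(1)[OF j(3,1,2) _ up] in auto)
      moreover have "(j - 1) - i = j - i - 1" by simp
      ultimately show ?thesis using False Suc.prems(3)
        by (intro awp_Loop) (auto intro!: awp_Seq[of _ _ _ "dec CountB"] awp_dec_B[OF KN])
    qed
  qed
  have "awp w N K (Seq test rewind) (awp w N K ?loop Q) (f, i, [], [], 0, length w - i, o1)"
    by (rule tr) (use assms(1) loop[of "length w"] in auto)
  then show ?thesis unfolding search_def by (rule awp_Seq)
qed

lemma awp_factor_step:
  assumes "i \<le> length w" "T i"
    and test: "\<And>j f Q. i \<le> j \<Longrightarrow> j \<le> length w \<Longrightarrow>
      (\<And>f' a'. a' \<le> j - i \<Longrightarrow> answer f' = T j \<Longrightarrow> Q (f', i + a', [], [], a', (j - i) - a', o1)) \<Longrightarrow>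
      awp w N K test Q (f, i, [], [], 0, j - i, o1)"
    and emit: "\<And>j f Q. i \<le> j \<Longrightarrow> j \<le> length w \<Longrightarrow> T j \<Longrightarrow>
      (\<And>f' a'. a' \<le> j - i \<Longrightarrow> Q (f', i + a', [], [], a', (j - i) - a', o1 @ g j)) \<Longrightarrow>
      awp w N K emit Q (f, i, [], [], 0, j - i, o1)"
    and Q: "\<And>f' j. i \<le> j \<Longrightarrow> j \<le> length w \<Longrightarrow> T j \<Longrightarrow> (\<And>k. j < k \<Longrightarrow> k \<le> length w \<Longrightarrow> \<not> T k) \<Longrightarrow>
      Q (f', j, [], [], 0, 0, o1 @ g j)"
  shows "awp w N K (factor_step test emit) Q (f, i, [], [], 0, 0, o1)"
proof -
  have found: "awp w N K (Seq emit (Seq rewind advance)) Q (f', i, [], [], 0, j - i, o1)"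
    if j: "i \<le> j" "j \<le> length w" "T j" and max: "\<And>k. j < k \<Longrightarrow> k \<le> length w \<Longrightarrow> \<not> T k"
    for f' j
  proof -
    have "awp w N K emit (awp w N K (Seq rewind advance) Q) (f', i, [], [], 0, j - i, o1)"
    proof (rule emit[OF j])
      fix g' :: vars and a' assume a': "a' \<le> j - i"
      have "j - i < 2 ^ K" using j wK by linarith
      moreover have "awp w N K advance Q (f'', i, [], [], 0, j - i, o1 @ g j)" for f''
        by (rule awp_advance) (use j Q[OF j max] in auto)
      ultimately have "awp w N K rewind (awp w N K advance Q) (g', i + a', [], [], a', (j - i) - a', o1 @ g j)"
        by (intro awp_rewind[where i = i]) (use a' j in auto)
      then show "awp w N K (Seq rewind advance) Q (g', i + a', [], [], a', (j - i) - a', o1 @ g j)"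
        by (rule awp_Seq)
    qed
    then show ?thesis by (rule awp_Seq)
  qed
  have "awp w N K (search test) (awp w N K (Seq emit (Seq rewind advance)) Q)
      (f', i, [], [], 0, length w - i, o1)" for f'
    by (rule awp_search[where T = T, OF assms(1,2) test]) (use found in blast)+
  then show ?thesis unfolding factor_step_def
    by (intro awp_Seq[of _ _ _ open_window] awp_Seq[of _ _ _ "search test"] awp_open_window[OF assms(1)])
qed

text \<open>
  The rounds are governed by a list \<open>r i\<close> attached to each position \<open>i\<close>, below the reduced word
  of the suffix after \<open>i\<close>. A round turns it into \<open>td (tc (r i))\<close>, which is shorter unless it is
  empty. The end of the input can be used as the condition to stop since it is reached exactly
  when the list is empty after a round.
\<close>

lemma awp_main:
  assumes stepc: "\<And>i f Q o1. i \<le> length w \<Longrightarrow>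
      (\<And>f' j. j \<le> length w \<Longrightarrow> r j = tc (r i) \<Longrightarrow> Q (f', j, [], [], 0, 0, o1 @ oc (r i))) \<Longrightarrow>
      awp w N K c Q (f, i, [], [], 0, 0, o1)"
    and stepd: "\<And>i f Q o1. i \<le> length w \<Longrightarrow>
      (\<And>f' j. j \<le> length w \<Longrightarrow> r j = td (r i) \<Longrightarrow> (r j = [] \<Longrightarrow> j = length w) \<Longrightarrow>
         Q (f', j, [], [], 0, 0, o1 @ od (r i))) \<Longrightarrow>
      awp w N K d Q (f, i, [], [], 0, 0, o1)"
    and r: "r (length w) = []"
    and rec: "\<And>x. out x = oc x @ od (tc x) @ (if td (tc x) = [] then [] else out (td (tc x)))"
    and meas: "\<And>x. td (tc x) \<noteq> [] \<Longrightarrow> length (td (tc x)) < length x"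
    and Q: "\<And>f'. Q (f', length w, [], [], 0, 0, o1 @ out (r i))"
    and i: "i \<le> length w"
  shows "awp w N K (main_prog c d) Q (f, i, [], [], 0, 0, o1)"
proof -
  have round: "awp w N K (round_prog c d) P (f, i, [], [], 0, 0, o1)"
    if start: "i \<le> length w" and
      post: "\<And>f' j. j \<le> length w \<Longrightarrow> r j = td (tc (r i)) \<Longrightarrow> again f' = (r j \<noteq> []) \<Longrightarrow> (r j = [] \<Longrightarrow> j = length w) \<Longrightarrow>
        P (f', j, [], [], 0, 0, o1 @ oc (r i) @ od (tc (r i)))"
    for f i o1 P
  proof -
    let ?end = "Seq (mv MoveRight) (Seq check_end (mv MoveLeft))"
    have finish: "awp w N K ?end P (f2, k, [], [], 0, 0, o1 @ oc (r i) @ od (tc (r i)))"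
      if k: "k \<le> length w" "r k = td (tc (r i))" "r k = [] \<Longrightarrow> k = length w" for f2 :: vars and k
    proof -
      let ?f = "f2\<lparr>again := in_sym_at w (k + 1) \<noteq> RightEnd\<rparr>"
      let ?o = "o1 @ oc (r i) @ od (tc (r i))"
      have "again ?f = (r k \<noteq> [])"
      proof (cases "k = length w")
        case True
        then show ?thesis using r by (simp add: in_sym_at_RightEnd)
      next
        case False
        then have "r k \<noteq> []" using k(3) by blast
        then show ?thesis using False k(1) by (simp add: in_sym_at_RightEnd)
      qed
      then have P: "P (?f, k, [], [], 0, 0, ?o)" using k by (intro post)
      have "awp w N K (mv MoveLeft) P (?f, k + 1, [], [], 0, 0, ?o)"
        by (rule awp_mv) (use k(1) P in \<open>simp add: min_def\<close>)
      then have "awp w N K check_end (awp w N K (mv MoveLeft) P) (f2, k + 1, [], [], 0, 0, ?o)"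
        by (rule awp_check_end)
      then have "awp w N K (Seq check_end (mv MoveLeft)) P (f2, k + 1, [], [], 0, 0, ?o)"
        by (rule awp_Seq)
      then have "awp w N K (mv MoveRight) (awp w N K (Seq check_end (mv MoveLeft)) P) (f2, k, [], [], 0, 0, ?o)"
        using k(1) awp_mv[of "awp w N K (Seq check_end (mv MoveLeft)) P" f2 MoveRight k w] by simp
      then show ?thesis by (rule awp_Seq)
    qed
    have "awp w N K d (awp w N K ?end P) (f1, j, [], [], 0, 0, o1 @ oc (r i))"
      if j: "j \<le> length w" "r j = tc (r i)" for f1 :: vars and j
      by (rule stepd[OF j(1)]) (use finish j in simp)
    then have "awp w N K c (awp w N K (Seq d ?end) P) (f, i, [], [], 0, 0, o1)"
      by (intro stepc[OF start] awp_Seq[of _ _ _ d])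
    then show ?thesis unfolding round_prog_def by (rule awp_Seq)
  qed
  have loop: "awp w N K (Loop again (round_prog c d)) Q (f', j, [], [], 0, 0, o')"
    if "j \<le> length w" "again f' = (r j \<noteq> [])" "r j = [] \<Longrightarrow> j = length w"
      "\<And>f'. Q (f', length w, [], [], 0, 0, o' @ (if r j = [] then [] else out (r j)))" for f' j o'
    using that
  proof (induction "length (r j)" arbitrary: f' j o' rule: less_induct)
    case less
    show ?case
    proof (cases "r j = []")
      case True
      then show ?thesis using less.prems(2,3) less.prems(4)[of f'] by (intro awp_Loop) simp
    next
      case False
      have "awp w N K (round_prog c d) (awp w N K (Loop again (round_prog c d)) Q) (f', j, [], [], 0, 0, o')"
      proof (rule round[OF less.prems(1)])
        fix f'' :: vars and k
        assume k: "k \<le> length w" "r k = td (tc (r j))" "again f'' = (r k \<noteq> [])" "r k = [] \<Longrightarrow> k = length w"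
        show "awp w N K (Loop again (round_prog c d)) Q (f'', k, [], [], 0, 0, o' @ oc (r j) @ od (tc (r j)))"
        proof (cases "r k = []")
          case True
          then show ?thesis using k less.prems(4)[of f''] False rec[of "r j"] by (intro awp_Loop) simp
        next
          case rk: False
          show ?thesis
            by (rule less.hyps[OF _ k(1,3,4)])
              (use k(2) rk meas[of "r j"] less.prems(4) False rec[of "r j"] in auto)
        qed
      qed
      then show ?thesis using less.prems(2) False by (intro awp_Loop) simp
    qed
  qed
  show ?thesis unfolding main_prog_def
  proof (intro awp_Seq round[OF i])
    fix f' :: vars and j
    assume j: "j \<le> length w" "r j = td (tc (r i))" "again f' = (r j \<noteq> [])" "r j = [] \<Longrightarrow> j = length w"
    show "awp w N K (Loop again (round_prog c d)) Q (f', j, [], [], 0, 0, o1 @ oc (r i) @ od (tc (r i)))"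
      by (rule loop[OF j(1,3,4)]) (use Q rec[of "r i"] j(2) in auto)
  qed
qed

end

declare split_paired_All [simp] split_paired_Ex [simp]

section \<open>Reduced words in a free product\<close>

definition same_side :: "'a + 'b \<Rightarrow> 'a + 'b \<Rightarrow> bool" where
  "same_side x y \<longleftrightarrow> isl x = isl y"

locale two_groups =
  fixes G :: "('a, 'c) monoid_scheme" (structure) and H :: "('b, 'd) monoid_scheme"
  assumes G: "group G" and H: "group H"
begin

interpretation G: group G by (rule G)
interpretation H: group H by (rule H)

abbreviation letters :: "('a + 'b) set" where "letters \<equiv> carrier G <+> carrier H"

definition trivial :: "'a + 'b \<Rightarrow> bool" where
  "trivial x \<longleftrightarrow> (case x of Inl g \<Rightarrow> g = \<one>\<^bsub>G\<^esub> | Inr h \<Rightarrow> h = \<one>\<^bsub>H\<^esub>)"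

fun lmult :: "'a + 'b \<Rightarrow> 'a + 'b \<Rightarrow> 'a + 'b" where
  "lmult (Inl g) (Inl g') = Inl (g \<otimes>\<^bsub>G\<^esub> g')"
| "lmult (Inr h) (Inr h') = Inr (h \<otimes>\<^bsub>H\<^esub> h')"
| "lmult x y = x"

definition put :: "'a + 'b \<Rightarrow> ('a + 'b) list \<Rightarrow> ('a + 'b) list" where
  "put x r = (if trivial x then r else x # r)"

text \<open>
  Left multiplication by a letter, as an action on reduced words (van der Waerden).
\<close>

fun act :: "'a + 'b \<Rightarrow> ('a + 'b) list \<Rightarrow> ('a + 'b) list" where
  "act x [] = put x []"
| "act x (y # r) = (if same_side x y then put (lmult x y) r else put x (y # r))"

fun reduced :: "('a + 'b) list \<Rightarrow> bool" where
  "reduced [] = True"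
| "reduced (x # r) \<longleftrightarrow> x \<in> letters \<and> \<not> trivial x \<and> reduced r \<and> (r \<noteq> [] \<longrightarrow> \<not> same_side x (hd r))"

definition nf :: "('a + 'b) list \<Rightarrow> ('a + 'b) list" where
  "nf u = foldr act u []"

lemma lmult_props:
  assumes "x \<in> letters" "y \<in> letters" "same_side x y"
  shows "lmult x y \<in> letters" "same_side (lmult x y) x" "same_side z (lmult x y) = same_side z x"
  using assms by (cases x; cases y; auto simp: same_side_def)+

lemma same_side_sym: "same_side x y = same_side y x"
  by (auto simp: same_side_def)

lemma same_side_trans: "same_side x y \<Longrightarrow> same_side y z = same_side x z"
  by (auto simp: same_side_def)

lemma reduced_put:
  assumes "reduced r" "x \<in> letters" "r \<noteq> [] \<Longrightarrow> \<not> same_side x (hd r)"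
  shows "reduced (put x r)"
  using assms by (auto simp: put_def)

lemma reduced_act:
  assumes "reduced r" "x \<in> letters"
  shows "reduced (act x r)"
proof (cases r)
  case Nil
  then show ?thesis using assms by (auto intro: reduced_put)
next
  case (Cons y r')
  show ?thesis
  proof (cases "same_side x y")
    case True
    then show ?thesis using assms Cons lmult_props[OF assms(2) _ True] same_side_sym same_side_trans
      by (auto intro!: reduced_put simp: same_side_def)
  next
    case False
    then show ?thesis using assms Cons by (auto intro!: reduced_put)
  qed
qed

lemma trivial_lmult_left: "trivial x \<Longrightarrow> x \<in> letters \<Longrightarrow> y \<in> letters \<Longrightarrow> same_side x y \<Longrightarrow> lmult x y = y"
  by (cases x; cases y) (auto simp: trivial_def same_side_def)

lemma trivial_lmult_right: "trivial y \<Longrightarrow> x \<in> letters \<Longrightarrow> y \<in> letters \<Longrightarrow> same_side x y \<Longrightarrow> lmult x y = x"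
  by (cases x; cases y) (auto simp: trivial_def same_side_def)

lemma lmult_assoc:
  assumes "x \<in> letters" "y \<in> letters" "z \<in> letters" "same_side x y" "same_side y z"
  shows "lmult (lmult x y) z = lmult x (lmult y z)"
  using assms by (cases x; cases y; cases z) (auto simp: same_side_def G.m_assoc H.m_assoc)

lemma act_trivial: "trivial x \<Longrightarrow> x \<in> letters \<Longrightarrow> reduced r \<Longrightarrow> act x r = r"
  by (cases r) (auto simp: put_def trivial_lmult_left)

lemma act_put:
  assumes "x \<in> letters" "y \<in> letters" "same_side x y" "r \<noteq> [] \<Longrightarrow> \<not> same_side x (hd r)"
  shows "act x (put y r) = put (lmult x y) r"
proof (cases "trivial y")
  case True
  then have "lmult x y = x" using assms trivial_lmult_right by blast
  then show ?thesis using True assms(4) by (cases r) (auto simp: put_def)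
next
  case False
  then show ?thesis using assms by (simp add: put_def)
qed

lemma act_lmult:
  assumes "x \<in> letters" "y \<in> letters" "same_side x y" "reduced r"
  shows "act x (act y r) = act (lmult x y) r"
proof (cases r)
  case Nil
  then show ?thesis using assms act_put[of x y "[]"] by simp
next
  case (Cons z r')
  have z: "z \<in> letters" "r' \<noteq> [] \<Longrightarrow> \<not> same_side z (hd r')" using assms(4) Cons by auto
  show ?thesis
  proof (cases "same_side y z")
    case True
    have "act x (put (lmult y z) r') = put (lmult x (lmult y z)) r'"
      using z True assms(3) lmult_props[OF assms(2) z(1) True]
      by (intro act_put) (use assms in \<open>auto simp: same_side_def\<close>)
    moreover have "same_side (lmult x y) z"
      using lmult_props(2)[OF assms(1,2,3)] assms(3) True by (simp add: same_side_def)
    ultimately show ?thesis using True Cons lmult_assoc[OF assms(1,2) z(1) assms(3) True] by simp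
  next
    case False
    have "act x (put y r) = put (lmult x y) r"
      using False Cons assms by (intro act_put) (auto simp: same_side_def)
    moreover have "\<not> same_side (lmult x y) z"
      using lmult_props(2)[OF assms(1,2,3)] assms(3) False by (simp add: same_side_def)
    ultimately show ?thesis using False Cons by simp
  qed
qed

lemma reduced_foldr: "u \<in> lists letters \<Longrightarrow> reduced r \<Longrightarrow> reduced (foldr act u r)"
  by (induction u) (auto intro: reduced_act)

lemma reduced_nf: "u \<in> lists letters \<Longrightarrow> reduced (nf u)"
  unfolding nf_def by (rule reduced_foldr) auto

lemma foldr_act_fp_eq: "fp_eq G H u v \<Longrightarrow> reduced r \<Longrightarrow> foldr act u r = foldr act v r"
proof (induction arbitrary: r rule: fp_eq.induct)
  case (one_l u v)
  then show ?case using act_trivial[of "Inl \<one>\<^bsub>G\<^esub>"] reduced_foldr[of v r]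
    by (simp add: trivial_def InlI)
next
  case (one_r u v)
  then show ?case using act_trivial[of "Inr \<one>\<^bsub>H\<^esub>"] reduced_foldr[of v r]
    by (simp add: trivial_def InrI)
next
  case (mult_l u v x y)
  then show ?case using act_lmult[of "Inl x" "Inl y" "foldr act v r"] reduced_foldr[of v r]
    by (simp add: same_side_def InlI)
next
  case (mult_r u v x y)
  then show ?case using act_lmult[of "Inr x" "Inr y" "foldr act v r"] reduced_foldr[of v r]
    by (simp add: same_side_def InrI)
qed auto

text \<open>
  Reduced words are unique: the action respects the defining relations of the free product, so
  the image of the empty word under a word depends on the element only.
\<close>

lemma nf_fp_eq: "fp_eq G H u v \<Longrightarrow> nf u = nf v"
  unfolding nf_def by (rule foldr_act_fp_eq) auto

lemma nf_append_letter: "nf (x # u) = act x (nf u)"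
  by (simp add: nf_def)

lemmas fp_refl = fp_eq.refl[of _ G H]
lemmas fp_trans = fp_eq.trans[of G H]
lemmas fp_app = fp_eq_append[OF G H]

lemma fp_trivial: "trivial x \<Longrightarrow> x \<in> letters \<Longrightarrow> u \<in> lists letters \<Longrightarrow> fp_eq G H (x # u) u"
  using fp_eq.one_l[of "[]" G H u] fp_eq.one_r[of "[]" G H u]
  by (cases x) (auto simp: trivial_def)

lemma fp_lmult: "x \<in> letters \<Longrightarrow> y \<in> letters \<Longrightarrow> same_side x y \<Longrightarrow> fp_eq G H [x, y] [lmult x y]"
  using fp_eq.mult_l[of "[]" G H "[]"] fp_eq.mult_r[of "[]" G H "[]"]
  by (cases x; cases y) (auto simp: same_side_def)

lemma fp_put: "x \<in> letters \<Longrightarrow> r \<in> lists letters \<Longrightarrow> fp_eq G H (x # r) (put x r)"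
  using fp_trivial[of x r] fp_refl[of "x # r"] by (auto simp: put_def)

lemma fp_act:
  assumes "x \<in> letters" "r \<in> lists letters"
  shows "fp_eq G H (x # r) (act x r)"
proof (cases r)
  case Nil
  then show ?thesis using assms fp_put[of x "[]"] by simp
next
  case (Cons y r')
  then have y: "y \<in> letters" "r' \<in> lists letters" using assms by auto
  show ?thesis
  proof (cases "same_side x y")
    case True
    have "fp_eq G H ([x, y] @ r') ([lmult x y] @ r')"
      by (rule fp_app[OF fp_lmult[OF assms(1) y(1) True] fp_refl[OF y(2)]])
    then show ?thesis using fp_trans[OF _ fp_put[OF lmult_props(1)[OF assms(1) y(1) True] y(2)]] Cons True
      by simp
  next
    case False
    then show ?thesis using fp_put[OF assms] Cons by simp
  qed
qed

lemma reduced_lists: "reduced r \<Longrightarrow> r \<in> lists letters"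
  by (induction r) auto

lemma fp_nf: "u \<in> lists letters \<Longrightarrow> fp_eq G H u (nf u)"
proof (induction u)
  case Nil
  then show ?case by (simp add: nf_def fp_refl)
next
  case (Cons x u)
  then have x: "x \<in> letters" "u \<in> lists letters" by auto
  have "fp_eq G H ([x] @ u) ([x] @ nf u)"
    by (rule fp_app[OF fp_refl Cons.IH[OF x(2)]]) (use x in auto)
  then show ?case using fp_trans[OF _ fp_act[OF x(1) reduced_lists[OF reduced_nf[OF x(2)]]]]
    by (simp add: nf_append_letter)
qed

text \<open>
  By induction on the word. A new letter \<open>x\<close> in front either becomes the first syllable itself
  or is multiplied with the first syllable \<open>t\<close> of the rest, which is the value of a prefix by
  induction. If \<open>x\<close> cancels \<open>t\<close>, then the word remaining after that prefix begins with the
  syllable \<open>s\<close>, and the induction hypothesis applies a second time.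
\<close>

lemma prefix_of_first_syllable:
  assumes "u \<in> lists letters" "nf u = s # r"
  shows "\<exists>k. 1 \<le> k \<and> k \<le> length u \<and> fp_eq G H (take k u) [s] \<and> nf (drop k u) = r"
  using assms
proof (induction "length u" arbitrary: u s r rule: less_induct)
  case less
  obtain x v where u: "u = x # v" using less.prems(2) by (cases u) (auto simp: nf_def)
  have x: "x \<in> letters" "v \<in> lists letters" using less.prems(1) u by auto
  have s: "s \<in> letters" using reduced_nf[OF less.prems(1)] less.prems(2) by simp
  have red: "reduced (nf v)" by (rule reduced_nf[OF x(2)])
  have act: "act x (nf v) = s # r" using less.prems(2) by (simp add: u nf_append_letter)
  have tk: "take k v \<in> lists letters" "drop k v \<in> lists letters" for k
    using x(2) by (auto dest: in_set_takeD in_set_dropD)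
  show ?case
  proof (cases "trivial x")
    case True
    then have "nf v = s # r" using act act_trivial[OF True x(1) red] by simp
    then obtain k where k: "1 \<le> k" "k \<le> length v" "fp_eq G H (take k v) [s]" "nf (drop k v) = r"
      using less.hyps[of v] x(2) u by auto
    have "fp_eq G H (x # take k v) [s]" by (rule fp_trans[OF fp_trivial[OF True x(1) tk(1)] k(3)])
    then show ?thesis using k u by (intro exI[of _ "Suc k"]) simp
  next
    case nt: False
    show ?thesis
    proof (cases "nf v \<noteq> [] \<and> same_side x (hd (nf v))")
      case False
      then have "s = x" "r = nf v" using act nt by (cases "nf v"; simp add: put_def)+
      then show ?thesis using u x fp_refl[of "[x]"] by (intro exI[of _ 1]) simp
    next
      case True
      then obtain t r' where nv: "nf v = t # r'" and ss: "same_side x t" by (cases "nf v") auto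
      have t: "t \<in> letters" using red nv by simp
      have put: "put (lmult x t) r' = s # r" using act nv ss by simp
      obtain k where k: "1 \<le> k" "k \<le> length v" "fp_eq G H (take k v) [t]" "nf (drop k v) = r'"
        using less.hyps[of v, OF _ x(2) nv] u by auto
      have xt: "fp_eq G H (x # take k v) [lmult x t]"
        using fp_trans[OF fp_app[OF fp_refl[of "[x]"] k(3)]] fp_lmult[OF x(1) t ss] x(1) by simp
      show ?thesis
      proof (cases "trivial (lmult x t)")
        case False
        then have "s = lmult x t" "r = r'" using put by (simp_all add: put_def)
        then show ?thesis using k u xt by (intro exI[of _ "Suc k"]) simp
      next
        case triv: True
        then have "r' = s # r" using put by (simp add: put_def)
        then have nd: "nf (drop k v) = s # r" using k(4) by simp
        have "length (drop k v) < length u" using u by simp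
        from less.hyps[OF this tk(2) nd] obtain k' where k':
          "1 \<le> k'" "k' \<le> length (drop k v)" "fp_eq G H (take k' (drop k v)) [s]"
          "nf (drop k' (drop k v)) = r"
          by auto
        have "fp_eq G H ((x # take k v) @ take k' (drop k v)) ([lmult x t] @ [s])"
          by (rule fp_app[OF xt k'(3)])
        moreover have "fp_eq G H ([lmult x t] @ [s]) [s]"
          using fp_trivial[OF triv lmult_props(1)[OF x(1) t ss]] s by simp
        ultimately have "fp_eq G H (x # take (k + k') v) [s]"
          using fp_trans by (simp add: take_add)
        then show ?thesis using k k' u
          by (intro exI[of _ "Suc (k + k')"]) (simp add: add.commute)
      qed
    qed
  qed
qed

text \<open>
  A factor is indicated by its trivial letter \<open>e\<close>, which also stands in for the first syllable
  if the reduced word begins with a letter of the other factor.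
\<close>

definition head_on :: "'a + 'b \<Rightarrow> ('a + 'b) list \<Rightarrow> 'a + 'b" where
  "head_on e r = (case r of [] \<Rightarrow> e | x # _ \<Rightarrow> if same_side e x then x else e)"

definition tail_on :: "'a + 'b \<Rightarrow> ('a + 'b) list \<Rightarrow> ('a + 'b) list" where
  "tail_on e r = (case r of [] \<Rightarrow> [] | x # r' \<Rightarrow> if same_side e x then r' else r)"

text \<open>
  If the rest after the longest prefix began with a syllable of the same factor, then a prefix
  of the rest would have this syllable as its value, and the prefix could be extended. So
  nothing is merged when \<open>x\<close> is put in front of the rest.
\<close>

lemma longest_prefix_is_syllable:
  assumes u: "u \<in> lists letters" and j: "j \<le> length u"
    and e: "e \<in> letters" "trivial e"
    and x: "x \<in> letters" "same_side e x" "fp_eq G H (take j u) [x]"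
    and max: "\<And>k y. j < k \<Longrightarrow> k \<le> length u \<Longrightarrow> y \<in> letters \<Longrightarrow> same_side e y \<Longrightarrow>
      \<not> fp_eq G H (take k u) [y]"
  shows "x = head_on e (nf u)" "nf (drop j u) = tail_on e (nf u)"
proof -
  let ?r = "nf (drop j u)"
  have lt: "take j u \<in> lists letters" "drop j u \<in> lists letters"
    using u by (auto dest: in_set_takeD in_set_dropD)
  have red: "reduced ?r" by (rule reduced_nf[OF lt(2)])
  have other: "\<not> same_side e (hd ?r)" if ne: "?r \<noteq> []"
  proof
    assume ss: "same_side e (hd ?r)"
    obtain y r where y: "?r = y # r" using ne by (cases ?r) auto
    have yl: "y \<in> letters" using red y by simp
    obtain k where k: "1 \<le> k" "k \<le> length (drop j u)" "fp_eq G H (take k (drop j u)) [y]"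
      using prefix_of_first_syllable[OF lt(2) y] by blast
    have sxy: "same_side x y" using ss x(2) y by (auto simp: same_side_def)
    have "fp_eq G H (take j u @ take k (drop j u)) ([x] @ [y])" by (rule fp_app[OF x(3) k(3)])
    then have val: "fp_eq G H (take (j + k) u) [lmult x y]"
      using fp_trans fp_lmult[OF x(1) yl sxy] by (simp add: take_add)
    have xy: "same_side e (lmult x y)" "lmult x y \<in> letters"
      using lmult_props[OF x(1) yl sxy] x(2) by (auto simp: same_side_def)
    have jk: "j < j + k" "j + k \<le> length u" using k(1,2) j by auto
    show False using max[OF jk xy(2,1)] val by (rule notE)
  qed
  have "fp_eq G H (take j u @ drop j u) ([x] @ drop j u)" by (rule fp_app[OF x(3) fp_refl[OF lt(2)]])
  then have n: "nf u = act x ?r" using nf_fp_eq nf_append_letter by force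
  also have "act x ?r = put x ?r"
    using other x(2) by (cases ?r) (auto simp: same_side_def)
  finally have nu: "nf u = put x ?r" .
  have "x = head_on e (nf u) \<and> ?r = tail_on e (nf u)"
  proof (cases "trivial x")
    case True
    then have "x = e" using e x(2) by (cases x; cases e) (auto simp: trivial_def same_side_def)
    then show ?thesis using nu True other
      by (auto simp: put_def head_on_def tail_on_def split: list.splits)
  next
    case False
    then show ?thesis using nu x(2) by (auto simp: put_def head_on_def tail_on_def)
  qed
  then show "x = head_on e (nf u)" "?r = tail_on e (nf u)" by auto
qed

end

section \<open>Finite control and logarithmic space\<close>

definition vars_ok :: "nat \<Rightarrow> vars set" where
  "vars_ok D = {f. sim_state f < D \<and> sim_sym f < D \<and> popped f < D \<and> offset f < D}"

lemma finite_moves: "finite (UNIV :: move set)"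
proof -
  have "UNIV = {MoveLeft, Stay, MoveRight}" using move.exhaust by auto
  then show ?thesis by (metis finite.simps)
qed

lemma finite_vars_ok: "finite (vars_ok D)"
proof -
  let ?g = "\<lambda>((q, s, t, k), (b1, b2, b3), (b4, b5, b6), d, e).
     \<lparr>sim_state = q, sim_sym = s, popped = t, offset = k, back_pass = b1, busy = b2, nonzero = b3,
      again = b4, running = b5, answer = b6, work_move = d, input_move = e\<rparr>"
  let ?A = "({..<D} \<times> {..<D} \<times> {..<D} \<times> {..<D}) \<times> (UNIV :: (bool \<times> bool \<times> bool) set) \<times>
     (UNIV :: (bool \<times> bool \<times> bool) set) \<times> (UNIV :: move set) \<times> (UNIV :: move set)"
  have "f \<in> ?g ` ?A" if "f \<in> vars_ok D" for f
    using that by (cases f) (force simp: vars_ok_def image_iff)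
  moreover have "finite ?A" using finite_moves by (intro finite_cartesian_product) auto
  ultimately show ?thesis by (meson finite_imageI finite_subset subsetI)
qed

lemmas prog_defs = skip_def upd_def mv_def restore_loop_def restore_def inc_scan_def inc_def dec_scan_def dec_def ztest_def hop_def

lemma wf_basic:
  assumes "2 \<le> D"
  shows "wf_prog X Y (vars_ok D) {..<D} (skip :: ('x, 'y) vprog)"
    "wf_prog X Y (vars_ok D) {..<D} (mv e :: ('x, 'y) vprog)"
    "wf_prog X Y (vars_ok D) {..<D} (inc r :: ('x, 'y) vprog)"
    "wf_prog X Y (vars_ok D) {..<D} (dec r :: ('x, 'y) vprog)"
    "wf_prog X Y (vars_ok D) {..<D} (ztest r :: ('x, 'y) vprog)"
    "wf_prog X Y (vars_ok D) {..<D} (hop fwd :: ('x, 'y) vprog)"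
    "wf_prog X Y (vars_ok D) {..<D} (clear r :: ('x, 'y) vprog)"
    "wf_prog X Y (vars_ok D) {..<D} (rewind :: ('x, 'y) vprog)"
    "wf_prog X Y (vars_ok D) {..<D} (advance :: ('x, 'y) vprog)"
    "wf_prog X Y (vars_ok D) {..<D} (check_end :: ('x, 'y) vprog)"
    "wf_prog X Y (vars_ok D) {..<D} (open_window :: ('x, 'y) vprog)"
    "wf_prog X Y (vars_ok D) {..<D} (work_prog :: ('x, 'y) vprog)"
  using assms
  by (auto simp: prog_defs clear_def rewind_def advance_def check_end_def open_window_def
      work_prog_def vars_ok_def)

lemma wf_vmove:
  assumes D: "2 \<le> D" and "\<And>z. z \<in> X \<Longrightarrow> length (\<alpha> z) \<le> D" "\<And>z. z \<in> X \<Longrightarrow> length (\<beta> z) \<le> D"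
  shows "wf_prog X Y (vars_ok D) {..<D} (vmove \<alpha> \<beta> fwd :: ('x, 'y) vprog)"
proof -
  have bl: "blen \<alpha> \<beta> f x \<le> D" if "x \<in> {LeftEnd, RightEnd} \<union> Letter ` X" for f x
    using that assms by (auto simp: blen_def blk_def)
  have bl': "blen \<alpha> \<beta> f x - 1 < D" if "x \<in> {LeftEnd, RightEnd} \<union> Letter ` X" for f x
    using bl[OF that, of f] D by linarith
  have "vmove_act \<alpha> \<beta> fwd f x \<in> vars_ok D"
    if "f \<in> vars_ok D" "x \<in> {LeftEnd, RightEnd} \<union> Letter ` X" for f x
    using that bl[OF that(2), of f] by (auto simp: vmove_act_def vars_ok_def)
  then show ?thesis using bl' D
    unfolding vmove_def vmove_loop_def
    by (simp add: wf_basic[OF D]) (simp add: vars_ok_def)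
qed

lemma wf_sim:
  assumes D: "2 \<le> D" and "\<And>z. z \<in> X \<Longrightarrow> length (\<alpha> z) \<le> D" "\<And>z. z \<in> X \<Longrightarrow> length (\<beta> z) \<le> D"
    and st: "start M < D" and em: "\<And>v. v \<in> V \<Longrightarrow> em v \<in> lists Y"
  shows "wf_prog X Y (vars_ok D) {..<D} (sim M V D \<alpha> \<beta> em test :: ('x, 'y) vprog)"
proof -
  have em': "y \<in> Y" if "v \<in> V" "y \<in> set (em v)" for v y
    using em[OF that(1)] that(2) by auto
  have "fst (sim_act M V D \<alpha> \<beta> em test f x) \<in> vars_ok D \<and>
      snd (snd (sim_act M V D \<alpha> \<beta> em test f x)) \<in> lists Y" if "f \<in> vars_ok D" for f x
    using that by (auto simp: sim_act_def cdelta_def vars_ok_def split: option.splits) (use em' in blast)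
  then show ?thesis using D st
    unfolding sim_def sim_loop_def input_prog_def
    by (simp add: wf_basic[OF D] wf_vmove[OF D assms(2,3)]) (simp add: upd_def vars_ok_def)
qed

lemma wf_factor_step:
  assumes D: "2 \<le> D" and "wf_prog X Y (vars_ok D) {..<D} c" "wf_prog X Y (vars_ok D) {..<D} d"
  shows "wf_prog X Y (vars_ok D) {..<D} (factor_step c d)"
  using assms by (simp add: factor_step_def search_def wf_basic)

lemma wf_main_prog:
  assumes D: "2 \<le> D" and "wf_prog X Y (vars_ok D) {..<D} c" "wf_prog X Y (vars_ok D) {..<D} d"
  shows "wf_prog X Y (vars_ok D) {..<D} (main_prog c d)"
  using assms by (simp add: main_prog_def round_prog_def wf_basic)

text \<open>
  Enough bits for counters that do not exceed the length \<open>n\<close> of the input.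
\<close>

definition bits :: "nat \<Rightarrow> nat" where
  "bits n = nat \<lceil>log 2 (real n + 2)\<rceil>"

lemma log_ge_1: "1 \<le> log 2 (real n + 2)"
proof -
  have "log 2 2 \<le> log 2 (real n + 2)" by (intro log_mono) auto
  then show ?thesis by simp
qed

lemma bits_bounds: "n < 2 ^ bits n" "log 2 (real n + 2) \<le> real (bits n)" "real (bits n) \<le> 2 * log 2 (real n + 2)"
proof -
  show b: "log 2 (real n + 2) \<le> real (bits n)"
    using log_ge_1[of n] unfolding bits_def by linarith
  show "real (bits n) \<le> 2 * log 2 (real n + 2)"
    using log_ge_1[of n] unfolding bits_def by linarith
  have "real n + 2 = 2 powr log 2 (real n + 2)" by simp
  also have "\<dots> \<le> 2 powr real (bits n)" using b by (intro powr_mono) auto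
  also have "\<dots> = real (2 ^ bits n)" by (simp add: powr_realpow)
  finally show "n < 2 ^ bits n" by linarith
qed

text \<open>
  The virtual word of a window is longer than the input by a constant factor at most, and \<open>log
  (2 * D * (n + 2))\<close> is at most \<open>2 * D + 1\<close> times \<open>log (n + 2)\<close>.
\<close>

lemma work_pos_bound:
  assumes "\<And>u t. u \<in> lists X \<Longrightarrow> real (work_pos (config_at M u t) + 1) \<le> real c * log 2 (real (length u) + 2)"
    and "u \<in> lists X" "length u \<le> 2 * D * n" "1 \<le> D"
  shows "work_pos (config_at M u t) \<le> c * (2 * D + 1) * bits n"
proof -
  have "real (length u) + 2 \<le> real (2 * D) * (real n + 2)"
  proof -
    have "real (length u) \<le> real (2 * D) * real n" using assms(3) by (metis of_nat_le_iff of_nat_mult)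
    moreover have "2 \<le> real (2 * D) * 2" using assms(4) by simp
    ultimately show ?thesis by (simp add: distrib_left)
  qed
  then have "log 2 (real (length u) + 2) \<le> log 2 (real (2 * D) * (real n + 2))"
    by (intro log_mono) auto
  also have "\<dots> = log 2 (real (2 * D)) + log 2 (real n + 2)"
    using assms(4) by (intro log_mult_pos) auto
  also have "\<dots> \<le> real (2 * D) * log 2 (real n + 2) + log 2 (real n + 2)"
  proof -
    have "2 * D < 2 ^ (2 * D)" by (rule less_exp)
    then have "real (2 * D) \<le> 2 ^ (2 * D)" by (metis less_imp_le of_nat_le_iff of_nat_numeral of_nat_power)
    then have "log 2 (real (2 * D)) \<le> log 2 (2 ^ (2 * D))" using assms(4) by (intro log_mono) auto
    also have "\<dots> = real (2 * D)" by (simp add: log_nat_power)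
    also have "\<dots> \<le> real (2 * D) * log 2 (real n + 2)"
      using mult_left_mono[OF log_ge_1[of n], of "real (2 * D)"] by simp
    finally show ?thesis by simp
  qed
  also have "\<dots> = real (2 * D + 1) * log 2 (real n + 2)" by (simp add: distrib_right)
  also have "\<dots> \<le> real (2 * D + 1) * real (bits n)"
    by (intro mult_left_mono bits_bounds) auto
  finally have "real c * log 2 (real (length u) + 2) \<le> real c * (real (2 * D + 1) * real (bits n))"
    by (intro mult_left_mono) auto
  with assms(1)[OF assms(2), of t]
  have "real (work_pos (config_at M u t) + 1) \<le> real (c * (2 * D + 1) * bits n)" by (simp add: algebra_simps)
  then have "work_pos (config_at M u t) + 1 \<le> c * (2 * D + 1) * bits n" by (simp only: of_nat_le_iff)
  then show ?thesis by simp
qed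

lemma length_concat_map_le:
  "(\<And>x. x \<in> set xs \<Longrightarrow> length (h x) \<le> D) \<Longrightarrow> length (concat (map h xs)) \<le> D * length xs"
  by (induction xs) (auto intro: add_mono)

lemma concat_map_in_lists: "(\<And>x. x \<in> set xs \<Longrightarrow> h x \<in> lists A) \<Longrightarrow> concat (map h xs) \<in> lists A"
  by (induction xs) auto

text \<open>
  The simulation with one space bound for all windows of \<open>w\<close>. The constant \<open>D\<close> bounds the
  blocks, the states and the work symbols.
\<close>

lemma awp_sim_window:
  fixes w :: "'x list" and M :: "('z, 'v) transducer" and \<alpha> \<beta> :: "'x \<Rightarrow> 'z list"
  assumes M: "wf_transducer X V M" "states M \<union> work_syms M \<subseteq> {..<D}"
    and sp: "\<And>u t. u \<in> lists X \<Longrightarrow> real (work_pos (config_at M u t) + 1) \<le> real c * log 2 (real (length u) + 2)"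
    and out: "\<And>u. u \<in> lists X \<Longrightarrow> outputs M u (h u)"
    and w: "w \<in> lists Z" and D: "1 \<le> D"
    and \<alpha>: "\<And>z. z \<in> Z \<Longrightarrow> \<alpha> z \<in> lists X \<and> length (\<alpha> z) \<le> D"
    and \<beta>: "\<And>z. z \<in> Z \<Longrightarrow> \<beta> z \<in> lists X \<and> length (\<beta> z) \<le> D"
    and N: "c * (2 * D + 1) * bits (length w) < N" "bits (length w) \<le> N"
    and ij: "i \<le> j" "j \<le> length w"
    and u: "u = concat (map \<alpha> (take (j - i) (drop i w))) @ concat (map \<beta> (rev (take (j - i) (drop i w))))"
    and Q: "\<And>f' a'. a' \<le> j - i \<Longrightarrow> answer f' = (\<exists>x \<in> set (h u). test x) \<Longrightarrow>
      Q (f', i + a', [], [], a', (j - i) - a', o1 @ concat (map em (h u)))"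
  shows "awp w N (bits (length w)) (sim M V D \<alpha> \<beta> em test) Q (f, i, [], [], 0, j - i, o1)"
proof -
  interpret window w N "bits (length w)" i j \<alpha> \<beta>
    using N(2) ij bits_bounds(1) by unfold_locales auto
  let ?seg = "take (j - i) (drop i w)"
  have seg: "set ?seg \<subseteq> Z" using w by (auto dest: in_set_takeD in_set_dropD)
  have vu: "vword = u" by (simp add: vword_def seg_def u)
  have uX: "u \<in> lists X"
  proof -
    have "concat (map \<alpha> ?seg) \<in> lists X"
      by (rule concat_map_in_lists) (use seg \<alpha> in blast)
    moreover have "concat (map \<beta> (rev ?seg)) \<in> lists X"
      by (rule concat_map_in_lists, unfold set_rev) (use seg \<beta> in blast)
    ultimately
    show ?thesis unfolding u by simp
  qed
  have a: "length (concat (map \<alpha> ?seg)) \<le> D * length ?seg"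
    by (rule length_concat_map_le) (use seg \<alpha> in blast)
  have b: "length (concat (map \<beta> (rev ?seg))) \<le> D * length (rev ?seg)"
    by (rule length_concat_map_le, unfold set_rev) (use seg \<beta> in blast)
  have "length u \<le> D * length ?seg + D * length (rev ?seg)"
    unfolding u length_append by (rule add_mono[OF a b])
  also have "\<dots> \<le> D * length w + D * length w"
    by (intro add_mono mult_left_mono) auto
  finally have "length u \<le> 2 * D * length w" by (simp add: mult_2 distrib_right)
  then have B: "work_pos (config_at M vword t) \<le> c * (2 * D + 1) * bits (length w)" for t
    unfolding vu by (intro work_pos_bound[OF sp uX _ D])
  show ?thesis
    using awp_sim[where em = em and test = test and Q = Q and f = f and ?o1.0 = o1,
        OF M(1) _ M(2) B N(1) out[of vword]] uX Q
    by (simp add: vu m_def)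
qed

section \<open>Values of words, and retracts\<close>

lemma concat_map_Nil: "concat (map (\<lambda>_. []) l) = []"
  by (induction l) auto

context group
begin

lemma word_val_simps [simp]: "word_val G [] = \<one>" "word_val G (x # u) = x \<otimes> word_val G u"
  by (simp_all add: word_val_def)

lemma word_val_closed: "u \<in> lists (carrier G) \<Longrightarrow> word_val G u \<in> carrier G"
  by (induction u) auto

lemma word_val_append:
  "u \<in> lists (carrier G) \<Longrightarrow> v \<in> lists (carrier G) \<Longrightarrow>
     word_val G (u @ v) = word_val G u \<otimes> word_val G v"
  by (induction u) (auto simp: m_assoc word_val_closed in_listsI)

lemma word_val_concat_map:
  assumes "\<And>z. z \<in> set u \<Longrightarrow> h z \<in> lists (carrier G)"
  shows "word_val G (concat (map h u)) = word_val G (map (\<lambda>z. word_val G (h z)) u)"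
  using assms by (induction u) (simp_all add: word_val_append concat_map_in_lists del: in_lists_conv_set)

lemma word_val_rev_inv:
  "u \<in> lists (carrier G) \<Longrightarrow> word_val G (map (\<lambda>z. inv z) (rev u)) = inv (word_val G u)"
proof (induction u)
  case (Cons x u)
  then have x: "x \<in> carrier G" "u \<in> lists (carrier G)" by auto
  have "map (\<lambda>z. inv z) (rev u) \<in> lists (carrier G)" using x by auto
  then have "word_val G (map (\<lambda>z. inv z) (rev u) @ [inv x]) = inv (word_val G u) \<otimes> inv x"
    using Cons.IH[OF x(2)] x word_val_append[of "map (\<lambda>z. inv z) (rev u)" "[inv x]"] by simp
  then show ?case using x word_val_closed[OF x(2)] by (simp add: inv_mult_group)
qed simp

lemma word_val_onto:
  assumes "fin_sym_gen G X" "g \<in> carrier G"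
  shows "\<exists>u \<in> lists X. word_val G u = g"
proof -
  have X: "X \<subseteq> carrier G" "\<And>x. x \<in> X \<Longrightarrow> inv x \<in> X" using assms(1) by (auto simp: fin_sym_gen_def)
  have "g \<in> generate G X" using assms by (simp add: fin_sym_gen_def)
  then show ?thesis
  proof (induction rule: generate.induct)
    case one
    show ?case by (rule bexI[of _ "[]"]) auto
  next
    case (incl h)
    then show ?case using X by (intro bexI[of _ "[h]"]) auto
  next
    case (inv h)
    then show ?case using X by (intro bexI[of _ "[inv h]"]) auto
  next
    case (eng h1 h2)
    then obtain u1 u2 where "u1 \<in> lists X" "word_val G u1 = h1" "u2 \<in> lists X" "word_val G u2 = h2"
      by blast
    moreover have "u1 \<in> lists (carrier G)" "u2 \<in> lists (carrier G)"
      using calculation X(1) lists_mono by blast+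
    ultimately show ?case by (intro bexI[of _ "u1 @ u2"]) (auto simp: word_val_append)
  qed
qed

end

lemma hom_word_val:
  assumes "group A" "group B" "h \<in> hom A B" "u \<in> lists (carrier A)"
  shows "h (word_val A u) = word_val B (map h u)"
proof -
  interpret A: group A by fact
  interpret B: group B by fact
  interpret group_hom A B h using assms(3) by unfold_locales
  show ?thesis using assms(4) by (induction u) (auto simp: A.word_val_closed in_listsI)
qed

text \<open>
  Both factors are retracts of the free product; this is all that a factorisation step needs.
\<close>

locale retract = P: group P + A: group A
  for P :: "('p, 'm) monoid_scheme" and A :: "('e, 'n) monoid_scheme" +
  fixes emb :: "'e \<Rightarrow> 'p" and ret :: "'p \<Rightarrow> 'e"
  assumes emb: "emb \<in> hom A P" and ret: "ret \<in> hom P A"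
    and ret_emb: "\<And>a. a \<in> carrier A \<Longrightarrow> ret (emb a) = a"
begin

lemma emb_closed: "a \<in> carrier A \<Longrightarrow> emb a \<in> carrier P"
  using emb by (auto simp: hom_def)

lemma ret_closed: "x \<in> carrier P \<Longrightarrow> ret x \<in> carrier A"
  using ret by (auto simp: hom_def)

text \<open>
  An element \<open>s\<close> lies in the retract iff \<open>s = emb (ret s)\<close>. The word on the left has the value
  \<open>s\<close> times the inverse of \<open>emb (ret s)\<close>; the reversal accounts for the inverse of a product.
\<close>

lemma in_factor_iff:
  assumes "seg \<in> lists (carrier P)"
    and \<psi>: "\<And>x. x \<in> carrier P \<Longrightarrow> \<psi> x \<in> lists Z0 \<and> word_val P (\<psi> x) = x"
    and Z0: "Z0 \<subseteq> carrier P"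
  shows "concat (map \<psi> seg) @ concat (map (\<lambda>z. \<psi> (inv\<^bsub>P\<^esub> (emb (ret z)))) (rev seg)) \<in> word_problem P Z0
    \<longleftrightarrow> word_val P seg \<in> emb ` carrier A"
proof -
  let ?b = "\<lambda>z. \<psi> (inv\<^bsub>P\<^esub> (emb (ret z)))"
  let ?s = "word_val P seg"
  have ls: "\<And>u. u \<in> lists Z0 \<Longrightarrow> u \<in> lists (carrier P)" using Z0 lists_mono by blast
  have s: "?s \<in> carrier P" by (rule P.word_val_closed) fact
  have es: "\<And>z. z \<in> set seg \<Longrightarrow> z \<in> carrier P \<and> emb (ret z) \<in> carrier P"
    using assms(1) emb_closed ret_closed by auto
  have mr: "map ret seg \<in> lists (carrier A)" using assms(1) ret_closed by auto
  have l1: "concat (map \<psi> seg) \<in> lists Z0"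
    by (rule concat_map_in_lists) (use es \<psi> in blast)
  have l2: "concat (map ?b (rev seg)) \<in> lists Z0"
    by (rule concat_map_in_lists, unfold set_rev) (use es \<psi> P.inv_closed in blast)
  have "word_val P (concat (map \<psi> seg)) = word_val P (map (\<lambda>z. word_val P (\<psi> z)) seg)"
  proof (rule P.word_val_concat_map)
    fix z assume "z \<in> set seg"
    then show "\<psi> z \<in> lists (carrier P)" using es \<psi> ls by simp
  qed
  also have "map (\<lambda>z. word_val P (\<psi> z)) seg = seg"
    using es \<psi> by (intro map_idI) auto
  finally have v1: "word_val P (concat (map \<psi> seg)) = ?s" .
  have "word_val P (concat (map ?b (rev seg))) = word_val P (map (\<lambda>z. word_val P (?b z)) (rev seg))"
  proof (rule P.word_val_concat_map)
    fix z assume "z \<in> set (rev seg)"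
    then have "inv\<^bsub>P\<^esub> (emb (ret z)) \<in> carrier P" using es by simp
    then show "?b z \<in> lists (carrier P)" using \<psi> ls by simp
  qed
  also have "map (\<lambda>z. word_val P (?b z)) (rev seg) = map (\<lambda>z. inv\<^bsub>P\<^esub> z) (rev (map (\<lambda>z. emb (ret z)) seg))"
    using es \<psi> P.inv_closed by (auto simp: rev_map)
  also have "word_val P \<dots> = inv\<^bsub>P\<^esub> (word_val P (map (\<lambda>z. emb (ret z)) seg))"
    by (rule P.word_val_rev_inv) (use es in auto)
  also have "word_val P (map (\<lambda>z. emb (ret z)) seg) = emb (ret ?s)"
    using hom_word_val[OF P.is_group A.is_group ret assms(1)]
      hom_word_val[OF A.is_group P.is_group emb, of "map ret seg"] mr
    by (simp add: comp_def)
  finally have v2: "word_val P (concat (map ?b (rev seg))) = inv\<^bsub>P\<^esub> (emb (ret ?s))" .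
  have er: "emb (ret ?s) \<in> carrier P" using s emb_closed ret_closed by blast
  have "concat (map \<psi> seg) @ concat (map ?b (rev seg)) \<in> word_problem P Z0 \<longleftrightarrow>
      ?s \<otimes>\<^bsub>P\<^esub> inv\<^bsub>P\<^esub> (emb (ret ?s)) = \<one>\<^bsub>P\<^esub>"
    using l1 l2 by (auto simp: word_problem_def P.word_val_append[OF ls[OF l1] ls[OF l2]] v1 v2)
  also have "\<dots> \<longleftrightarrow> ?s = emb (ret ?s)"
    using s er P.inv_solve_right[of "\<one>\<^bsub>P\<^esub>" ?s "emb (ret ?s)"] by auto
  also have "\<dots> \<longleftrightarrow> ?s \<in> emb ` carrier A"
  proof
    assume "?s = emb (ret ?s)"
    then show "?s \<in> emb ` carrier A" using ret_closed[OF s] by (rule image_eqI)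
  next
    assume "?s \<in> emb ` carrier A"
    then obtain a where "a \<in> carrier A" "?s = emb a" by blast
    then show "?s = emb (ret ?s)" using ret_emb by simp
  qed
  finally show ?thesis .
qed

lemma ret_word:
  assumes "seg \<in> lists (carrier P)" and "\<And>z. z \<in> set seg \<Longrightarrow> \<alpha> z \<in> lists (carrier A) \<and> word_val A (\<alpha> z) = ret z"
  shows "word_val A (concat (map \<alpha> seg)) = ret (word_val P seg)"
proof -
  have "word_val A (concat (map \<alpha> seg)) = word_val A (map (\<lambda>z. word_val A (\<alpha> z)) seg)"
    by (rule A.word_val_concat_map) (use assms(2) in blast)
  also have "map (\<lambda>z. word_val A (\<alpha> z)) seg = map ret seg" using assms(2) by simp
  finally show ?thesis using hom_word_val[OF P.is_group A.is_group ret assms(1)] by simp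
qed

text \<open>
  One step of the factorisation, for either factor: \<open>MW\<close> decides the word problem of \<open>P\<close> and is
  used to test windows, \<open>MA\<close> computes the normal forms of \<open>A\<close>. The step finds the longest window
  with a value \<open>emb a\<close> in the factor and outputs the normal form of \<open>a\<close>. For the second
  simulation the backward pass is empty.
\<close>

lemma awp_retract_step:
  assumes Z: "Z \<subseteq> carrier P" "w \<in> lists Z" and Z0: "Z0 \<subseteq> carrier P"
    and \<psi>: "\<And>x. x \<in> carrier P \<Longrightarrow> \<psi> x \<in> lists Z0 \<and> word_val P (\<psi> x) = x"
    and \<beta>: "\<beta> = (\<lambda>z. \<psi> (inv\<^bsub>P\<^esub> (emb (ret z))))"
    and len: "\<And>z. z \<in> Z \<Longrightarrow> length (\<psi> z) \<le> D \<and> length (\<beta> z) \<le> D \<and> length (\<alpha> z) \<le> D" and D: "1 \<le> D"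
    and MW: "wf_transducer Z0 (UNIV :: bool set) MW" "states MW \<union> work_syms MW \<subseteq> {..<D}"
      "\<And>u t. u \<in> lists Z0 \<Longrightarrow> real (work_pos (config_at MW u t) + 1) \<le> real c * log 2 (real (length u) + 2)"
      "\<And>u. u \<in> lists Z0 \<Longrightarrow> outputs MW u [u \<in> word_problem P Z0]"
    and MA: "wf_transducer X X MA" "states MA \<union> work_syms MA \<subseteq> {..<D}"
      "\<And>u t. u \<in> lists X \<Longrightarrow> real (work_pos (config_at MA u t) + 1) \<le> real c * log 2 (real (length u) + 2)"
      "\<And>u. u \<in> lists X \<Longrightarrow> outputs MA u (nA (word_val A u))"
    and X: "X \<subseteq> carrier A"
    and \<alpha>: "\<And>z. z \<in> Z \<Longrightarrow> \<alpha> z \<in> lists X \<and> word_val A (\<alpha> z) = ret z"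
    and N: "c * (2 * D + 1) * bits (length w) < N" "bits (length w) \<le> N"
    and i: "i \<le> length w"
    and Q: "\<And>f' j a. i \<le> j \<Longrightarrow> j \<le> length w \<Longrightarrow> a \<in> carrier A \<Longrightarrow>
      word_val P (take (j - i) (drop i w)) = emb a \<Longrightarrow>
      (\<And>k. j < k \<Longrightarrow> k \<le> length w \<Longrightarrow> word_val P (take (k - i) (drop i w)) \<notin> emb ` carrier A) \<Longrightarrow>
      Q (f', j, [], [], 0, 0, o1 @ map emb (nA a))"
  shows "awp w N (bits (length w)) (factor_step (sim MW UNIV D \<psi> \<beta> (\<lambda>_. []) (\<lambda>b. b))
    (sim MA X D \<alpha> (\<lambda>_. []) (\<lambda>v. [emb v]) (\<lambda>_. False))) Q (f, i, [], [], 0, 0, o1)"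
proof -
  let ?seg = "\<lambda>j. take (j - i) (drop i w)"
  have segZ: "set (?seg j) \<subseteq> Z" for j using Z(2) by (auto dest: in_set_takeD in_set_dropD)
  then have segP: "?seg j \<in> lists (carrier P)" for j using Z(1) by blast
  have lX: "u \<in> lists X \<Longrightarrow> u \<in> lists (carrier A)" for u using X lists_mono by blast
  have \<psi>': "\<psi> z \<in> lists Z0 \<and> length (\<psi> z) \<le> D" if "z \<in> Z" for z using \<psi> len that Z(1) by blast
  have "inv\<^bsub>P\<^esub> (emb (ret z)) \<in> carrier P" if "z \<in> Z" for z
    using that Z(1) by (intro P.inv_closed emb_closed ret_closed) blast
  then have \<beta>': "\<beta> z \<in> lists Z0 \<and> length (\<beta> z) \<le> D" if "z \<in> Z" for z using \<psi> len that unfolding \<beta> by blast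
  have \<alpha>': "\<alpha> z \<in> lists X \<and> length (\<alpha> z) \<le> D" if "z \<in> Z" for z using \<alpha> len that by blast
  have nil: "([] :: 'e list) \<in> lists X \<and> length ([] :: 'e list) \<le> D" if "z \<in> Z" for z :: 'p by simp
  show ?thesis
  proof (rule awp_factor_step[where T = "\<lambda>j. word_val P (?seg j) \<in> emb ` carrier A"
        and g = "\<lambda>j. map emb (nA (ret (word_val P (?seg j))))"])
    show "bits (length w) \<le> N" "length w < 2 ^ bits (length w)" "i \<le> length w"
      using N bits_bounds i by auto
    have "emb \<one>\<^bsub>A\<^esub> = \<one>\<^bsub>P\<^esub>" using hom_one[OF emb A.is_group P.is_group] .
    then show "word_val P (?seg i) \<in> emb ` carrier A" by (auto intro!: image_eqI[of _ _ "\<one>\<^bsub>A\<^esub>"])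
  next
    fix j f and Q :: "'p astate \<Rightarrow> bool"
    assume j: "i \<le> j" "j \<le> length w"
      and Q: "\<And>f' a'. a' \<le> j - i \<Longrightarrow> answer f' = (word_val P (?seg j) \<in> emb ` carrier A) \<Longrightarrow>
        Q (f', i + a', [], [], a', (j - i) - a', o1)"
    let ?u = "concat (map \<psi> (?seg j)) @ concat (map \<beta> (rev (?seg j)))"
    have u: "?u \<in> word_problem P Z0 \<longleftrightarrow> word_val P (?seg j) \<in> emb ` carrier A"
      unfolding \<beta> by (rule in_factor_iff[OF segP \<psi> Z0])
    show "awp w N (bits (length w)) (sim MW UNIV D \<psi> \<beta> (\<lambda>_. []) (\<lambda>b. b)) Q (f, i, [], [], 0, j - i, o1)"
      by (rule awp_sim_window[where h = "\<lambda>u. [u \<in> word_problem P Z0]", OF MW(1-4) Z(2) D \<psi>' \<beta>' N j HOL.refl])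
        (use Q u in simp_all)
  next
    fix j f and Q :: "'p astate \<Rightarrow> bool"
    assume j: "i \<le> j" "j \<le> length w" "word_val P (?seg j) \<in> emb ` carrier A"
      and Q: "\<And>f' a'. a' \<le> j - i \<Longrightarrow>
        Q (f', i + a', [], [], a', (j - i) - a', o1 @ map emb (nA (ret (word_val P (?seg j)))))"
    let ?u = "concat (map \<alpha> (?seg j)) @ concat (map (\<lambda>_. []) (rev (?seg j)))"
    have "word_val A (concat (map \<alpha> (?seg j))) = ret (word_val P (?seg j))"
      by (rule ret_word[OF segP]) (use \<alpha> lX segZ in blast)
    then have u: "nA (word_val A ?u) = nA (ret (word_val P (?seg j)))"
      unfolding concat_map_Nil append_Nil2 by simp
    have em: "concat (map (\<lambda>v. [emb v]) l) = map emb l" for l by (induction l) auto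
    show "awp w N (bits (length w)) (sim MA X D \<alpha> (\<lambda>_. []) (\<lambda>v. [emb v]) (\<lambda>_. False)) Q
        (f, i, [], [], 0, j - i, o1)"
      by (rule awp_sim_window[where h = "\<lambda>u. nA (word_val A u)", OF MA(1-4) Z(2) D \<alpha>' nil N j(1,2) HOL.refl])
        (use Q u in \<open>simp_all add: em\<close>)
  next
    fix f' :: vars and j
    assume j: "i \<le> j" "j \<le> length w" "word_val P (?seg j) \<in> emb ` carrier A"
      and max: "\<And>k. j < k \<Longrightarrow> k \<le> length w \<Longrightarrow> word_val P (?seg k) \<notin> emb ` carrier A"
    from j(3) obtain a where a: "a \<in> carrier A" "word_val P (?seg j) = emb a" by blast
    show "Q (f', j, [], [], 0, 0, o1 @ map emb (nA (ret (word_val P (?seg j)))))"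
      using Q[OF j(1,2) a max] ret_emb[OF a(1)] a(2) by simp
  qed
qed

end

section \<open>The normal form of the free product\<close>

context two_groups
begin

abbreviation "FP \<equiv> free_product G H"

definition cls :: "('a + 'b) list \<Rightarrow> ('a + 'b) list set" where
  "cls u = fp_rel G H `` {u}"

lemma cls_eq: "u \<in> lists letters \<Longrightarrow> v \<in> lists letters \<Longrightarrow> cls u = cls v \<longleftrightarrow> fp_eq G H u v"
  unfolding cls_def by (rule fp_class_eq_iff[OF G H])

lemma cls_append: "u \<in> lists letters \<Longrightarrow> v \<in> lists letters \<Longrightarrow> cls u \<otimes>\<^bsub>FP\<^esub> cls v = cls (u @ v)"
  unfolding cls_def by (rule fp_mult_class[OF G H])

lemma cls_word:
  assumes "\<And>z. z \<in> set w \<Longrightarrow> rep z \<in> letters \<and> z = cls [rep z]"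
  shows "word_val FP w = cls (map rep w)"
  using assms
proof (induction w)
  case Nil
  then show ?case using fp_one[OF G H] by (simp add: word_val_def cls_def)
next
  case (Cons z w)
  then have "map rep w \<in> lists letters" "[rep z] \<in> lists letters" by auto
  with Cons show ?case using cls_append[of "[rep z]" "map rep w"] by (simp add: word_val_def)
qed

lemma length_tail_on: "length (tail_on e r) \<le> length r"
  by (auto simp: tail_on_def split: list.splits)

lemma tail_on_shorter:
  assumes "\<not> same_side e e'" "r \<noteq> []"
  shows "length (tail_on e' (tail_on e r)) < length r"
proof (cases r)
  case (Cons x r')
  show ?thesis
  proof (cases "same_side e x")
    case True
    then show ?thesis using Cons length_tail_on[of e' r'] by (simp add: tail_on_def)
  next
    case False
    then have "same_side e' x" using assms(1) by (auto simp: same_side_def)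
    then show ?thesis using Cons False by (simp add: tail_on_def)
  qed
qed (use assms in simp)

lemma fp_head_tail:
  assumes "reduced r" "e \<in> letters" "trivial e"
  shows "fp_eq G H (head_on e r # tail_on e r) r" "reduced (tail_on e r)" "head_on e r \<in> letters"
    "same_side e (head_on e r)"
proof -
  have r: "r \<in> lists letters" by (rule reduced_lists[OF assms(1)])
  have "fp_eq G H (head_on e r # tail_on e r) r \<and> reduced (tail_on e r) \<and> head_on e r \<in> letters \<and>
      same_side e (head_on e r)"
  proof (cases r)
    case Nil
    then show ?thesis using assms fp_trivial[OF assms(3,2), of "[]"]
      by (simp add: head_on_def tail_on_def same_side_def)
  next
    case (Cons x r')
    then show ?thesis using assms r fp_trivial[OF assms(3,2) r] fp_refl[OF r]
      by (simp add: head_on_def tail_on_def same_side_def)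
  qed
  then show "fp_eq G H (head_on e r # tail_on e r) r" "reduced (tail_on e r)" "head_on e r \<in> letters"
    "same_side e (head_on e r)" by blast+
qed

definition left_one :: "'a + 'b" where "left_one = Inl \<one>\<^bsub>G\<^esub>"
definition right_one :: "'a + 'b" where "right_one = Inr \<one>\<^bsub>H\<^esub>"

lemma ones: "left_one \<in> letters" "trivial left_one" "right_one \<in> letters" "trivial right_one"
  "\<not> same_side left_one right_one"
  using group.is_monoid[OF G] group.is_monoid[OF H]
  by (auto simp: left_one_def right_one_def trivial_def same_side_def monoid.one_closed)

text \<open>
  The syllables of a reduced word, translated by \<open>p\<close> and \<open>q\<close>. The form of the recursion is that
  of the program: a syllable of each factor is produced in every round, trivial or not, and
  there is at least one round.
\<close>

function syllables :: "(('a + 'b) \<Rightarrow> 'y list) \<Rightarrow> (('a + 'b) \<Rightarrow> 'y list) \<Rightarrow> ('a + 'b) list \<Rightarrow> 'y list" where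
  "syllables p q r = p (head_on left_one r) @ q (head_on right_one (tail_on left_one r)) @
     (if tail_on right_one (tail_on left_one r) = [] then []
      else syllables p q (tail_on right_one (tail_on left_one r)))"
  by pat_completeness auto
termination
proof (relation "measure (\<lambda>(p, q, r). length r)")
  fix p q :: "('a + 'b) \<Rightarrow> 'y list" and r
  assume "tail_on right_one (tail_on left_one r) \<noteq> []"
  then have "r \<noteq> []" by (auto simp: tail_on_def)
  then show "((p, q, tail_on right_one (tail_on left_one r)), p, q, r) \<in> measure (\<lambda>(p, q, r). length r)"
    using tail_on_shorter[OF ones(5)] by simp
qed simp

declare syllables.simps [simp del]

end

context two_groups
begin

lemma syllables_value:
  assumes Z: "Z \<subseteq> carrier FP"
    and p: "\<And>r. reduced r \<Longrightarrow> p (head_on left_one r) \<in> lists Z \<and> word_val FP (p (head_on left_one r)) = cls [head_on left_one r]"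
    and q: "\<And>r. reduced r \<Longrightarrow> q (head_on right_one r) \<in> lists Z \<and> word_val FP (q (head_on right_one r)) = cls [head_on right_one r]"
    and "reduced r"
  shows "syllables p q r \<in> lists Z \<and> word_val FP (syllables p q r) = cls r"
  using assms(4)
proof (induction "length r" arbitrary: r rule: less_induct)
  case less
  interpret P: group FP by (rule group_free_product[OF G H])
  have lP: "u \<in> lists Z \<Longrightarrow> u \<in> lists (carrier FP)" for u using Z lists_mono by blast
  let ?x = "head_on left_one r" and ?r1 = "tail_on left_one r"
  let ?y = "head_on right_one ?r1" and ?r2 = "tail_on right_one ?r1"
  let ?t = "if ?r2 = [] then [] else syllables p q ?r2"
  note h1 = fp_head_tail[OF less.prems ones(1,2)]
  note h2 = fp_head_tail[OF h1(2) ones(3,4)]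
  have l: "[?x] \<in> lists letters" "[?y] \<in> lists letters" "?r1 \<in> lists letters" "?r2 \<in> lists letters"
    using h1 h2 reduced_lists by auto
  have t: "?t \<in> lists Z \<and> word_val FP ?t = cls ?r2"
  proof (cases "?r2 = []")
    case True
    then show ?thesis using fp_one[OF G H] by (simp add: cls_def)
  next
    case False
    then have "r \<noteq> []" by (auto simp: tail_on_def)
    then show ?thesis using less.hyps[OF tail_on_shorter[OF ones(5)] h2(2)] False by simp
  qed
  have s: "syllables p q r = p ?x @ q ?y @ ?t" by (subst syllables.simps) simp
  have "word_val FP (syllables p q r) = cls [?x] \<otimes>\<^bsub>FP\<^esub> (cls [?y] \<otimes>\<^bsub>FP\<^esub> cls ?r2)"
    unfolding s using p[OF less.prems] q[OF h1(2)] t lP by (simp add: P.word_val_append del: in_lists_conv_set)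
  also have "cls [?y] \<otimes>\<^bsub>FP\<^esub> cls ?r2 = cls ?r1"
    using cls_append[OF l(2,4)] cls_eq[of "[?y] @ ?r2" ?r1] l h2(1) by simp
  also have "cls [?x] \<otimes>\<^bsub>FP\<^esub> cls ?r1 = cls r"
    using cls_append[OF l(1,3)] cls_eq[of "[?x] @ ?r1" r] l h1(1) reduced_lists[OF less.prems] by simp
  finally show ?case using p[OF less.prems] q[OF h1(2)] t by (simp add: s)
qed

lemma retraction_left:
  "\<exists>\<rho> \<in> hom FP G. (\<forall>x \<in> carrier G. \<rho> (fp_inl G H x) = x) \<and> (\<forall>y \<in> carrier H. \<rho> (fp_inr G H y) = \<one>\<^bsub>G\<^esub>)"
  using group.is_monoid[OF G]
  by (intro free_product_lift_exists[OF G H G]) (auto simp: hom_def)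

lemma retraction_right:
  "\<exists>\<rho> \<in> hom FP H. (\<forall>x \<in> carrier G. \<rho> (fp_inl G H x) = \<one>\<^bsub>H\<^esub>) \<and> (\<forall>y \<in> carrier H. \<rho> (fp_inr G H y) = y)"
  using group.is_monoid[OF H]
  by (intro free_product_lift_exists[OF G H H]) (auto simp: hom_def)

lemma inl_cls: "fp_inl G H x = cls [Inl x]" and inr_cls: "fp_inr G H y = cls [Inr y]"
  by (simp_all add: fp_inl_def fp_inr_def cls_def)

lemma fin_sym_gen_free_product:
  assumes X: "fin_sym_gen G X" and Y: "fin_sym_gen H Y"
  shows "fin_sym_gen FP (fp_inl G H ` X \<union> fp_inr G H ` Y)" (is "fin_sym_gen FP ?Z")
proof -
  interpret P: group FP by (rule group_free_product[OF G H])
  interpret L: group_hom G FP "fp_inl G H" using G P.is_group fp_inl_hom[OF G H]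
    by (auto simp: group_hom_def group_hom_axioms_def)
  interpret R: group_hom H FP "fp_inr G H" using H P.is_group fp_inr_hom[OF G H]
    by (auto simp: group_hom_def group_hom_axioms_def)
  have XY: "X \<subseteq> carrier G" "Y \<subseteq> carrier H" using X Y by (auto simp: fin_sym_gen_def)
  have Z: "?Z \<subseteq> carrier FP" using XY by auto
  have "inv\<^bsub>FP\<^esub> z \<in> ?Z" if "z \<in> ?Z" for z
    using that
  proof
    assume "z \<in> fp_inl G H ` X"
    then obtain x where x: "x \<in> X" "z = fp_inl G H x" by blast
    then have "inv\<^bsub>FP\<^esub> z = fp_inl G H (inv\<^bsub>G\<^esub> x)" using L.hom_inv XY by auto
    then show ?thesis using X x by (auto simp: fin_sym_gen_def)
  next
    assume "z \<in> fp_inr G H ` Y"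
    then obtain y where y: "y \<in> Y" "z = fp_inr G H y" by blast
    then have "inv\<^bsub>FP\<^esub> z = fp_inr G H (inv\<^bsub>H\<^esub> y)" using R.hom_inv XY by auto
    then show ?thesis using Y y by (auto simp: fin_sym_gen_def)
  qed
  moreover have "generate FP ?Z = carrier FP"
  proof
    show "generate FP ?Z \<subseteq> carrier FP" by (rule P.generate_incl[OF Z])
    have l: "cls [x] \<in> generate FP ?Z" if "x \<in> letters" for x
      using that
    proof (cases x)
      case (Inl g)
      then have "g \<in> generate G X" using that X by (auto simp: fin_sym_gen_def)
      then have "fp_inl G H g \<in> generate FP (fp_inl G H ` X)" using L.generate_img[OF XY(1)] by blast
      then show ?thesis using P.mono_generate[of "fp_inl G H ` X" ?Z] Inl inl_cls by auto
    next
      case (Inr h)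
      then have "h \<in> generate H Y" using that Y by (auto simp: fin_sym_gen_def)
      then have "fp_inr G H h \<in> generate FP (fp_inr G H ` Y)" using R.generate_img[OF XY(2)] by blast
      then show ?thesis using P.mono_generate[of "fp_inr G H ` Y" ?Z] Inr inr_cls by auto
    qed
    have "cls u \<in> generate FP ?Z" if "u \<in> lists letters" for u
      using that
    proof (induction u)
      case Nil
      then show ?case using generate.one[of FP ?Z] fp_one[OF G H] by (simp add: cls_def)
    next
      case (Cons x u)
      then have xu: "[x] \<in> lists letters" "u \<in> lists letters" "x \<in> letters" by auto
      have "cls [x] \<otimes>\<^bsub>FP\<^esub> cls u \<in> generate FP ?Z" by (rule generate.eng[OF l[OF xu(3)] Cons.IH])
      then show ?case unfolding cls_append[OF xu(1,2)] by simp
    qed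
    then show "carrier FP \<subseteq> generate FP ?Z" using fp_carrier[OF G H] by (auto simp: cls_def)
  qed
  ultimately show ?thesis using X Y Z unfolding fin_sym_gen_def by blast
qed

end

text \<open>
  Either of the two factors: \<open>\<iota>\<close> is \<open>Inl\<close> or \<open>Inr\<close>, \<open>un\<close> is its inverse, and the trivial letter
  \<open>e\<close> indicates the factor.
\<close>

locale free_factor = two_groups G H + retract "free_product G H" A emb ret
  for G :: "('a, 'c) monoid_scheme" (structure) and H :: "('b, 'd) monoid_scheme"
    and A :: "('e, 'n) monoid_scheme" and emb ret +
  fixes \<iota> :: "'e \<Rightarrow> 'a + 'b" and un :: "'a + 'b \<Rightarrow> 'e" and e :: "'a + 'b"
  assumes e: "e \<in> letters" "trivial e"
    and side: "{x \<in> letters. same_side e x} = \<iota> ` carrier A"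
    and emb_cls: "\<And>a. a \<in> carrier A \<Longrightarrow> emb a = cls [\<iota> a]"
    and un: "\<And>a. un (\<iota> a) = a"
begin

lemma letter: "a \<in> carrier A \<Longrightarrow> \<iota> a \<in> letters \<and> same_side e (\<iota> a)"
  using side by blast

lemma head_cls:
  assumes "reduced r"
  shows "un (head_on e r) \<in> carrier A" "emb (un (head_on e r)) = cls [head_on e r]"
proof -
  have "head_on e r \<in> \<iota> ` carrier A" by (subst side[symmetric]) (simp add: fp_head_tail[OF assms e])
  then show "un (head_on e r) \<in> carrier A" "emb (un (head_on e r)) = cls [head_on e r]"
    using un emb_cls by auto
qed

text \<open>
  The translation of \<open>longest_prefix_is_syllable\<close> to words over generators \<open>z\<close> of the free
  product, each of which is a single letter \<open>rep z\<close>. If nothing remains after the window, then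
  the whole suffix has the value of the window, so that by maximality the window extends to the
  end.
\<close>

lemma longest_window:
  assumes rep: "\<And>z. z \<in> set w \<Longrightarrow> rep z \<in> letters \<and> z = cls [rep z]"
    and ij: "i \<le> j" "j \<le> length w"
    and a: "a \<in> carrier A" "word_val FP (take (j - i) (drop i w)) = emb a"
    and max: "\<And>k. j < k \<Longrightarrow> k \<le> length w \<Longrightarrow> word_val FP (take (k - i) (drop i w)) \<notin> emb ` carrier A"
  defines "r \<equiv> nf (drop i (map rep w))"
  shows "a = un (head_on e r)" "nf (drop j (map rep w)) = tail_on e r"
    "nf (drop j (map rep w)) = [] \<Longrightarrow> j = length w"
proof -
  let ?u = "drop i (map rep w)"
  have lt: "drop k (map rep w) \<in> lists letters" "take k ?u \<in> lists letters" for k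
    using rep by (auto dest!: in_set_takeD in_set_dropD)
  have val: "word_val FP (take k (drop i w)) = cls (take k ?u)" for k
  proof -
    have "word_val FP (take k (drop i w)) = cls (map rep (take k (drop i w)))"
      by (rule cls_word) (use rep in \<open>auto dest!: in_set_takeD in_set_dropD\<close>)
    then show ?thesis by (simp add: take_map drop_map)
  qed
  have hit: "word_val FP (take k (drop i w)) \<in> emb ` carrier A"
    if y: "y \<in> letters" "same_side e y" "fp_eq G H (take k ?u) [y]" for k y
  proof -
    obtain b where b: "b \<in> carrier A" "y = \<iota> b" using y(1,2) side by blast
    have "cls (take k ?u) = cls [y]" using cls_eq[OF lt(2), of "[y]"] y by simp
    then show ?thesis using b emb_cls val by auto
  qed
  have x: "fp_eq G H (take (j - i) ?u) [\<iota> a]"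
    using a val emb_cls[OF a(1)] cls_eq[OF lt(2), of "[\<iota> a]"] letter[OF a(1)] by simp
  have mx: "\<not> fp_eq G H (take k ?u) [y]"
    if "j - i < k" "k \<le> length ?u" "y \<in> letters" "same_side e y" for k y
  proof
    assume "fp_eq G H (take k ?u) [y]"
    then have "word_val FP (take ((k + i) - i) (drop i w)) \<in> emb ` carrier A" using hit that by simp
    moreover have "j < k + i" "k + i \<le> length w" using that(1,2) ij by auto
    ultimately show False using max by blast
  qed
  have ji: "j - i \<le> length ?u" "drop (j - i) ?u = drop j (map rep w)" using ij by simp_all
  have l: "\<iota> a \<in> letters" "same_side e (\<iota> a)" using letter[OF a(1)] by auto
  have h: "\<iota> a = head_on e r" and t: "nf (drop j (map rep w)) = tail_on e r"
    using longest_prefix_is_syllable[OF lt(1) ji(1) e l x mx] ji(2) unfolding r_def by auto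
  show "a = un (head_on e r)" using un[of a] h by simp
  show "nf (drop j (map rep w)) = tail_on e r" by (rule t)
  show "j = length w" if nil: "nf (drop j (map rep w)) = []"
  proof (rule ccontr)
    assume "j \<noteq> length w"
    then have j: "j < length w" using ij by simp
    have "fp_eq G H (drop j (map rep w)) []" using fp_nf[OF lt(1)] nil by metis
    from fp_app[OF x this] have "fp_eq G H (take (j - i) ?u @ drop (j - i) ?u) [\<iota> a]" unfolding ji(2) by simp
    then have "fp_eq G H (take (length w - i) ?u) [\<iota> a]" unfolding append_take_drop_id by simp
    then show False using hit[OF l] max[OF j] by blast
  qed
qed

end

definition zero_vars :: vars where
  "zero_vars = \<lparr>sim_state = 0, sim_sym = 0, popped = 0, offset = 0, back_pass = False, busy = False,
     nonzero = False, again = False, running = False, answer = False, work_move = Stay, input_move = Stay\<rparr>"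

lemma wp_of_awp:
  assumes "awp w N K c (\<lambda>(f, p, L, R, a, b, o1). o1 = v) (zero_vars, 0, [], [], 0, 0, [])"
  shows "wp w N c (\<lambda>s. snd (snd (snd s)) = v) (zero_vars, 0, \<lambda>_. [], [])"
proof -
  have "shows_as K w (zero_vars, 0, [], [], 0, 0, []) (zero_vars, 0, \<lambda>_. [], [])"
    by (simp add: shows_as_def zero_vars_def counts_def)
  with assms have "wp w N c (\<lambda>s'. \<exists>\<sigma>'. shows_as K w \<sigma>' s' \<and> (\<lambda>(f, p, L, R, a, b, o1). o1 = v) \<sigma>')
      (zero_vars, 0, \<lambda>_. [], [])"
    unfolding awp_def by blast
  then show ?thesis
    by (rule wp_conseq) (auto simp: shows_as_def split: prod.splits)
qed

lemma logspace_machine: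
  assumes "logspace_computable X V h"
  shows "\<exists>M. \<exists>c :: nat. wf_transducer X V M \<and>
    (\<forall>u \<in> lists X. \<forall>t. real (work_pos (config_at M u t) + 1) \<le> real c * log 2 (real (length u) + 2)) \<and>
    (\<forall>u \<in> lists X. outputs M u (h u))"
  using assms unfolding logspace_computable_def logspace_bounded_def by blast

lemma finite_machine: "wf_transducer X V M \<Longrightarrow> finite (states M \<union> work_syms M)"
  by (simp add: wf_transducer_def)

lemma start_state: "wf_transducer X V M \<Longrightarrow> start M \<in> states M"
  by (simp add: wf_transducer_def)

text \<open>
  A normal form function is determined by values: \<open>nA\<close> selects the word of the normal form with
  a given value.
\<close>

lemma normal_form_by_value:
  assumes "logspace_normal_form_function G X f" "group G"
  shows "\<exists>nA. (\<forall>u \<in> lists X. f u = nA (word_val G u)) \<and>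
    (\<forall>g \<in> carrier G. nA g \<in> lists X \<and> word_val G (nA g) = g)"
proof -
  interpret group G by fact
  obtain L where L: "L \<subseteq> lists X" "bij_betw (word_val G) L (carrier G)"
    "\<And>w. w \<in> lists X \<Longrightarrow> f w \<in> L \<and> word_val G (f w) = word_val G w"
    using assms(1) unfolding logspace_normal_form_function_def normal_form_def by blast
  let ?n = "inv_into L (word_val G)"
  have "f u = ?n (word_val G u)" if "u \<in> lists X" for u
    using L(3)[OF that] inv_into_f_f[OF bij_betw_imp_inj_on[OF L(2)], of "f u"] by simp
  moreover have "?n g \<in> lists X \<and> word_val G (?n g) = g" if "g \<in> carrier G" for g
    using that L(1) inv_into_into[of g "word_val G" L] f_inv_into_f[of g "word_val G" L]
      bij_betw_imp_surj_on[OF L(2)] by auto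
  ultimately show ?thesis by blast
qed

theorem proposition28:
  fixes G :: "('a, 'c) monoid_scheme" and H :: "('b, 'd) monoid_scheme"
    and X :: "'a set" and Y :: "'b set"
  assumes "group G" and "group H"
    and "fin_sym_gen G X" and "fin_sym_gen H Y"
    and "has_logspace_normal_form G" and "has_logspace_normal_form H"
    and "has_logspace_word_problem (free_product G H)"
  shows "has_logspace_normal_form (free_product G H)"
proof -
  interpret two_groups G H by (rule two_groups.intro) fact+
  interpret P: group FP by (rule group_free_product[OF assms(1,2)])
  interpret gG: group G by (rule assms(1))
  interpret gH: group H by (rule assms(2))
  let ?l = "fp_inl G H" and ?r = "fp_inr G H"
  obtain XG fG where XG: "fin_sym_gen G XG" "logspace_normal_form_function G XG fG"
    using assms(5) by (auto simp: has_logspace_normal_form_def)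
  obtain XH fH where XH: "fin_sym_gen H XH" "logspace_normal_form_function H XH fH"
    using assms(6) by (auto simp: has_logspace_normal_form_def)
  obtain Z0 where Z0: "fin_sym_gen FP Z0" "logspace_decidable Z0 (word_problem FP Z0)"
    using assms(7) by (auto simp: has_logspace_word_problem_def)
  obtain nG where nG: "\<And>u. u \<in> lists XG \<Longrightarrow> fG u = nG (word_val G u)"
    "\<And>g. g \<in> carrier G \<Longrightarrow> nG g \<in> lists XG \<and> word_val G (nG g) = g"
    using normal_form_by_value[OF XG(2) assms(1)] by blast
  obtain nH where nH: "\<And>u. u \<in> lists XH \<Longrightarrow> fH u = nH (word_val H u)"
    "\<And>g. g \<in> carrier H \<Longrightarrow> nH g \<in> lists XH \<and> word_val H (nH g) = g"
    using normal_form_by_value[OF XH(2) assms(2)] by blast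
  obtain rG where rG: "rG \<in> hom FP G" "\<And>x. x \<in> carrier G \<Longrightarrow> rG (?l x) = x"
    "\<And>y. y \<in> carrier H \<Longrightarrow> rG (?r y) = \<one>\<^bsub>G\<^esub>" using retraction_left by blast
  obtain rH where rH: "rH \<in> hom FP H" "\<And>x. x \<in> carrier H \<Longrightarrow> rH (?r x) = x"
    "\<And>y. y \<in> carrier G \<Longrightarrow> rH (?l y) = \<one>\<^bsub>H\<^esub>" using retraction_right by blast
  interpret L: free_factor G H G ?l rG Inl projl left_one
    using rG fp_inl_hom[OF assms(1,2)] ones inl_cls
    by unfold_locales (auto simp: same_side_def left_one_def)
  interpret R: free_factor G H H ?r rH Inr projr right_one
    using rH fp_inr_hom[OF assms(1,2)] ones inr_cls
    by unfold_locales (auto simp: same_side_def right_one_def)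
  define Z where "Z = ?l ` XG \<union> ?r ` XH"
  have Zgen: "fin_sym_gen FP Z" unfolding Z_def by (rule fin_sym_gen_free_product[OF XG(1) XH(1)])
  have sub: "XG \<subseteq> carrier G" "XH \<subseteq> carrier H" "Z0 \<subseteq> carrier FP" "Z \<subseteq> carrier FP" "finite Z"
    using XG(1) XH(1) Z0(1) Zgen by (auto simp: fin_sym_gen_def)
  \<comment> \<open>The word problem is given over other generators \<open>Z0\<close>, so every element is expressed in these.\<close>
  have "\<exists>\<psi>. \<forall>x \<in> carrier FP. \<psi> x \<in> lists Z0 \<and> word_val FP (\<psi> x) = x"
    using P.word_val_onto[OF Z0(1)] by (intro bchoice) blast
  then obtain \<psi> where \<psi>: "\<And>x. x \<in> carrier FP \<Longrightarrow> \<psi> x \<in> lists Z0 \<and> word_val FP (\<psi> x) = x" by blast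
  define \<beta>G where "\<beta>G = (\<lambda>z. \<psi> (inv\<^bsub>FP\<^esub> (?l (rG z))))"
  define \<beta>H where "\<beta>H = (\<lambda>z. \<psi> (inv\<^bsub>FP\<^esub> (?r (rH z))))"
  \<comment> \<open>Projection to a factor erases the generators of the other one. An identity element among the
    generators of both factors does no harm, as it projects to a word for the identity either way.\<close>
  define \<alpha>G where "\<alpha>G = (\<lambda>z. if z \<in> ?l ` XG then [rG z] else [])"
  define \<alpha>H where "\<alpha>H = (\<lambda>z. if z \<in> ?r ` XH then [rH z] else [])"
  have \<alpha>G: "\<alpha>G z \<in> lists XG \<and> word_val G (\<alpha>G z) = rG z" if "z \<in> Z" for z
    using that sub rG by (auto simp: \<alpha>G_def Z_def subset_iff)
  have \<alpha>H: "\<alpha>H z \<in> lists XH \<and> word_val H (\<alpha>H z) = rH z" if "z \<in> Z" for z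
    using that sub rH by (auto simp: \<alpha>H_def Z_def subset_iff)
  define rep where "rep z = (if z \<in> ?l ` XG then Inl (rG z) else Inr (rH z))" for z
  have rep: "rep z \<in> letters \<and> z = cls [rep z]" if "z \<in> Z" for z
    using that sub rG(2) rH(2) inl_cls inr_cls by (auto simp: rep_def Z_def subset_iff)
  obtain MG cG where MG: "wf_transducer XG XG MG"
    "\<And>u t. u \<in> lists XG \<Longrightarrow> real (work_pos (config_at MG u t) + 1) \<le> real cG * log 2 (real (length u) + 2)"
    "\<And>u. u \<in> lists XG \<Longrightarrow> outputs MG u (fG u)"
    using XG(2) logspace_machine[of XG XG fG] unfolding logspace_normal_form_function_def by blast
  obtain MH cH where MH: "wf_transducer XH XH MH"
    "\<And>u t. u \<in> lists XH \<Longrightarrow> real (work_pos (config_at MH u t) + 1) \<le> real cH * log 2 (real (length u) + 2)"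
    "\<And>u. u \<in> lists XH \<Longrightarrow> outputs MH u (fH u)"
    using XH(2) logspace_machine[of XH XH fH] unfolding logspace_normal_form_function_def by blast
  obtain MW cW where MW: "wf_transducer Z0 (UNIV :: bool set) MW"
    "\<And>u t. u \<in> lists Z0 \<Longrightarrow> real (work_pos (config_at MW u t) + 1) \<le> real cW * log 2 (real (length u) + 2)"
    "\<And>u. u \<in> lists Z0 \<Longrightarrow> outputs MW u [u \<in> word_problem FP Z0]"
    using logspace_machine[OF Z0(2)[unfolded logspace_decidable_def]] by blast
  \<comment> \<open>One space constant and one bound \<open>D\<close> for all three machines and all blocks.\<close>
  define c where "c = cG + cH + cW"
  have more: "real k * log 2 (real n + 2) \<le> real c * log 2 (real n + 2)" if "k \<le> c" for k n
    using that log_ge_1[of n] by (intro mult_right_mono) auto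
  have cs: "cG \<le> c" "cH \<le> c" "cW \<le> c" by (auto simp: c_def)
  have space:
    "\<And>u t. u \<in> lists XG \<Longrightarrow> real (work_pos (config_at MG u t) + 1) \<le> real c * log 2 (real (length u) + 2)"
    "\<And>u t. u \<in> lists XH \<Longrightarrow> real (work_pos (config_at MH u t) + 1) \<le> real c * log 2 (real (length u) + 2)"
    "\<And>u t. u \<in> lists Z0 \<Longrightarrow> real (work_pos (config_at MW u t) + 1) \<le> real c * log 2 (real (length u) + 2)"
    using order_trans[OF MG(2) more[OF cs(1)]] order_trans[OF MH(2) more[OF cs(2)]]
      order_trans[OF MW(2) more[OF cs(3)]] by blast+
  let ?U = "(states MG \<union> work_syms MG) \<union> (states MH \<union> work_syms MH) \<union> (states MW \<union> work_syms MW) \<union>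
    (\<lambda>z. length (\<psi> z)) ` Z \<union> (\<lambda>z. length (\<beta>G z)) ` Z \<union> (\<lambda>z. length (\<beta>H z)) ` Z"
  have "finite ?U"
    using finite_machine[OF MG(1)] finite_machine[OF MH(1)] finite_machine[OF MW(1)] sub(5) by blast
  then obtain D0 where D0: "\<forall>n \<in> ?U. n < D0" unfolding finite_nat_set_iff_bounded by (rule exE)
  define D where "D = D0 + 2"
  have U: "n < D" if "n \<in> ?U" for n using bspec[OF D0 that] by (simp add: D_def)
  have D: "2 \<le> D" "1 \<le> D" by (auto simp: D_def)
  have sts: "states MG \<union> work_syms MG \<subseteq> {..<D}" "states MH \<union> work_syms MH \<subseteq> {..<D}"
    "states MW \<union> work_syms MW \<subseteq> {..<D}"
    using U by (simp_all add: subset_iff)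
  have start: "start MG < D" "start MH < D" "start MW < D"
    using sts start_state[OF MG(1)] start_state[OF MH(1)] start_state[OF MW(1)] by auto
  have len: "length (\<psi> z) \<le> D" "length (\<beta>G z) \<le> D" "length (\<beta>H z) \<le> D" "length (\<alpha>G z) \<le> D" "length (\<alpha>H z) \<le> D"
    if "z \<in> Z" for z
    using that U D by (auto simp: \<alpha>G_def \<alpha>H_def intro!: less_imp_le)
  define stepG where "stepG = factor_step (sim MW UNIV D \<psi> \<beta>G (\<lambda>_. []) (\<lambda>b. b))
    (sim MG XG D \<alpha>G (\<lambda>_. []) (\<lambda>v. [?l v]) (\<lambda>_. False))"
  define stepH where "stepH = factor_step (sim MW UNIV D \<psi> \<beta>H (\<lambda>_. []) (\<lambda>b. b))
    (sim MH XH D \<alpha>H (\<lambda>_. []) (\<lambda>v. [?r v]) (\<lambda>_. False))"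
  have "wf_prog Z Z (vars_ok D) {..<D} stepG"
    unfolding stepG_def
    by (intro wf_factor_step wf_sim D len start) (auto simp: Z_def)
  moreover have "wf_prog Z Z (vars_ok D) {..<D} stepH"
    unfolding stepH_def
    by (intro wf_factor_step wf_sim D len start) (auto simp: Z_def)
  ultimately have wf: "wf_prog Z Z (vars_ok D) {..<D} (main_prog stepG stepH)"
    by (intro wf_main_prog D)
  define pG where "pG x = map ?l (nG (projl x))" for x :: "'a + 'b"
  define pH where "pH x = map ?r (nH (projr x))" for x :: "'a + 'b"
  define f where "f w = syllables pG pH (nf (map rep w))" for w
  define k where "k = c * (2 * D + 1) + 1"
  define N where "N n = k * bits n + 1" for n
  have N: "c * (2 * D + 1) * bits n < N n" "bits n \<le> N n" for n
    by (auto simp: N_def k_def)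
  have run: "awp w (N (length w)) (bits (length w)) (main_prog stepG stepH)
      (\<lambda>(f', p, L, R, a, b, o1). o1 = f w) (zero_vars, 0, [], [], 0, 0, [])"
    if w: "w \<in> lists Z" for w
  proof -
    have repw: "\<And>z. z \<in> set w \<Longrightarrow> rep z \<in> letters \<and> z = cls [rep z]" using w rep by auto
    let ?s = "\<lambda>i. nf (drop i (map rep w))"
    show ?thesis
    proof (rule awp_main[where r = ?s and tc = "tail_on left_one" and td = "tail_on right_one"
          and oc = "\<lambda>x. pG (head_on left_one x)" and od = "\<lambda>x. pH (head_on right_one x)"
          and out = "syllables pG pH"])
      show "bits (length w) \<le> N (length w)" "length w < 2 ^ bits (length w)" by (rule N, rule bits_bounds)
      show "?s (length w) = []" by (simp add: nf_def)
      show "syllables pG pH x = pG (head_on left_one x) @ pH (head_on right_one (tail_on left_one x)) @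
          (if tail_on right_one (tail_on left_one x) = [] then []
           else syllables pG pH (tail_on right_one (tail_on left_one x)))" for x
        by (rule syllables.simps)
      show "length (tail_on right_one (tail_on left_one x)) < length x"
        if "tail_on right_one (tail_on left_one x) \<noteq> []" for x
        using that by (intro tail_on_shorter ones) (auto simp: tail_on_def)
      show "case (f', length w, [], [], 0, 0, [] @ syllables pG pH (?s 0)) of
          (f', p, L, R, a, b, o1) \<Rightarrow> o1 = f w" for f' :: vars
        by (simp add: f_def)
      show "0 \<le> length w" by simp
    next
      fix i f0 and Q :: "('a + 'b) list set astate \<Rightarrow> bool" and o1 :: "('a + 'b) list set list"
      assume i: "i \<le> length w" and Q: "\<And>f' j. j \<le> length w \<Longrightarrow> ?s j = tail_on left_one (?s i) \<Longrightarrow>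
        Q (f', j, [], [], 0, 0, o1 @ pG (head_on left_one (?s i)))"
      show "awp w (N (length w)) (bits (length w)) stepG Q (f0, i, [], [], 0, 0, o1)"
        unfolding stepG_def
      proof (rule L.awp_retract_step[where nA = nG, OF sub(4) w sub(3) \<psi> \<beta>G_def _ D(2) MW(1) sts(3) space(3) MW(3)
            MG(1) sts(1) space(1) _ sub(1) \<alpha>G N i])
        fix f' :: vars and j a
        assume j: "i \<le> j" "j \<le> length w" "a \<in> carrier G" "word_val FP (take (j - i) (drop i w)) = ?l a"
          "\<And>k. j < k \<Longrightarrow> k \<le> length w \<Longrightarrow> word_val FP (take (k - i) (drop i w)) \<notin> ?l ` carrier G"
        note syl = L.longest_window[OF repw j]
        have "Q (f', j, [], [], 0, 0, o1 @ pG (head_on left_one (?s i)))" by (rule Q[OF j(2) syl(2)])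
        then show "Q (f', j, [], [], 0, 0, o1 @ map ?l (nG a))" using syl(1) by (simp only: pG_def)
      qed (use len MG(3) nG(1) in auto)
    next
      fix i f0 and Q :: "('a + 'b) list set astate \<Rightarrow> bool" and o1 :: "('a + 'b) list set list"
      assume i: "i \<le> length w" and Q: "\<And>f' j. j \<le> length w \<Longrightarrow> ?s j = tail_on right_one (?s i) \<Longrightarrow>
        (?s j = [] \<Longrightarrow> j = length w) \<Longrightarrow> Q (f', j, [], [], 0, 0, o1 @ pH (head_on right_one (?s i)))"
      show "awp w (N (length w)) (bits (length w)) stepH Q (f0, i, [], [], 0, 0, o1)"
        unfolding stepH_def
      proof (rule R.awp_retract_step[where nA = nH, OF sub(4) w sub(3) \<psi> \<beta>H_def _ D(2) MW(1) sts(3) space(3) MW(3)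
            MH(1) sts(2) space(2) _ sub(2) \<alpha>H N i])
        fix f' :: vars and j a
        assume j: "i \<le> j" "j \<le> length w" "a \<in> carrier H" "word_val FP (take (j - i) (drop i w)) = ?r a"
          "\<And>k. j < k \<Longrightarrow> k \<le> length w \<Longrightarrow> word_val FP (take (k - i) (drop i w)) \<notin> ?r ` carrier H"
        note syl = R.longest_window[OF repw j]
        have "Q (f', j, [], [], 0, 0, o1 @ pH (head_on right_one (?s i)))" by (rule Q[OF j(2) syl(2,3)])
        then show "Q (f', j, [], [], 0, 0, o1 @ map ?r (nH a))" using syl(1) by (simp only: pH_def)
      qed (use len MH(3) nH(1) in auto)
    qed
  qed
  have comp: "logspace_computable Z Z f"
  proof (rule logspace_computable_prog[where N = N and d = "2 * k + 2"])
    show "finite Z" "finite Z" "finite (vars_ok D)" "finite {..<D}"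
      using sub(5) finite_vars_ok by auto
    show "zero_vars \<in> vars_ok D" using D by (simp add: zero_vars_def vars_ok_def)
    show "wf_prog Z Z (vars_ok D) {..<D} (main_prog stepG stepH)" by (rule wf)
    show "wp w (N (length w)) (main_prog stepG stepH) (\<lambda>s. snd (snd (snd s)) = f w)
        (zero_vars, 0, \<lambda>_. [], [])" if "w \<in> lists Z" for w
      by (rule wp_of_awp[OF run[OF that]])
    show "real (N n + 1) \<le> real (2 * k + 2) * log 2 (real n + 2)" for n
    proof -
      have "real (N n + 1) = real k * real (bits n) + 2" by (simp add: N_def)
      also have "\<dots> \<le> real k * (2 * log 2 (real n + 2)) + 2 * log 2 (real n + 2)"
        using bits_bounds(3)[of n] log_ge_1[of n] by (intro add_mono mult_left_mono) auto
      finally show ?thesis by (simp add: algebra_simps)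
    qed
  qed
  have nfw: "reduced (nf (map rep w)) \<and> map rep w \<in> lists letters \<and> cls (map rep w) = word_val FP w \<and>
      cls (nf (map rep w)) = word_val FP w" if "w \<in> lists Z" for w
  proof -
    have l: "map rep w \<in> lists letters" using that rep by auto
    have "word_val FP w = cls (map rep w)" by (rule cls_word) (use that rep in auto)
    then show ?thesis using l reduced_nf[OF l] fp_nf[OF l] cls_eq[OF l, of "nf (map rep w)"]
        reduced_lists by auto
  qed
  have pG: "pG (head_on left_one r) \<in> lists Z \<and> word_val FP (pG (head_on left_one r)) = cls [head_on left_one r]"
    if "reduced r" for r
  proof -
    note h = L.head_cls[OF that]
    have "nG (projl (head_on left_one r)) \<in> lists (carrier G)" using nG(2)[OF h(1)] sub(1) lists_mono by blast
    from hom_word_val[OF assms(1) P.is_group fp_inl_hom[OF assms(1,2)] this]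
    show ?thesis using nG(2)[OF h(1)] h(2) by (auto simp: pG_def Z_def)
  qed
  have pH: "pH (head_on right_one r) \<in> lists Z \<and> word_val FP (pH (head_on right_one r)) = cls [head_on right_one r]"
    if "reduced r" for r
  proof -
    note h = R.head_cls[OF that]
    have "nH (projr (head_on right_one r)) \<in> lists (carrier H)" using nH(2)[OF h(1)] sub(2) lists_mono by blast
    from hom_word_val[OF assms(2) P.is_group fp_inr_hom[OF assms(1,2)] this]
    show ?thesis using nH(2)[OF h(1)] h(2) by (auto simp: pH_def Z_def)
  qed
  have f: "f w \<in> lists Z \<and> word_val FP (f w) = word_val FP w" if "w \<in> lists Z" for w
    using syllables_value[OF sub(4) pG pH, of "nf (map rep w)"] nfw[OF that] by (simp add: f_def)
  \<comment> \<open>The output depends on the element only, so the set of outputs is a normal form.\<close>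
  have inj: "f w = f v" if "w \<in> lists Z" "v \<in> lists Z" "word_val FP w = word_val FP v" for w v
  proof -
    have "fp_eq G H (map rep w) (map rep v)"
      using nfw[OF that(1)] nfw[OF that(2)] that(3) cls_eq by metis
    then show ?thesis using nf_fp_eq by (simp add: f_def)
  qed
  have "normal_form FP Z (f ` lists Z)"
    unfolding normal_form_def bij_betw_def
  proof (intro conjI)
    show "f ` lists Z \<subseteq> lists Z" using f by blast
    show "inj_on (word_val FP) (f ` lists Z)"
    proof (rule inj_onI)
      fix x y assume "x \<in> f ` lists Z" "y \<in> f ` lists Z" and eq: "word_val FP x = word_val FP y"
      then obtain u v where u: "u \<in> lists Z" "x = f u" and v: "v \<in> lists Z" "y = f v" by blast
      have "word_val FP u = word_val FP v" using f[OF u(1)] f[OF v(1)] eq by (simp add: u v)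
      from inj[OF u(1) v(1) this] show "x = y" by (simp only: u v)
    qed
    show "word_val FP ` f ` lists Z = carrier FP"
    proof
      show "word_val FP ` f ` lists Z \<subseteq> carrier FP"
      proof
        fix g assume "g \<in> word_val FP ` f ` lists Z"
        then obtain u where "u \<in> lists Z" "g = word_val FP (f u)" by blast
        moreover have "f u \<in> lists (carrier FP)" using f[OF calculation(1)] lists_mono[OF sub(4)] by blast
        ultimately show "g \<in> carrier FP" using P.word_val_closed by simp
      qed
      show "carrier FP \<subseteq> word_val FP ` f ` lists Z"
      proof
        fix g assume "g \<in> carrier FP"
        then obtain u where u: "u \<in> lists Z" "word_val FP u = g" using P.word_val_onto[OF Zgen] by blast
        have "g = word_val FP (f u)" using f[OF u(1)] u(2) by simp
        then show "g \<in> word_val FP ` f ` lists Z" using u(1) by blast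
      qed
    qed
  qed
  then have "logspace_normal_form_function FP Z f"
    unfolding logspace_normal_form_function_def using comp f by blast
  then show ?thesis unfolding has_logspace_normal_form_def using Zgen by blast
qed

end
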